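(* Let $0<\alpha<n$, $1<p<\frac n\alpha$, $\frac1q=\frac1p-\frac\alpha n$, $0<k<\frac pq$ and $w\in A_{(p,q)}$. Let $K_\alpha$ be a standard fractional Calderón–Zygmund kernel (SFCZK), let $P(x,y)$ be a real-valued polynomial on $\mathbb{R}^n\times\mathbb{R}^n$, and let $$S_\alpha f(x)=\int_{\mathbb{R}^n}e^{iP(x,y)}K_\alpha(x,y)f(y)\,dy .$$ Let $b\in BMO(\mathbb{R}^n)$ and $$S_{\alpha,b}f(x)=[b,S_\alpha]f(x)=b(x)S_\alpha f(x)-S_\alpha(bf)(x).$$ Then there exists a constant $C>0$ such that for all $f\in M_{p,k}(w^p,w^q)$, $$\|S_{\alpha,b}f\|_{M_{q,\frac{qk}{p}}(w^q)}\le C\,\|f\|_{M_{p,k}(w^p,w^q)} .$$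
   Context: A weight is a locally integrable function on $\mathbb{R}^n$ taking values in $(0,\infty)$ almost everywhere; for a weight $v$, $v(E)=\int_E v(x)\,dx$. For $1<p,q<\infty$, $w\in A_{(p,q)}$ means $$\sup_B\left(\frac1{|B|}\int_Bw(x)^q\,dx\right)^{1/q}\left(\frac1{|B|}\int_Bw(x)^{-p'}dx\right)^{1/p'}<\infty,\qquad \tfrac1p+\tfrac1{p'}=1,$$ supremum over all balls $B\subset\mathbb{R}^n$. A kernel $K_\alpha$ on $\mathbb{R}^n\times\mathbb{R}^n$ is a standard fractional Calderón–Zygmund kernel (SFCZK) if for some constant $C$ and all $x\neq y$: $|K_\alpha(x,y)|\le C|x-y|^{-(n-\alpha)}$ and $|\nabla_xK_\alpha(x,y)|+|\nabla_yK_\alpha(x,y)|\le C|x-y|^{-(n+1-\alpha)}$. Weighted Morrey spaces: for $1\le p<\infty$, $0<k<1$ and weights $w_1,w_2$, $M_{p,k}(w_1,w_2)$ is the space of $f$ with $$\|f\|_{M_{p,k}(w_1,w_2)}=\sup_B\left(\frac1{w_2(B)^k}\int_B|f(x)|^pw_1(x)\,dx\right)^{1/p}<\infty,$$ supremum over all balls $B\subset\mathbb{R}^n$; and $M_{p,k}(w)=M_{p,k}(w,w)$. $BMO(\mathbb{R}^n)$ is the space of locally integrable $b$ with $\|b\|_{BMO(\mathbb{R}^n)}=\sup_B\frac1{|B|}\int_B|b(x)-b_B|\,dx<\infty$, where $b_B=\frac1{|B|}\int_Bb(x)\,dx$. *)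

theory Defs
  imports "HOL-Analysis.Analysis"
begin

text \<open>
  Possibly infinite quantities (Morrey norms, the suprema over balls) are
  extended nonnegative reals.  They are raised only to positive exponents, for
  which \<open>\<infinity>\<close> to the power \<open>a\<close> is \<open>\<infinity>\<close>.
\<close>

definition ennreal_powr :: "ennreal \<Rightarrow> real \<Rightarrow> ennreal" where
  "ennreal_powr t a = (if t = \<infinity> then \<infinity> else ennreal (enn2real t powr a))"

definition locally_integrable :: "(real^'n \<Rightarrow> 'b::{banach, second_countable_topology}) \<Rightarrow> bool" where
  "locally_integrable f \<longleftrightarrow> (\<forall>S. compact S \<longrightarrow> set_integrable lebesgue S f)"

definition weight :: "(real^'n \<Rightarrow> real) \<Rightarrow> bool" where
  "weight v \<longleftrightarrow> locally_integrable v \<and> (AE x in lebesgue. 0 < v x)"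

definition wmeasure :: "(real^'n \<Rightarrow> real) \<Rightarrow> (real^'n) set \<Rightarrow> ennreal" where
  "wmeasure v E = (\<integral>\<^sup>+x\<in>E. ennreal (v x) \<partial>lebesgue)"

definition balls :: "(real^'n) set set" where
  "balls = {ball x r | x r. 0 < r}"

definition conj_exp :: "real \<Rightarrow> real" where
  "conj_exp p = (THE p'. 1 / p + 1 / p' = 1)"

definition A_pq :: "real \<Rightarrow> real \<Rightarrow> (real^'n \<Rightarrow> real) set" where
  "A_pq p q = {w. weight w \<and>
     (SUP B\<in>balls.
        ennreal_powr ((\<integral>\<^sup>+x\<in>B. ennreal (w x powr q) \<partial>lebesgue) / emeasure lebesgue B) (1 / q) *
        ennreal_powr ((\<integral>\<^sup>+x\<in>B. ennreal (w x powr (- conj_exp p)) \<partial>lebesgue) / emeasure lebesgue B)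
          (1 / conj_exp p)) < \<infinity>}"

text \<open>The norm on \<^typ>\<open>complex^'n\<close> is the Euclidean norm of the vector of partial derivatives.\<close>

definition gradient :: "(real^'n \<Rightarrow> complex) \<Rightarrow> real^'n \<Rightarrow> complex^'n" where
  "gradient g x = (\<chi> i. frechet_derivative g (at x) (axis i 1))"

definition SFCZK :: "real \<Rightarrow> (real^'n \<Rightarrow> real^'n \<Rightarrow> complex) \<Rightarrow> bool" where
  "SFCZK \<alpha> K \<longleftrightarrow> (\<exists>C. \<forall>x y. x \<noteq> y \<longrightarrow>
      norm (K x y) \<le> C * norm (x - y) powr (- (real CARD('n) - \<alpha>)) \<and>
      (\<lambda>u. K u y) differentiable (at x) \<and>
      (\<lambda>v. K x v) differentiable (at y) \<and>
      norm (gradient (\<lambda>u. K u y) x) + norm (gradient (\<lambda>v. K x v) y)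
        \<le> C * norm (x - y) powr (- (real CARD('n) + 1 - \<alpha>)))"

definition morrey_norm ::
  "real \<Rightarrow> real \<Rightarrow> (real^'n \<Rightarrow> real) \<Rightarrow> (real^'n \<Rightarrow> real) \<Rightarrow> (real^'n \<Rightarrow> complex) \<Rightarrow> ennreal" where
  "morrey_norm p k w1 w2 f =
     (SUP B\<in>balls.
        ennreal_powr
          (1 / ennreal_powr (wmeasure w2 B) k *
           (\<integral>\<^sup>+x\<in>B. ennreal (norm (f x) powr p * w1 x) \<partial>lebesgue)) (1 / p))"

definition morrey_space ::
  "real \<Rightarrow> real \<Rightarrow> (real^'n \<Rightarrow> real) \<Rightarrow> (real^'n \<Rightarrow> real) \<Rightarrow> (real^'n \<Rightarrow> complex) set" where
  "morrey_space p k w1 w2 = {f \<in> borel_measurable lebesgue. morrey_norm p k w1 w2 f < \<infinity>}"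

definition average :: "(real^'n) set \<Rightarrow> (real^'n \<Rightarrow> complex) \<Rightarrow> complex" where
  "average B b = (LINT x:B|lebesgue. b x) /\<^sub>R measure lebesgue B"

definition bmo_norm :: "(real^'n \<Rightarrow> complex) \<Rightarrow> ennreal" where
  "bmo_norm b =
     (SUP B\<in>balls. (\<integral>\<^sup>+x\<in>B. ennreal (norm (b x - average B b)) \<partial>lebesgue) / emeasure lebesgue B)"

definition BMO :: "(real^'n \<Rightarrow> complex) set" where
  "BMO = {b. locally_integrable b \<and> bmo_norm b < \<infinity>}"

definition osc_integrand ::
  "(real^'n \<Rightarrow> real^'n \<Rightarrow> real) \<Rightarrow> (real^'n \<Rightarrow> real^'n \<Rightarrow> complex) \<Rightarrow> (real^'n \<Rightarrow> complex)
     \<Rightarrow> real^'n \<Rightarrow> real^'n \<Rightarrow> complex" where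
  "osc_integrand P K f x y = exp (\<i> * of_real (P x y)) * K x y * f y"

text \<open>The Bochner integral has the value 0 at points \<open>x\<close> where the integrand is not integrable;
  absolute convergence is therefore expressed separately.\<close>

definition osc_op ::
  "(real^'n \<Rightarrow> real^'n \<Rightarrow> real) \<Rightarrow> (real^'n \<Rightarrow> real^'n \<Rightarrow> complex) \<Rightarrow> (real^'n \<Rightarrow> complex)
     \<Rightarrow> real^'n \<Rightarrow> complex" where
  "osc_op P K f x = (LINT y|lebesgue. osc_integrand P K f x y)"

definition osc_defined_ae ::
  "(real^'n \<Rightarrow> real^'n \<Rightarrow> real) \<Rightarrow> (real^'n \<Rightarrow> real^'n \<Rightarrow> complex) \<Rightarrow> (real^'n \<Rightarrow> complex) \<Rightarrow> bool" where
  "osc_defined_ae P K f \<longleftrightarrow> (AE x in lebesgue. integrable lebesgue (osc_integrand P K f x))"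

definition commutator ::
  "(real^'n \<Rightarrow> complex) \<Rightarrow> ((real^'n \<Rightarrow> complex) \<Rightarrow> real^'n \<Rightarrow> complex) \<Rightarrow> (real^'n \<Rightarrow> complex)
     \<Rightarrow> real^'n \<Rightarrow> complex" where
  "commutator b T f x = b x * T f x - T (\<lambda>y. b y * f y) x"

end

theory Submission
  imports Defs
begin

text \<open>
  The oscillating factor plays no role: the size of the kernel gives
  \<open>|S\<^bsub>\<alpha>,b\<^esub> f x| \<le> C \<integral> |b x - b y| |x - y| powr (\<alpha> - n) |f y| dy\<close>, and \<open>t \<le> exp (e * t) / e\<close> replaces
  \<open>|b x - b y|\<close> by exponentials \<open>exp (h x - h y)\<close> with \<open>h\<close> a small multiple of the real or imaginary part
  of \<open>\<plusminus>b\<close>. Such a factor only changes the weight \<open>w\<close> to \<open>w * exp h\<close>, which is again in \<open>A_pq p q\<close> by a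
  weighted John--Nirenberg inequality. So everything reduces to the weighted bound
  \<open>L\<^sup>p(w\<^sup>p) \<rightarrow> L\<^sup>q(w\<^sup>q)\<close> of the positive fractional integral, which follows from Hedberg's argument with
  the radius of a ball replaced by its measure under \<open>w\<^sup>q\<close> and from Lerner's proof of the maximal
  theorem. On a ball, the part of \<open>f\<close> far away is summed over dilated balls; the sum converges for
  small \<open>e\<close> because \<open>k < p / q\<close> and \<open>w\<^sup>q\<close> satisfies a reverse doubling condition.
\<close>

section \<open>Powers of extended nonnegative reals\<close>

text \<open>A linear bound for the positive kernel cannot absorb \<open>b x - b y\<close>, because
  no single constant approximates an unbounded \<open>b\<close> at all scales. A factor exp(h x - h
  y) can be absorbed: it is a conjugation, so a bound valid for every weight of the class already
  contains it. Positivity of the kernel lets pointwise domination do the rest, with one fixed small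
  \<open>e\<close>.

  The exponents fit together through \<tau> = 1/q + 1 - 1/p: \<theta> \<tau> = 1/q, (1 - \<theta>)
  \<tau> = 1 - 1/p and n \<tau> = n - \<alpha>. Raised to the power \<tau>, the ball condition
  bounds r powr (\<alpha> - n) times s(B) powr (1 - 1/p) by a constant times u(B) powr (-1/q). A
  scale then enters only through u(B), which is why the optimization runs over the
  \<open>u\<close>-measure and why reverse doubling makes every dyadic sum geometric.

  The smallness of \<open>e\<close> is used three times: to keep the perturbed pair in the class, to
  let the decay over dilated balls beat the growth exp(e j \<delta>) caused by the drift of the
  local means of \<open>b\<close>, and to integrate exp(e q |b - c|) against \<open>u\<close> over a
  ball.\<close>

lemma ennreal_powr_ennreal [simp]: "0 \<le> x \<Longrightarrow> ennreal_powr (ennreal x) a = ennreal (x powr a)"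
  by (simp add: ennreal_powr_def)

lemma ennreal_powr_top [simp]: "ennreal_powr top a = top"
  by (simp add: ennreal_powr_def)

lemma ennreal_powr_zero [simp]: "ennreal_powr 0 a = 0"
  by (simp add: ennreal_powr_def)

lemma ennreal_powr_1 [simp]: "ennreal_powr 1 a = 1"
  by (simp add: ennreal_powr_def)

lemma ennreal_powr_one [simp]: "ennreal_powr t 1 = t"
  by (cases t) (auto)

lemma ennreal_powr_mono: "0 \<le> a \<Longrightarrow> s \<le> t \<Longrightarrow> ennreal_powr s a \<le> ennreal_powr t a"
  by (cases s; cases t) (auto simp: top_unique intro!: ennreal_leI powr_mono2)

text \<open>\<open>0 powr a = 0\<close> for every \<open>a\<close>, also for
  \<open>a \<le> 0\<close>, and infinity is fixed by definition. Hence this and the identities below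
  hold without sign conditions on the exponent.\<close>

lemma ennreal_powr_eq_0_iff [simp]: "ennreal_powr t a = 0 \<longleftrightarrow> t = 0"
  by (cases t) (auto)

lemma ennreal_powr_eq_top_iff [simp]: "ennreal_powr t a = top \<longleftrightarrow> t = top"
  by (cases t) (auto)

lemma ennreal_powr_less_top_iff [simp]: "ennreal_powr t a < top \<longleftrightarrow> t < top"
  by (cases t) (auto)

lemma ennreal_powr_pos_iff [simp]: "0 < ennreal_powr t a \<longleftrightarrow> 0 < t"
  by (cases t) (auto simp: zero_less_iff_neq_zero)

lemma ennreal_powr_powr: "ennreal_powr (ennreal_powr t a) b = ennreal_powr t (a * b)"
  by (cases t) (auto simp: powr_powr)

lemma ennreal_powr_add: "ennreal_powr t (a + b) = ennreal_powr t a * ennreal_powr t b"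
  by (cases t) (auto simp: powr_add ennreal_mult)

lemma ennreal_powr_mult: "ennreal_powr (s * t) a = ennreal_powr s a * ennreal_powr t a"
  by (cases s; cases t; cases "s = 0"; cases "t = 0") 
     (auto simp: powr_mult ennreal_mult[symmetric] ennreal_top_mult ennreal_mult_top)

lemma measurable_ennreal_powr [measurable (raw)]:
  assumes [measurable]: "f \<in> borel_measurable M"
  shows "(\<lambda>x. ennreal_powr (f x) a) \<in> borel_measurable M"
proof -
  have "{x \<in> space M. f x = \<infinity>} \<in> sets M" by measurable
  then show ?thesis unfolding ennreal_powr_def by (intro measurable_If) measurable
qed

lemma ennreal_powr_add_le:
  assumes "0 \<le> a"
  shows "ennreal_powr (s + t) a \<le> ennreal (2 powr a) * (ennreal_powr s a + ennreal_powr t a)"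
proof -
  have *: "ennreal_powr (s + t) a \<le> ennreal (2 powr a) * (ennreal_powr s a + ennreal_powr t a)" if "s \<le> t" for s t
  proof -
    have "s + t \<le> 2 * t" using that by (simp add: mult_2 add_mono)
    then have "ennreal_powr (s + t) a \<le> ennreal_powr (2 * t) a" by (intro ennreal_powr_mono assms)
    also have "\<dots> = ennreal (2 powr a) * ennreal_powr t a"
      using ennreal_powr_ennreal[of 2 a] by (simp add: ennreal_powr_mult)
    also have "\<dots> \<le> ennreal (2 powr a) * (ennreal_powr s a + ennreal_powr t a)"
      by (intro mult_left_mono) auto
    finally show ?thesis .
  qed
  show ?thesis using *[of s t] *[of t s] by (cases "s \<le> t") (auto simp: add.commute)
qed

section \<open>Young and Hoelder inequalities with values in [0, \<infinity>]\<close>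

lemma ennreal_Young:
  assumes "0 < \<theta>" "\<theta> < 1"
  shows "ennreal_powr s \<theta> * ennreal_powr t (1 - \<theta>) \<le> ennreal \<theta> * s + ennreal (1 - \<theta>) * t"
proof (cases "s = 0 \<or> t = 0 \<or> s = top \<or> t = top")
  case True
  then show ?thesis using assms by (auto simp: ennreal_mult_top)
next
  case False
  then obtain x y where xy: "s = ennreal x" "t = ennreal y" "0 < x" "0 < y"
    by (cases s; cases t) (auto simp: less_le)
  then show ?thesis using assms Youngs_inequality_0[of \<theta> "1-\<theta>" x y]
    by (simp add: ennreal_mult[symmetric] ennreal_plus[symmetric] del: ennreal_plus)
qed

text \<open>The exponents \<theta> and 1 - \<theta> sit on the integrands, which is the shape a
  Muckenhoupt pair provides. After division by the two integrals, Young's inequality gives the bound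
  \<theta> + (1 - \<theta>) = 1; vanishing and infinite integrals cannot be normalized and are split
  off.\<close>

lemma nn_integral_Holder:
  assumes th: "0 < \<theta>" "\<theta> < 1" and [measurable]: "F \<in> borel_measurable M" "G \<in> borel_measurable M"
  shows "(\<integral>\<^sup>+x. ennreal_powr (F x) \<theta> * ennreal_powr (G x) (1 - \<theta>) \<partial>M)
     \<le> ennreal_powr (\<integral>\<^sup>+x. F x \<partial>M) \<theta> * ennreal_powr (\<integral>\<^sup>+x. G x \<partial>M) (1 - \<theta>)"
proof -
  define A where "A = (\<integral>\<^sup>+x. F x \<partial>M)"
  define B where "B = (\<integral>\<^sup>+x. G x \<partial>M)"
  consider "A = 0" | "B = 0" | "A \<noteq> 0" "B \<noteq> 0" "A = top \<or> B = top"
    | "A \<noteq> 0" "B \<noteq> 0" "A \<noteq> top" "B \<noteq> top" by auto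
  then show ?thesis
  proof cases
    case 1
    then have "AE x in M. F x = 0" unfolding A_def by (subst (asm) nn_integral_0_iff_AE) auto
    then have "(\<integral>\<^sup>+x. ennreal_powr (F x) \<theta> * ennreal_powr (G x) (1 - \<theta>) \<partial>M) = (\<integral>\<^sup>+x. 0 \<partial>M)"
      by (intro nn_integral_cong_AE) auto
    then show ?thesis by simp
  next
    case 2
    then have "AE x in M. G x = 0" unfolding B_def by (subst (asm) nn_integral_0_iff_AE) auto
    then have "(\<integral>\<^sup>+x. ennreal_powr (F x) \<theta> * ennreal_powr (G x) (1 - \<theta>) \<partial>M) = (\<integral>\<^sup>+x. 0 \<partial>M)"
      by (intro nn_integral_cong_AE) auto
    then show ?thesis by simp
  next
    case 3
    then show ?thesis unfolding A_def[symmetric] B_def[symmetric]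
      by (auto simp: ennreal_top_mult ennreal_mult_top)
  next
    case 4
    have inv: "inverse A * A = 1" "inverse B * B = 1"
      using 4 by (auto simp: ennreal_inverse_mult less_top mult.commute divide_ennreal_def[symmetric] ennreal_divide_self)
    define D where "D = ennreal_powr A \<theta> * ennreal_powr B (1 - \<theta>)"
    have "(\<integral>\<^sup>+x. ennreal_powr (F x) \<theta> * ennreal_powr (G x) (1 - \<theta>) \<partial>M)
      = (\<integral>\<^sup>+x. D * (ennreal_powr (inverse A * F x) \<theta> * ennreal_powr (inverse B * G x) (1 - \<theta>)) \<partial>M)"
    proof (intro nn_integral_cong)
      fix x
      have "ennreal_powr (F x) \<theta> = ennreal_powr A \<theta> * ennreal_powr (inverse A * F x) \<theta>"
        "ennreal_powr (G x) (1-\<theta>) = ennreal_powr B (1-\<theta>) * ennreal_powr (inverse B * G x) (1-\<theta>)"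
        unfolding ennreal_powr_mult[symmetric] using inv by (simp_all add: mult.assoc[symmetric] mult.commute)
      then show "ennreal_powr (F x) \<theta> * ennreal_powr (G x) (1 - \<theta>)
        = D * (ennreal_powr (inverse A * F x) \<theta> * ennreal_powr (inverse B * G x) (1 - \<theta>))"
        unfolding D_def by (simp add: mult_ac)
    qed
    also have "\<dots> = D * (\<integral>\<^sup>+x. ennreal_powr (inverse A * F x) \<theta> * ennreal_powr (inverse B * G x) (1 - \<theta>) \<partial>M)"
      by (rule nn_integral_cmult) measurable
    also have "\<dots> \<le> D * (\<integral>\<^sup>+x. ennreal \<theta> * (inverse A * F x) + ennreal (1-\<theta>) * (inverse B * G x) \<partial>M)"
      by (intro mult_left_mono nn_integral_mono ennreal_Young th) auto
    also have "(\<integral>\<^sup>+x. ennreal \<theta> * (inverse A * F x) + ennreal (1-\<theta>) * (inverse B * G x) \<partial>M)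
       = ennreal \<theta> * (inverse A * A) + ennreal (1-\<theta>) * (inverse B * B)"
      by (simp add: nn_integral_add nn_integral_cmult A_def B_def)
    also have "\<dots> = 1" using th by (simp add: inv ennreal_plus[symmetric] del: ennreal_plus)
    finally show ?thesis by (simp add: D_def A_def B_def)
  qed
qed

section \<open>Muckenhoupt pairs of weights\<close>

definition wm :: "(real^'n \<Rightarrow> real) \<Rightarrow> (real^'n) measure" where
  "wm u = density lebesgue (\<lambda>x. ennreal (u x))"

lemma sets_wm [simp, measurable_cong]: "sets (wm u) = sets lebesgue"
  by (simp add: wm_def)

lemma space_wm [simp]: "space (wm u) = UNIV"
  by (simp add: wm_def)

text \<open>For \<open>w \<in> A_pq p q\<close> the pair is \<open>u = w\<^sup>q\<close>, \<open>s = w powr - p'\<close> with \<open>\<theta> = p' / (q + p')\<close>; in this form the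
  condition is symmetric under exchanging \<open>(u, \<theta>)\<close> and \<open>(s, 1 - \<theta>)\<close>.\<close>

locale muckenhoupt_pair =
  fixes u s :: "real^'n \<Rightarrow> real" and \<theta> K :: real
  assumes theta: "0 < \<theta>" "\<theta> < 1"
    and meas_u [measurable]: "u \<in> borel_measurable lebesgue"
    and meas_s [measurable]: "s \<in> borel_measurable lebesgue"
    and dual: "AE x in lebesgue. 0 < u x \<and> 0 < s x \<and> u x powr \<theta> * s x powr (1 - \<theta>) = 1"
    and finite_u: "emeasure (wm u) (ball x r) < \<infinity>"
    and finite_s: "emeasure (wm s) (ball x r) < \<infinity>"
    and ball_cond: "0 < r \<Longrightarrow>
      measure (wm u) (ball x r) powr \<theta> * measure (wm s) (ball x r) powr (1 - \<theta>) \<le> K * r ^ CARD('n)"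
begin

abbreviation "ub x r \<equiv> measure (wm u) (ball x r)"
abbreviation "sb x r \<equiv> measure (wm s) (ball x r)"

lemma swap: "muckenhoupt_pair s u (1 - \<theta>) K"
proof
  show "AE x in lebesgue. 0 < s x \<and> 0 < u x \<and> s x powr (1 - \<theta>) * u x powr (1 - (1 - \<theta>)) = 1"
    using dual by eventually_elim (simp add: mult.commute)
qed (use theta finite_u finite_s ball_cond in \<open>auto simp: mult.commute\<close>)

lemma emeasure_wm: "E \<in> sets lebesgue \<Longrightarrow> emeasure (wm u) E = (\<integral>\<^sup>+x\<in>E. ennreal (u x) \<partial>lebesgue)"
  "E \<in> sets lebesgue \<Longrightarrow> emeasure (wm s) E = (\<integral>\<^sup>+x\<in>E. ennreal (s x) \<partial>lebesgue)"
  unfolding wm_def by (simp_all add: emeasure_density)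

lemma fmeasurable_wm: "E \<in> sets lebesgue \<Longrightarrow> E \<subseteq> ball x r \<Longrightarrow> E \<in> fmeasurable (wm u)"
  "E \<in> sets lebesgue \<Longrightarrow> E \<subseteq> ball x r \<Longrightarrow> E \<in> fmeasurable (wm s)"
  using finite_u[of x r] finite_s[of x r] 
  by (auto intro!: fmeasurableI le_less_trans[OF emeasure_mono[of E "ball x r"]])

text \<open>Hoelder applied to 1 = u^\<theta> s^(1-\<theta>). This is the reverse of
  \<open>ball_cond\<close>, for arbitrary sets; on balls the two together make u(B)^\<theta>
  s(B)^(1-\<theta>) comparable with the volume.\<close>

lemma measure_le_Holder:
  assumes "E \<in> sets lebesgue" "E \<subseteq> ball x r"
  shows "measure lebesgue E \<le> measure (wm u) E powr \<theta> * measure (wm s) E powr (1 - \<theta>)"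
proof -
  have [measurable]: "E \<in> sets lebesgue" by fact
  have "emeasure lebesgue E = (\<integral>\<^sup>+y. indicator E y \<partial>lebesgue)" by simp
  also have "\<dots> = (\<integral>\<^sup>+y. ennreal_powr (ennreal (u y) * indicator E y) \<theta>
      * ennreal_powr (ennreal (s y) * indicator E y) (1 - \<theta>) \<partial>lebesgue)"
    using dual by (intro nn_integral_cong_AE, eventually_elim)
       (auto simp: indicator_def ennreal_mult[symmetric])
  also have "\<dots> \<le> ennreal_powr (emeasure (wm u) E) \<theta> * ennreal_powr (emeasure (wm s) E) (1 - \<theta>)"
    unfolding emeasure_wm[OF assms(1)] by (intro nn_integral_Holder theta) measurable
  also have "\<dots> = ennreal (measure (wm u) E powr \<theta> * measure (wm s) E powr (1 - \<theta>))"
    using fmeasurable_wm[OF assms] by (simp add: emeasure_eq_measure2 ennreal_mult[symmetric])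
  finally show ?thesis
    by (simp add: measure_def enn2real_leI)
qed

lemma wm_ball_pos:
  assumes "0 < r" shows "0 < ub x r"
proof -
  have "0 < measure lebesgue (ball x r)" using content_ball_pos[OF assms, of x] by simp
  also have "\<dots> \<le> ub x r powr \<theta> * sb x r powr (1 - \<theta>)"
    by (rule measure_le_Holder) auto
  finally have "ub x r \<noteq> 0" by auto
  then show ?thesis by (simp add: less_le)
qed

lemma wm_mono: "E \<in> sets lebesgue \<Longrightarrow> F \<in> sets lebesgue \<Longrightarrow> E \<subseteq> F \<Longrightarrow> F \<subseteq> ball x r 
    \<Longrightarrow> measure (wm u) E \<le> measure (wm u) F"
  using fmeasurable_wm(1)[of F x r] by (intro measure_mono_fmeasurable) auto

lemma K_pos: "0 < K"
proof -
  have "0 < ub 0 1 powr \<theta> * sb 0 1 powr (1 - \<theta>)"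
    using wm_ball_pos[of 1 0] muckenhoupt_pair.wm_ball_pos[OF swap, of 1 0] by simp
  also have "\<dots> \<le> K" using ball_cond[of 1 0] by simp
  finally show ?thesis .
qed

text \<open>Hoelder on \<open>E\<close>, the trivial bound s(E) \<le> s(B), and
  \<open>ball_cond\<close>, which cancels s(B). Doubling, reverse doubling and the complement
  estimate are all read off from this inequality.\<close>

lemma wm_lower:
  assumes E: "E \<in> sets lebesgue" "E \<subseteq> ball x r" and "0 < r" and c: "0 < c" "c * r ^ CARD('n) \<le> measure lebesgue E"
  shows "(c / K) powr (1 / \<theta>) * ub x r \<le> measure (wm u) E"
proof -
  let ?U = "measure (wm u)" and ?S = "measure (wm s)" and ?B = "ball x r"
  have U: "0 < ?U ?B" using wm_ball_pos[OF \<open>0 < r\<close>] .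
  have "c * r ^ CARD('n) * ?U ?B powr \<theta> \<le> ?U E powr \<theta> * ?S E powr (1 - \<theta>) * ?U ?B powr \<theta>"
    using c(2) measure_le_Holder[OF E] by (intro mult_right_mono) auto
  also have "\<dots> \<le> ?U E powr \<theta> * ?S ?B powr (1 - \<theta>) * ?U ?B powr \<theta>"
    using theta muckenhoupt_pair.wm_mono[OF swap, of E "ball x r" x r] E
    by (intro mult_right_mono mult_left_mono powr_mono2) auto
  also have "\<dots> \<le> ?U E powr \<theta> * (K * r ^ CARD('n))"
    using mult_left_mono[OF ball_cond[OF \<open>0 < r\<close>, of x], of "?U E powr \<theta>"] by (simp add: mult_ac)
  finally have "r ^ CARD('n) * (c * ?U ?B powr \<theta>) \<le> r ^ CARD('n) * (K * ?U E powr \<theta>)"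
    by (simp add: mult_ac)
  then have "c * ?U ?B powr \<theta> \<le> K * ?U E powr \<theta>" using \<open>0 < r\<close> by (simp add: mult_le_cancel_left_pos)
  then have "(c / K) * ?U ?B powr \<theta> \<le> ?U E powr \<theta>" using K_pos by (simp add: field_simps)
  then have "((c / K) * ?U ?B powr \<theta>) powr (1 / \<theta>) \<le> (?U E powr \<theta>) powr (1 / \<theta>)"
    using theta K_pos c U by (intro powr_mono2) auto
  moreover have "((c / K) * ?U ?B powr \<theta>) powr (1 / \<theta>) = (c / K) powr (1 / \<theta>) * ?U ?B"
    by (subst powr_mult) (use theta K_pos c U in \<open>simp_all add: powr_powr\<close>)
  ultimately show ?thesis using theta by (simp add: powr_powr)
qed

lemma wm_doubling:
  assumes "0 < t"
  obtains D where "0 < D" "\<And>x z r. 0 < r \<Longrightarrow> ball x r \<subseteq> ball z (t * r) \<Longrightarrow>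
    ub z (t * r) \<le> D * ub x r"
proof -
  \<comment> \<open>Chosen so that the volume of \<open>ball x r\<close> equals
    \<open>c * (t * r) ^ CARD('n)\<close>, as \<open>wm_lower\<close> asks for a subset of the ball
    of radius \<open>t * r\<close>.\<close>
  define c where "c = unit_ball_vol (real CARD('n)) / t ^ CARD('n)"
  have c: "0 < c" unfolding c_def using assms by (simp add: unit_ball_vol_pos)
  define \<kappa> where "\<kappa> = (c / K) powr (1 / \<theta>)"
  have k: "0 < \<kappa>" unfolding \<kappa>_def using c K_pos by simp
  show ?thesis
  proof (rule that[of "1 / \<kappa>"])
    fix x z :: "real^'n" and r :: real assume r: "0 < r" "ball x r \<subseteq> ball z (t * r)"
    have "\<kappa> * ub z (t * r) \<le> ub x r"
      unfolding \<kappa>_def using r assms c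
      by (intro wm_lower) (auto simp: c_def content_ball power_mult_distrib)
    then show "ub z (t * r) \<le> 1 / \<kappa> * ub x r"
      using k by (simp add: field_simps)
  qed (use k in auto)
qed

text \<open>The only form of the \<open>A\<^sub>\<infinity>\<close> property that is needed.\<close>

lemma wm_compl_le:
  assumes "0 < c"
  obtains \<eta> where "0 < \<eta>" "\<eta> < 1" "\<And>E F x r. 0 < r \<Longrightarrow> E \<in> sets lebesgue \<Longrightarrow> F \<in> sets lebesgue \<Longrightarrow> E \<subseteq> F \<Longrightarrow> F \<subseteq> ball x r 
    \<Longrightarrow> c * r ^ CARD('n) \<le> measure lebesgue (F - E) \<Longrightarrow> measure (wm u) E \<le> \<eta> * measure (wm u) F"
proof -
  \<comment> \<open>The minimum with 1/2 keeps \<open>\<eta> = 1 - \<kappa>\<close>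
    positive.\<close>
  define \<kappa> where "\<kappa> = min (1/2) ((c / K) powr (1 / \<theta>))"
  have k: "0 < \<kappa>" "\<kappa> \<le> 1/2" unfolding \<kappa>_def using assms K_pos by auto
  show ?thesis
  proof (rule that[of "1 - \<kappa>"])
    fix E F :: "(real^'n) set" and x and r :: real
    assume r: "0 < r" and E: "E \<in> sets lebesgue" "F \<in> sets lebesgue" "E \<subseteq> F" "F \<subseteq> ball x r" 
      and l: "c * r ^ CARD('n) \<le> measure lebesgue (F - E)"
    have "\<kappa> * measure (wm u) F \<le> (c / K) powr (1 / \<theta>) * ub x r"
      using E by (intro mult_mono wm_mono[where x = x and r = r]) (auto simp: \<kappa>_def)
    also have "\<dots> \<le> measure (wm u) (F - E)"
      using E r l assms by (intro wm_lower) auto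
    also have "\<dots> = measure (wm u) F - measure (wm u) E"
      using E fmeasurable_wm(1)[of F x r] fmeasurable_wm(1)[of E x r]
      by (intro measurable_measure_Diff) auto
    finally show "measure (wm u) E \<le> (1 - \<kappa>) * measure (wm u) F" by (simp add: algebra_simps)
  qed (use k in auto)
qed

text \<open>In dimension at least 1 the annulus between the radii r and 2 r has at least half the
  volume of the larger ball, so the complement estimate applies with half the volume of the unit
  ball as \<open>c\<close>.\<close>

lemma wm_reverse_doubling:
  obtains \<rho> where "0 < \<rho>" "\<rho> < 1" "\<And>x r. 0 < r \<Longrightarrow> ub x r \<le> \<rho> * ub x (2 * r)"
proof -
  define c where "c = unit_ball_vol (real CARD('n)) / 2"
  have c: "0 < c" by (simp add: c_def)
  obtain \<eta> where \<eta>: "0 < \<eta>" "\<eta> < 1" "\<And>E F x r. 0 < r \<Longrightarrow> E \<in> sets lebesgue \<Longrightarrow> F \<in> sets lebesgue \<Longrightarrow> E \<subseteq> F \<Longrightarrow> F \<subseteq> ball x r 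
    \<Longrightarrow> c * r ^ CARD('n) \<le> measure lebesgue (F - E) \<Longrightarrow> measure (wm u) E \<le> \<eta> * measure (wm u) F"
    using wm_compl_le[OF c] by blast
  show ?thesis
  proof (rule that[OF \<eta>(1,2)])
    fix x :: "real^'n" and r :: real assume r: "0 < r"
    have "2 * 1 ^ CARD('n) \<le> (2::real) ^ CARD('n)"
      using power_increasing[of 1 "CARD('n)" "2::real"] by (simp add: Suc_leI)
    define V where "V = unit_ball_vol (real CARD('n)) * r ^ CARD('n)"
    have "V * 2 \<le> V * 2 ^ CARD('n)" unfolding V_def
      using r \<open>2 * 1 ^ CARD('n) \<le> 2 ^ CARD('n)\<close> by (intro mult_left_mono) auto
    moreover have "c * (2 * r) ^ CARD('n) = V * 2 ^ CARD('n) / 2"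
      by (simp add: c_def V_def power_mult_distrib)
    moreover have "unit_ball_vol (real CARD('n)) * ((2 * r) ^ CARD('n) - r ^ CARD('n)) = V * 2 ^ CARD('n) - V"
      by (simp add: V_def power_mult_distrib algebra_simps)
    ultimately have "c * (2 * r) ^ CARD('n) \<le> unit_ball_vol (real CARD('n)) * ((2 * r) ^ CARD('n) - r ^ CARD('n))"
      by linarith
    also have "\<dots> = measure lebesgue (ball x (2 * r)) - measure lebesgue (ball x r)"
      using r by (simp add: content_ball algebra_simps)
    also have "\<dots> = measure lebesgue (ball x (2 * r) - ball x r)"
      using r by (intro measurable_measure_Diff[symmetric]) auto
    finally show "ub x r \<le> \<eta> * ub x (2 * r)"
      using r by (intro \<eta>(3)[of "2 * r" _ _ x]) auto
  qed
qed

end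

section \<open>The maximal function of a doubling measure\<close>

text \<open>The layer-cake formula for a single value \<open>y\<close>, infinity included, so that
  it can be integrated over functions with values in [0, \<infinity>].\<close>

lemma nn_integral_powr_layer:
  assumes "0 < a"
  shows "(\<integral>\<^sup>+t. ennreal (t powr (a - 1)) * indicator {t. 0 < t \<and> ennreal t < y} t \<partial>lborel)
     = ennreal (1 / a) * ennreal_powr y a"
proof -
  have fin: "(\<integral>\<^sup>+t. ennreal (t powr (a - 1)) * indicator {t. 0 < t \<and> t < c} t \<partial>lborel)
      = ennreal (c powr a / a)" if "0 \<le> c" for c
  proof -
    have "((\<lambda>x. x powr (a - 1)) has_integral (c powr (a-1+1) / (a-1+1))) {0..c}"
      using assms that by (intro has_integral_powr_from_0) auto
    then have "((\<lambda>x. if x \<in> {0..c} then x powr (a - 1) else 0) has_integral (c powr a / a)) UNIV"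
      by (subst has_integral_restrict_UNIV) simp
    then have "(\<integral>\<^sup>+x. ennreal (if x \<in> {0..c} then x powr (a - 1) else 0) \<partial>lborel) = ennreal (c powr a / a)"
      by (intro nn_integral_has_integral_lborel) auto
    moreover have "(\<integral>\<^sup>+x. ennreal (if x \<in> {0..c} then x powr (a - 1) else 0) \<partial>lborel)
       = (\<integral>\<^sup>+t. ennreal (t powr (a - 1)) * indicator {t. 0 < t \<and> t < c} t \<partial>lborel)"
      using AE_lborel_singleton[of 0] AE_lborel_singleton[of c]
      by (intro nn_integral_cong_AE, eventually_elim) (auto simp: indicator_def)
    ultimately show ?thesis by simp
  qed
  show ?thesis
  proof (cases y)
    case (real c)
    then have "{t. 0 < t \<and> ennreal t < y} = {t. 0 < t \<and> t < c}"
      by (auto simp: ennreal_less_iff)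
    then show ?thesis using fin[OF real(1)] real assms by (simp add: ennreal_mult[symmetric])
  next
    case top
    have "(\<integral>\<^sup>+t. ennreal (t powr (a - 1)) * indicator {t. 0 < t} t \<partial>lborel) = top"
    proof (rule ccontr)
      let ?I = "\<integral>\<^sup>+t. ennreal (t powr (a - 1)) * indicator {t. 0 < t} t \<partial>lborel"
      assume "?I \<noteq> top"
      then obtain z where z: "0 \<le> z" "?I = ennreal z" by (cases ?I) auto
      \<comment> \<open>With this \<open>c\<close> the integral up to \<open>c\<close> is
        \<open>z + 1\<close>, which exceeds the supposed finite value \<open>z\<close>.\<close>
      define c where "c = (a * (z + 1)) powr (1 / a)"
      have "ennreal (c powr a / a) \<le> ?I" unfolding fin[of c, unfolded c_def, simplified, folded c_def, symmetric]
        by (intro nn_integral_mono) (auto simp: indicator_def)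
      moreover have "c powr a / a = z + 1" using assms z unfolding c_def by (simp add: powr_powr)
      ultimately show False using z by simp
    qed
    then show ?thesis using top assms by (simp add: ennreal_mult_top)
  qed
qed

text \<open>Uncentred, so that superlevel sets are unions of balls, hence open whatever
  \<open>g\<close> is, and so that the average over a ball is a lower bound at each of its
  points.\<close>

definition maxf :: "(real^'n) measure \<Rightarrow> (real^'n \<Rightarrow> ennreal) \<Rightarrow> real^'n \<Rightarrow> ennreal" where
  "maxf \<mu> g x = (SUP B\<in>{B\<in>balls. x \<in> B}. (\<integral>\<^sup>+y\<in>B. g y \<partial>\<mu>) / emeasure \<mu> B)"

lemma maxf_upper: "0 < r \<Longrightarrow> x \<in> ball z r \<Longrightarrow> (\<integral>\<^sup>+y\<in>ball z r. g y \<partial>\<mu>) / emeasure \<mu> (ball z r) \<le> maxf \<mu> g x"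
  unfolding maxf_def balls_def by (intro SUP_upper) auto

lemma less_maxf_iff: "{x. t < maxf \<mu> g x} = \<Union>{B\<in>balls. t < (\<integral>\<^sup>+y\<in>B. g y \<partial>\<mu>) / emeasure \<mu> B}"
  unfolding maxf_def less_SUP_iff by auto

lemma open_less_maxf: "open {x. t < maxf \<mu> g x}"
  unfolding less_maxf_iff by (auto simp: balls_def)

lemma borel_measurable_maxf: "maxf \<mu> g \<in> borel_measurable borel"
proof (rule borel_measurableI_greater)
  fix y show "{x \<in> space borel. y < maxf \<mu> g x} \<in> sets borel"
    using open_less_maxf[of y \<mu> g] by simp
qed

text \<open>The dilation factor 5 is the one of Vitali's covering lemma.\<close>

locale doubling_measure =
  fixes \<mu> :: "(real^'n) measure" and D :: real
  assumes sets_eq [simp, measurable_cong]: "sets \<mu> = sets lebesgue"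
    and finite_ball: "emeasure \<mu> (ball x r) < \<infinity>"
    and pos_ball: "0 < r \<Longrightarrow> 0 < emeasure \<mu> (ball x r)"
    and doubling: "0 < r \<Longrightarrow> emeasure \<mu> (ball x (5 * r)) \<le> ennreal D * emeasure \<mu> (ball x r)"
    and D_pos: "0 < D"
begin

lemma space_eq [simp]: "space \<mu> = UNIV"
  using sets_eq_imp_space_eq[OF sets_eq] by simp

lemma ball_in_sets [measurable]: "ball x r \<in> sets \<mu>"
  by simp

lemma sigma_finite: "sigma_finite_measure \<mu>"
proof
  have "\<Union>(range (\<lambda>n::nat. ball (0::real^'n) (real n))) = UNIV"
    using reals_Archimedean2 by (auto simp: ) 
  then show "\<exists>A. countable A \<and> A \<subseteq> sets \<mu> \<and> \<Union> A = space \<mu> \<and> (\<forall>a\<in>A. emeasure \<mu> a \<noteq> \<infinity>)"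
    using finite_ball by (intro exI[of _ "range (\<lambda>n::nat. ball (0::real^'n) (real n))"]) (auto simp: less_top)
qed

lemma borel_measurable_maxf' [measurable]: "maxf \<nu> g \<in> borel_measurable \<mu>"
proof -
  have "maxf \<nu> g \<in> borel_measurable lborel" using borel_measurable_maxf by simp
  then have "maxf \<nu> g \<in> borel_measurable lebesgue" by (rule measurable_completion)
  then show ?thesis by (simp cong: measurable_cong_sets)
qed

text \<open>Vitali selects disjoint balls whose fivefold dilates cover the rest. Doubling pays for
  the dilation, and disjointness keeps the sum of the integrals below the integral over the whole
  space.\<close>

lemma finite_Vitali:
  assumes F: "finite F" "\<And>a r. (a, r) \<in> F \<Longrightarrow> 0 < r \<and> t * emeasure \<mu> (ball a r) \<le> (\<integral>\<^sup>+y\<in>ball a r. g y \<partial>\<mu>)"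
    and [measurable]: "g \<in> borel_measurable \<mu>"
  shows "t * emeasure \<mu> (\<Union>(a, r)\<in>F. ball a r) \<le> ennreal D * (\<integral>\<^sup>+y. g y \<partial>\<mu>)"
proof -
  \<comment> \<open>The covering lemma wants a common bound of the radii; the inserted 0 gives the
    maximum a value for empty \<open>F\<close>.\<close>
  define B where "B = Max (insert 0 (snd ` F))"
  obtain C where C: "C \<subseteq> F" "pairwise (\<lambda>i j. disjnt (cball (fst i) (snd i)) (cball (fst j) (snd j))) C"
    "\<And>i. i \<in> F \<Longrightarrow> \<exists>j. j \<in> C \<and> \<not> disjnt (cball (fst i) (snd i)) (cball (fst j) (snd j)) \<and>
                        cball (fst i) (snd i) \<subseteq> ball (fst j) (5 * snd j)"
  proof (rule Vitali_covering_lemma_cballs_balls[of F snd B fst])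
    fix i assume "i \<in> F"
    then have "snd i \<in> insert 0 (snd ` F)" by blast
    then show "0 < snd i \<and> snd i \<le> B" using F \<open>i \<in> F\<close> by (cases i) (auto simp: B_def intro!: Max_ge)
  qed blast
  have fC: "finite C" using C(1) F(1) finite_subset by blast
  have sub: "(\<Union>(a, r)\<in>F. ball a r) \<subseteq> (\<Union>j\<in>C. ball (fst j) (5 * snd j))"
  proof
    fix x assume "x \<in> (\<Union>(a, r)\<in>F. ball a r)"
    then obtain i where i: "i \<in> F" "x \<in> cball (fst i) (snd i)" by force
    then show "x \<in> (\<Union>j\<in>C. ball (fst j) (5 * snd j))" using C(3)[of i] by blast
  qed
  have "emeasure \<mu> (\<Union>(a, r)\<in>F. ball a r) \<le> emeasure \<mu> (\<Union>j\<in>C. ball (fst j) (5 * snd j))"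
    using sub fC by (intro emeasure_mono sets.finite_UN) auto
  also have "\<dots> \<le> (\<Sum>j\<in>C. emeasure \<mu> (ball (fst j) (5 * snd j)))"
    using fC by (intro emeasure_subadditive_finite) auto
  also have "\<dots> \<le> (\<Sum>j\<in>C. ennreal D * emeasure \<mu> (ball (fst j) (snd j)))"
    using C(1) F(2) by (intro sum_mono doubling) (auto dest: subsetD)
  finally have "t * emeasure \<mu> (\<Union>(a, r)\<in>F. ball a r) \<le> t * (\<Sum>j\<in>C. ennreal D * emeasure \<mu> (ball (fst j) (snd j)))"
    by (rule mult_left_mono) simp
  also have "\<dots> = ennreal D * (\<Sum>j\<in>C. t * emeasure \<mu> (ball (fst j) (snd j)))"
    by (simp add: sum_distrib_left mult_ac)
  also have "\<dots> \<le> ennreal D * (\<Sum>j\<in>C. (\<integral>\<^sup>+y\<in>ball (fst j) (snd j). g y \<partial>\<mu>))"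
    using C(1) F(2) by (intro mult_left_mono sum_mono) (auto dest: subsetD)
  also have "(\<Sum>j\<in>C. (\<integral>\<^sup>+y\<in>ball (fst j) (snd j). g y \<partial>\<mu>)) = (\<integral>\<^sup>+y. (\<Sum>j\<in>C. g y * indicator (ball (fst j) (snd j)) y) \<partial>\<mu>)"
    by (intro nn_integral_sum[symmetric]) measurable
  also have "\<dots> \<le> (\<integral>\<^sup>+y. g y \<partial>\<mu>)"
  proof (intro nn_integral_mono)
    fix y
    have "disjoint_family_on (\<lambda>j. ball (fst j) (snd j)) C"
      unfolding disjoint_family_on_def
    proof (intro ballI impI)
      fix i j assume "i \<in> C" "j \<in> C" "i \<noteq> j"
      then have "disjnt (cball (fst i) (snd i)) (cball (fst j) (snd j))" using C(2) by (auto simp: pairwise_def)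
      then show "ball (fst i) (snd i) \<inter> ball (fst j) (snd j) = {}"
        unfolding disjnt_def using ball_subset_cball by blast
    qed
    then have "(\<Sum>j\<in>C. (indicator (ball (fst j) (snd j)) y :: ennreal)) = indicator (\<Union>j\<in>C. ball (fst j) (snd j)) y"
      using fC by (simp add: indicator_UN_disjoint)
    then have "(\<Sum>j\<in>C. g y * indicator (ball (fst j) (snd j)) y) = g y * indicator (\<Union>j\<in>C. ball (fst j) (snd j)) y"
      by (simp add: sum_distrib_left[symmetric])
    also have "\<dots> \<le> g y" by (auto simp: indicator_def)
    finally show "(\<Sum>j\<in>C. g y * indicator (ball (fst j) (snd j)) y) \<le> g y" .
  qed
  finally show ?thesis by (simp add: mult_left_mono)
qed

text \<open>The superlevel set is a union of balls, of which countably many suffice by Lindelof.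
  Continuity of the measure along increasing finite unions then leaves only the finite covering
  estimate.\<close>

lemma maxf_weak_type:
  assumes [measurable]: "g \<in> borel_measurable \<mu>"
  shows "t * emeasure \<mu> {x. t < maxf \<mu> g x} \<le> ennreal D * (\<integral>\<^sup>+y. g y \<partial>\<mu>)"
proof -
  define F where "F = {B\<in>balls. t < (\<integral>\<^sup>+y\<in>B. g y \<partial>\<mu>) / emeasure \<mu> B}"
  have "\<And>B. B \<in> F \<Longrightarrow> open B" by (auto simp: F_def balls_def)
  from Lindelof[OF this] obtain F' where F': "F' \<subseteq> F" "countable F'" "\<Union>F' = \<Union>F" by auto
  show ?thesis
  proof (cases "F' = {}")
    case True
    then have "\<Union>F = {}" using F'(3) by simp
    then have "{x. t < maxf \<mu> g x} = {}" unfolding less_maxf_iff F_def .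
    then show ?thesis by (simp only: emeasure_empty) simp
  next
    case False
    have b: "\<exists>a r. 0 < r \<and> from_nat_into F' n = ball a r \<and> t * emeasure \<mu> (ball a r) \<le> (\<integral>\<^sup>+y\<in>ball a r. g y \<partial>\<mu>)" for n
    proof -
      have "from_nat_into F' n \<in> F" using from_nat_into[OF False, of n] F'(1) by auto
      then obtain a r where ar: "0 < r" "from_nat_into F' n = ball a r" 
        "t < (\<integral>\<^sup>+y\<in>ball a r. g y \<partial>\<mu>) / emeasure \<mu> (ball a r)" by (auto simp: F_def balls_def)
      have "t * emeasure \<mu> (ball a r) \<le> (\<integral>\<^sup>+y\<in>ball a r. g y \<partial>\<mu>) / emeasure \<mu> (ball a r) * emeasure \<mu> (ball a r)"
        using ar by (intro mult_right_mono) auto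
      also have "\<dots> = (\<integral>\<^sup>+y\<in>ball a r. g y \<partial>\<mu>)"
        using pos_ball[OF ar(1), of a] finite_ball[of a r] 
        by (subst ennreal_divide_times) (simp add: ennreal_divide_self less_top)
      finally show ?thesis using ar by blast
    qed
    then obtain a r where ar: "\<And>n. 0 < r n" "\<And>n. from_nat_into F' n = ball (a n) (r n)" 
        "\<And>n. t * emeasure \<mu> (ball (a n) (r n)) \<le> (\<integral>\<^sup>+y\<in>ball (a n) (r n). g y \<partial>\<mu>)" by metis
    define E where "E n = (\<Union>i<n. ball (a i) (r i))" for n :: nat
    have "{x. t < maxf \<mu> g x} = \<Union>(range (from_nat_into F'))"
      unfolding less_maxf_iff F_def[symmetric] F'(3)[symmetric] using range_from_nat_into[OF False F'(2)] by simp
    also have "\<dots> = (\<Union>n. E n)" unfolding ar(2) E_def by auto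
    finally have eq: "{x. t < maxf \<mu> g x} = (\<Union>n. E n)" .
    have "emeasure \<mu> (\<Union>n. E n) = (SUP n. emeasure \<mu> (E n))"
      by (intro SUP_emeasure_incseq[symmetric]) (force simp: E_def incseq_def)+
    then have "t * emeasure \<mu> {x. t < maxf \<mu> g x} = (SUP n. t * emeasure \<mu> (E n))"
      unfolding eq by (simp add: SUP_mult_left_ennreal)
    also have "\<dots> \<le> ennreal D * (\<integral>\<^sup>+y. g y \<partial>\<mu>)"
    proof (rule SUP_least)
      fix n
      have "E n = (\<Union>(a, r)\<in>(\<lambda>i. (a i, r i)) ` {..<n}. ball a r)" by (auto simp: E_def)
      then show "t * emeasure \<mu> (E n) \<le> ennreal D * (\<integral>\<^sup>+y. g y \<partial>\<mu>)"
        by (simp only:) (rule finite_Vitali, use ar in auto)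
    qed
    finally show ?thesis .
  qed
qed

text \<open>The part of \<open>g\<close> below \<open>t\<close> contributes at most \<open>t\<close>
  to every average, so exceeding \<open>2 * t\<close> forces the maximal function of the part above
  \<open>t\<close> to exceed \<open>t\<close>.\<close>

lemma maxf_weak_type_truncated:
  assumes [measurable]: "g \<in> borel_measurable \<mu>"
  shows "t * emeasure \<mu> {x. 2 * t < maxf \<mu> g x} \<le> ennreal D * (\<integral>\<^sup>+y. g y * indicator {y. t < g y} y \<partial>\<mu>)"
proof -
  define G where "G y = g y * indicator {y. t < g y} y" for y
  have [measurable]: "G \<in> borel_measurable \<mu>" unfolding G_def by measurable
  have "maxf \<mu> g x \<le> t + maxf \<mu> G x" for x
    unfolding maxf_def[of \<mu> g]
  proof (rule SUP_least, clarsimp simp: balls_def)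
    fix z :: "real^'n" and r :: real assume zr: "dist z x < r" "0 < r"
    let ?B = "ball z r"
    have "(\<integral>\<^sup>+y\<in>?B. g y \<partial>\<mu>) \<le> (\<integral>\<^sup>+y. t * indicator ?B y + G y * indicator ?B y \<partial>\<mu>)"
      by (intro nn_integral_mono) (auto simp: G_def indicator_def)
    also have "\<dots> = t * emeasure \<mu> ?B + (\<integral>\<^sup>+y\<in>?B. G y \<partial>\<mu>)"
      by (subst nn_integral_add) (measurable, simp add: nn_integral_cmult_indicator)
    finally have "(\<integral>\<^sup>+y\<in>?B. g y \<partial>\<mu>) / emeasure \<mu> ?B \<le> (t * emeasure \<mu> ?B + (\<integral>\<^sup>+y\<in>?B. G y \<partial>\<mu>)) / emeasure \<mu> ?B"
      by (rule divide_right_mono_ennreal)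
    also have "\<dots> = t + (\<integral>\<^sup>+y\<in>?B. G y \<partial>\<mu>) / emeasure \<mu> ?B"
      using pos_ball[OF zr(2), of z] finite_ball[of z r]
      by (simp add: add_divide_distrib_ennreal ennreal_times_divide[symmetric] ennreal_divide_self less_top)
    also have "\<dots> \<le> t + maxf \<mu> G x"
      using zr by (intro add_left_mono maxf_upper) auto
    finally show "(\<integral>\<^sup>+y\<in>?B. g y \<partial>\<mu>) / emeasure \<mu> ?B \<le> t + maxf \<mu> G x" .
  qed
  then have "{x. 2 * t < maxf \<mu> g x} \<subseteq> {x. t < maxf \<mu> G x}"
    by (auto simp: mult_2) (metis add_left_mono linorder_not_le order_trans)
  then have "emeasure \<mu> {x. 2 * t < maxf \<mu> g x} \<le> emeasure \<mu> {x. t < maxf \<mu> G x}"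
    using open_less_maxf[of t \<mu> G] by (intro emeasure_mono) auto
  then have "t * emeasure \<mu> {x. 2 * t < maxf \<mu> g x} \<le> t * emeasure \<mu> {x. t < maxf \<mu> G x}"
    by (rule mult_left_mono) simp
  also have "\<dots> \<le> ennreal D * (\<integral>\<^sup>+y. G y \<partial>\<mu>)" by (rule maxf_weak_type) simp
  finally show ?thesis by (simp add: G_def)
qed

text \<open>Marcinkiewicz interpolation with the bounded end built into the truncation: layer cake
  with exponent \<open>a\<close>, the truncated weak type at each level, Fubini, and layer cake with
  exponent \<open>a - 1\<close>. The last one needs \<open>1 < a\<close> and produces the factor
  1/(a - 1).\<close>

lemma maxf_strong_type:
  assumes [measurable]: "g \<in> borel_measurable \<mu>" and "1 < a"
  shows "(\<integral>\<^sup>+x. ennreal_powr (maxf \<mu> g x) a \<partial>\<mu>)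
    \<le> ennreal (2 powr a * a * D / (a - 1)) * (\<integral>\<^sup>+x. ennreal_powr (g x) a \<partial>\<mu>)"
proof -
  interpret sigma_finite_measure \<mu> by (rule sigma_finite)
  interpret pair_sigma_finite \<mu> "lborel :: real measure" by unfold_locales
  have [measurable]: "maxf \<mu> g \<in> borel_measurable \<mu>" by simp
  have "(\<integral>\<^sup>+x. ennreal (1 / a) * ennreal_powr (maxf \<mu> g x / 2) a \<partial>\<mu>)
    = (\<integral>\<^sup>+x. (\<integral>\<^sup>+t. ennreal (t powr (a - 1)) * indicator {t. 0 < t \<and> ennreal t < maxf \<mu> g x / 2} t \<partial>lborel) \<partial>\<mu>)"
    using assms by (simp add: nn_integral_powr_layer)
  also have "\<dots> = (\<integral>\<^sup>+t. (\<integral>\<^sup>+x. ennreal (t powr (a - 1)) * indicator {t. 0 < t \<and> ennreal t < maxf \<mu> g x / 2} t \<partial>\<mu>) \<partial>lborel)"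
    by (intro Fubini'[symmetric]) (simp add: indicator_def split_beta', measurable)
  also have "\<dots> \<le> (\<integral>\<^sup>+t. (\<integral>\<^sup>+x. ennreal D * (ennreal (t powr (a - 1 - 1)) * (g x * indicator {t. 0 < t \<and> ennreal t < g x} t)) \<partial>\<mu>) \<partial>lborel)"
  proof (rule nn_integral_mono)
    fix t :: real
    have half: "s < z / 2 \<longleftrightarrow> 2 * s < z" for s z :: ennreal
      by (cases s; cases z) (auto simp: ennreal_less_iff ennreal_mult[symmetric] ennreal_top_mult divide_ennreal
        ennreal_top_divide simp flip: ennreal_numeral)
    show "(\<integral>\<^sup>+x. ennreal (t powr (a - 1)) * indicator {t. 0 < t \<and> ennreal t < maxf \<mu> g x / 2} t \<partial>\<mu>)
      \<le> (\<integral>\<^sup>+x. ennreal D * (ennreal (t powr (a - 1 - 1)) * (g x * indicator {t. 0 < t \<and> ennreal t < g x} t)) \<partial>\<mu>)"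
    proof (cases "0 < t")
      case True
      have "(\<integral>\<^sup>+x. ennreal (t powr (a - 1)) * indicator {t. 0 < t \<and> ennreal t < maxf \<mu> g x / 2} t \<partial>\<mu>)
        = (\<integral>\<^sup>+x. ennreal (t powr (a - 1)) * indicator {x. 2 * ennreal t < maxf \<mu> g x} x \<partial>\<mu>)"
        using True by (intro nn_integral_cong) (auto simp: half indicator_def)
      also have "\<dots> = ennreal (t powr (a - 1)) * emeasure \<mu> {x. 2 * ennreal t < maxf \<mu> g x}"
        by (subst nn_integral_cmult_indicator) (auto simp: open_less_maxf)
      also have "\<dots> = ennreal (t powr (a - 1 - 1)) * (ennreal t * emeasure \<mu> {x. 2 * ennreal t < maxf \<mu> g x})"
        using True by (simp add: mult.assoc[symmetric] ennreal_mult[symmetric] powr_diff power2_eq_square)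
      also have "\<dots> \<le> ennreal (t powr (a - 1 - 1)) * (ennreal D * (\<integral>\<^sup>+y. g y * indicator {y. ennreal t < g y} y \<partial>\<mu>))"
        by (intro mult_left_mono maxf_weak_type_truncated) auto
      also have "\<dots> = (\<integral>\<^sup>+x. ennreal D * (ennreal (t powr (a - 1 - 1)) * (g x * indicator {t. 0 < t \<and> ennreal t < g x} t)) \<partial>\<mu>)"
        using True by (subst nn_integral_cmult, simp, subst nn_integral_cmult, simp) (simp add: indicator_def mult.left_commute)
      finally show ?thesis .
    qed simp
  qed
  also have "\<dots> = (\<integral>\<^sup>+x. (\<integral>\<^sup>+t. ennreal D * (ennreal (t powr (a - 1 - 1)) * (g x * indicator {t. 0 < t \<and> ennreal t < g x} t)) \<partial>lborel) \<partial>\<mu>)"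
    by (intro Fubini') (simp add: indicator_def split_beta', measurable)
  also have "\<dots> = (\<integral>\<^sup>+x. ennreal D * (g x * (\<integral>\<^sup>+t. ennreal (t powr (a - 1 - 1)) * indicator {t. 0 < t \<and> ennreal t < g x} t \<partial>lborel)) \<partial>\<mu>)"
    by (intro nn_integral_cong) (simp add: nn_integral_cmult[symmetric] mult_ac)
  also have "\<dots> = (\<integral>\<^sup>+x. ennreal (D / (a - 1)) * ennreal_powr (g x) a \<partial>\<mu>)"
  proof (intro nn_integral_cong)
    fix x
    have "g x * ennreal_powr (g x) (a - 1) = ennreal_powr (g x) a"
      using ennreal_powr_add[of "g x" 1 "a - 1"] by simp
    have "ennreal D * (g x * (\<integral>\<^sup>+t. ennreal (t powr (a - 1 - 1)) * indicator {t. 0 < t \<and> ennreal t < g x} t \<partial>lborel))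
      = ennreal D * (g x * (ennreal (1 / (a - 1)) * ennreal_powr (g x) (a - 1)))"
      using assms(2) by (subst nn_integral_powr_layer) auto
    also have "\<dots> = (ennreal D * ennreal (1 / (a - 1))) * (g x * ennreal_powr (g x) (a - 1))"
      by (simp only: mult_ac)
    also have "\<dots> = ennreal (D / (a - 1)) * ennreal_powr (g x) a"
      using assms(2) D_pos \<open>g x * ennreal_powr (g x) (a - 1) = ennreal_powr (g x) a\<close> by (simp add: ennreal_mult[symmetric])
    finally show "ennreal D * (g x * (\<integral>\<^sup>+t. ennreal (t powr (a - 1 - 1)) * indicator {t. 0 < t \<and> ennreal t < g x} t \<partial>lborel))
      = ennreal (D / (a - 1)) * ennreal_powr (g x) a" .
  qed
  also have "\<dots> = ennreal (D / (a - 1)) * (\<integral>\<^sup>+x. ennreal_powr (g x) a \<partial>\<mu>)"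
    by (simp add: nn_integral_cmult)
  finally have *: "(\<integral>\<^sup>+x. ennreal (1 / a) * ennreal_powr (maxf \<mu> g x / 2) a \<partial>\<mu>)
    \<le> ennreal (D / (a - 1)) * (\<integral>\<^sup>+x. ennreal_powr (g x) a \<partial>\<mu>)" .
  have "(\<integral>\<^sup>+x. ennreal_powr (maxf \<mu> g x) a \<partial>\<mu>) = (\<integral>\<^sup>+x. ennreal (2 powr a * a) * (ennreal (1 / a) * ennreal_powr (maxf \<mu> g x / 2) a) \<partial>\<mu>)"
  proof (intro nn_integral_cong)
    fix x
    have "maxf \<mu> g x = ennreal 2 * (maxf \<mu> g x / 2)"
      by (cases "maxf \<mu> g x") (auto simp: divide_ennreal ennreal_mult[symmetric] ennreal_top_divide ennreal_mult_top
        simp flip: ennreal_numeral)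
    then have "ennreal_powr (maxf \<mu> g x) a = ennreal (2 powr a) * ennreal_powr (maxf \<mu> g x / 2) a"
      by (metis ennreal_powr_mult ennreal_powr_ennreal zero_le_numeral)
    then show "ennreal_powr (maxf \<mu> g x) a = ennreal (2 powr a * a) * (ennreal (1 / a) * ennreal_powr (maxf \<mu> g x / 2) a)"
      using assms(2) by (simp add: mult.assoc[symmetric] ennreal_mult[symmetric])
  qed
  also have "\<dots> = ennreal (2 powr a * a) * (\<integral>\<^sup>+x. (ennreal (1 / a) * ennreal_powr (maxf \<mu> g x / 2) a) \<partial>\<mu>)"
    by (intro nn_integral_cmult) measurable
  also have "\<dots> \<le> ennreal (2 powr a * a) * (ennreal (D / (a - 1)) * (\<integral>\<^sup>+x. ennreal_powr (g x) a \<partial>\<mu>))"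
    by (intro mult_left_mono *) simp
  also have "\<dots> = ennreal (2 powr a * a * D / (a - 1)) * (\<integral>\<^sup>+x. ennreal_powr (g x) a \<partial>\<mu>)"
    using assms(2) D_pos by (simp add: mult.assoc[symmetric] ennreal_mult[symmetric])
  finally show ?thesis .
qed

end

section \<open>The weighted fractional integral\<close>

lemma ennreal_mult_divide_cancel: "0 < a \<Longrightarrow> ennreal a * (X / ennreal a) = X"
  by (cases X) (auto simp: divide_ennreal ennreal_mult[symmetric] ennreal_top_divide ennreal_mult_top)

section \<open>The normalized maximal operator from L^p(s) to L^p(u)\<close>

context muckenhoupt_pair
begin

lemma emeasure_wm_ball: "emeasure (wm u) (ball x r) = ennreal (ub x r)"
  "emeasure (wm s) (ball x r) = ennreal (sb x r)"
  using finite_u[of x r] finite_s[of x r] by (auto simp: emeasure_eq_ennreal_measure less_top)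

lemma doubling_measure_wm: obtains D where "doubling_measure (wm u) D"
proof -
  obtain D where D: "0 < D" "\<And>x z r. 0 < r \<Longrightarrow> ball x r \<subseteq> ball z (5 * r) \<Longrightarrow>
    ub z (5 * r) \<le> D * ub x r"
    using wm_doubling[of 5] by auto
  have "doubling_measure (wm u) D"
  proof
    fix x :: "real^'n" and r :: real assume r: "0 < r"
    show "0 < emeasure (wm u) (ball x r)" using wm_ball_pos[OF r, of x] by (simp add: emeasure_wm_ball)
    have "ub x (5 * r) \<le> D * ub x r"
      using r by (intro D) auto
    then show "emeasure (wm u) (ball x (5 * r)) \<le> ennreal D * emeasure (wm u) (ball x r)"
      using D(1) by (simp add: emeasure_wm_ball ennreal_mult[symmetric] ennreal_leI)
  qed (use D finite_u in auto)
  then show ?thesis by (rule that)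
qed

lemma nn_integral_wm:
  assumes "g \<in> borel_measurable lebesgue"
  shows "(\<integral>\<^sup>+x. g x \<partial>wm u) = (\<integral>\<^sup>+x. ennreal (u x) * g x \<partial>lebesgue)"
    "(\<integral>\<^sup>+x. g x \<partial>wm s) = (\<integral>\<^sup>+x. ennreal (s x) * g x \<partial>lebesgue)"
  unfolding wm_def using assms by (auto intro!: nn_integral_density)

lemma wm_s_pos: "0 < r \<Longrightarrow> 0 < sb x r"
  using muckenhoupt_pair.wm_ball_pos[OF swap] by blast

text \<open>The average of \<open>f\<close> against \<open>s\<close>, rescaled by (s(B)/u(B))^(1/p).
  This is the quantity that remains when a dyadic piece of the fractional integral is divided by a
  power of u(B), and the scaling matches a bound from L^p(s) to L^p(u).\<close>

abbreviation "nmean p f x r \<equiv> ennreal ((sb x r / ub x r) powr (1 / p)) *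
  ((\<integral>\<^sup>+y\<in>ball x r. f y \<partial>wm s) / emeasure (wm s) (ball x r))"

text \<open>Lerner's device: since \<open>u powr \<theta> * s powr (1 - \<theta>) = 1\<close>, raising to the power \<open>c\<close> turns the
  normalized \<open>s\<close>-average into an average with respect to \<open>u\<close>, so that the \<open>L\<^sup>p\<close> bound follows from
  two applications of the maximal theorem for doubling measures, without openness of the weight class.\<close>

lemma normalized_average_bound:
  assumes [measurable]: "f \<in> borel_measurable lebesgue" and "0 < r" "1 < p"
  defines "c \<equiv> p * (1 - \<theta>)"
  shows "ennreal_powr (nmean p f x r) c
    \<le> ennreal (K / unit_ball_vol (real CARD('n))) *
      maxf (wm u) (\<lambda>y. ennreal (1 / u y) * ennreal_powr (maxf (wm s) f y) c) x"
proof -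
  have c: "0 < c" using theta assms(3) by (simp add: c_def)
  obtain D where "doubling_measure (wm u) D" by (rule doubling_measure_wm)
  then interpret doubling_measure "wm u" D .
  let ?B = "ball x r"
  define A where "A = (\<integral>\<^sup>+y\<in>?B. f y \<partial>wm s) / emeasure (wm s) ?B"
  define U where "U = measure (wm u) ?B"
  define S where "S = measure (wm s) ?B"
  define \<omega> where "\<omega> = unit_ball_vol (real CARD('n))"
  have pos: "0 < U" "0 < S" "0 < \<omega>"
    using wm_ball_pos[OF assms(2), of x] wm_s_pos[OF assms(2), of x] by (auto simp: U_def S_def \<omega>_def)
  have [measurable]: "maxf (wm s) f \<in> borel_measurable lebesgue"
    using borel_measurable_maxf'[of "wm s" f] by (simp cong: measurable_cong_sets)
  define G where "G y = ennreal (1 / u y) * ennreal_powr (maxf (wm s) f y) c" for y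
  have [measurable]: "G \<in> borel_measurable lebesgue" unfolding G_def by measurable
  \<comment> \<open>The maximal function for \<open>s\<close> is at least \<open>A\<close> on the
    whole ball, so the power of \<open>A\<close> may be averaged over the ball in Lebesgue
    measure.\<close>
  have "emeasure lebesgue ?B * ennreal_powr A c = (\<integral>\<^sup>+y\<in>?B. ennreal_powr A c \<partial>lebesgue)"
    by (subst nn_integral_cmult_indicator) (auto simp: mult.commute)
  also have "\<dots> \<le> (\<integral>\<^sup>+y\<in>?B. ennreal_powr (maxf (wm s) f y) c \<partial>lebesgue)"
  proof (intro nn_integral_mono)
    fix y
    have "y \<in> ?B \<Longrightarrow> ennreal_powr A c \<le> ennreal_powr (maxf (wm s) f y) c"
      unfolding A_def using assms(2) c by (intro ennreal_powr_mono maxf_upper) auto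
    then show "ennreal_powr A c * indicator ?B y \<le> ennreal_powr (maxf (wm s) f y) c * indicator ?B y"
      by (cases "y \<in> ?B") auto
  qed
  \<comment> \<open>Writing 1 as u times 1/u turns the Lebesgue integral into one against
    \<open>u\<close>, at the price of the factor 1/u inside \<open>G\<close>.\<close>
  also have "\<dots> = (\<integral>\<^sup>+y. ennreal (u y) * (G y * indicator ?B y) \<partial>lebesgue)"
    using dual by (intro nn_integral_cong_AE, eventually_elim)
      (auto simp: G_def mult.assoc[symmetric] ennreal_mult[symmetric])
  also have "\<dots> = (\<integral>\<^sup>+y\<in>?B. G y \<partial>wm u)" by (subst nn_integral_wm) auto
  also have "\<dots> = emeasure (wm u) ?B * ((\<integral>\<^sup>+y\<in>?B. G y \<partial>wm u) / emeasure (wm u) ?B)"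
    using pos by (simp add: emeasure_wm_ball U_def ennreal_mult_divide_cancel)
  also have "\<dots> \<le> emeasure (wm u) ?B * maxf (wm u) G x"
    using assms(2) by (intro mult_left_mono maxf_upper) auto
  finally have 1: "ennreal (\<omega> * r ^ CARD('n)) * ennreal_powr A c \<le> ennreal U * maxf (wm u) G x"
    using assms(2) by (simp add: emeasure_wm_ball U_def emeasure_ball \<omega>_def emeasure_completion)
  \<comment> \<open>The exponent \<open>c = p * (1 - \<theta>)\<close> turns the prefactor into
    (S/U)^(1-\<theta>) = U^\<theta> S^(1-\<theta>) / U, whose numerator is what
    \<open>ball_cond\<close> bounds by a multiple of the volume.\<close>
  have "ennreal_powr (ennreal ((S / U) powr (1 / p)) * A) c = ennreal ((S / U) powr (1 - \<theta>)) * ennreal_powr A c"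
    using assms(3) pos by (simp add: ennreal_powr_mult powr_powr c_def)
  also have "(S / U) powr (1 - \<theta>) = U powr \<theta> * S powr (1 - \<theta>) / U"
    using pos by (simp add: powr_divide powr_diff mult_ac)
  also have "ennreal (U powr \<theta> * S powr (1 - \<theta>) / U) * ennreal_powr A c 
    \<le> ennreal (K * r ^ CARD('n) / U) * ennreal_powr A c"
    using ball_cond[OF assms(2), of x] pos
    by (intro mult_right_mono ennreal_leI divide_right_mono) (auto simp: U_def S_def)
  also have "\<dots> = ennreal (K / (\<omega> * U)) * (ennreal (\<omega> * r ^ CARD('n)) * ennreal_powr A c)"
    using pos assms(2) K_pos by (simp add: mult.assoc[symmetric] ennreal_mult[symmetric])
  also have "\<dots> \<le> ennreal (K / (\<omega> * U)) * (ennreal U * maxf (wm u) G x)"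
    using 1 by (rule mult_left_mono) simp
  also have "\<dots> = ennreal (K / \<omega>) * maxf (wm u) G x"
    using pos assms(2) K_pos by (simp add: mult.assoc[symmetric] ennreal_mult[symmetric])
  finally show ?thesis unfolding S_def U_def A_def \<omega>_def G_def .
qed

text \<open>One measurable majorant \<open>N\<close> serves all radii. Its L^p bound composes the
  maximal theorem for \<open>u\<close> at exponent 1/(1-\<theta>) with the one for \<open>s\<close>
  at exponent \<open>p\<close>.\<close>

lemma normalized_maximal:
  assumes "1 < p"
  obtains C where "0 < C" "\<And>f. f \<in> borel_measurable lebesgue \<Longrightarrow> \<exists>N\<in>borel_measurable lebesgue. 
     (\<forall>x r. 0 < r \<longrightarrow> nmean p f x r \<le> N x) \<and>
     (\<integral>\<^sup>+x. ennreal_powr (N x) p \<partial>wm u) \<le> ennreal C * (\<integral>\<^sup>+x. ennreal_powr (f x) p \<partial>wm s)"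
proof -
  obtain D where "doubling_measure (wm u) D" by (rule doubling_measure_wm)
  then interpret U: doubling_measure "wm u" D .
  obtain D' where "doubling_measure (wm s) D'" by (rule muckenhoupt_pair.doubling_measure_wm[OF swap])
  then interpret S: doubling_measure "wm s" D' .
  define c where "c = p * (1 - \<theta>)"
  \<comment> \<open>Since \<open>c * t = p\<close>, this is the exponent left for the outer maximal
    function; it exceeds 1 because \<theta> is positive.\<close>
  define t where "t = 1 / (1 - \<theta>)"
  have ct: "0 < c" "1 < t" "c * t = p" "1 / c * p = t" using theta assms by (auto simp: c_def t_def field_simps)
  define \<kappa> where "\<kappa> = K / unit_ball_vol (real CARD('n))"
  have \<kappa>: "0 < \<kappa>" unfolding \<kappa>_def using K_pos by simp
  define C1 where "C1 = 2 powr t * t * D / (t - 1)"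
  define C2 where "C2 = 2 powr p * p * D' / (p - 1)"
  have C12: "0 < C1" "0 < C2" unfolding C1_def C2_def using ct assms U.D_pos S.D_pos by auto
  show ?thesis
  proof (rule that[of "\<kappa> powr t * (C1 * C2)"])
    fix f :: "real^'n \<Rightarrow> ennreal" assume [measurable]: "f \<in> borel_measurable lebesgue"
    have [measurable]: "maxf (wm s) f \<in> borel_measurable lebesgue"
      using S.borel_measurable_maxf'[of "wm s" f] by (simp cong: measurable_cong_sets)
    define G where "G y = ennreal (1 / u y) * ennreal_powr (maxf (wm s) f y) c" for y
    have [measurable]: "G \<in> borel_measurable lebesgue" unfolding G_def by measurable
    have [measurable]: "maxf (wm u) G \<in> borel_measurable lebesgue"
      using U.borel_measurable_maxf'[of "wm u" G] by (simp cong: measurable_cong_sets)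
    define N where "N x = ennreal_powr (ennreal \<kappa> * maxf (wm u) G x) (1 / c)" for x
    have [measurable]: "N \<in> borel_measurable lebesgue" unfolding N_def by measurable
    have "nmean p f x r \<le> N x" (is "?L \<le> _") if "0 < r" for x r
    proof -
      have "ennreal_powr ?L c \<le> ennreal \<kappa> * maxf (wm u) G x"
        unfolding \<kappa>_def G_def c_def by (intro normalized_average_bound) (use that assms in auto)
      then have "ennreal_powr (ennreal_powr ?L c) (1 / c) \<le> N x" 
        unfolding N_def using ct by (intro ennreal_powr_mono) auto
      then show ?thesis using ct by (simp add: ennreal_powr_powr)
    qed
    moreover have "(\<integral>\<^sup>+x. ennreal_powr (N x) p \<partial>wm u) \<le> ennreal (\<kappa> powr t * (C1 * C2)) * (\<integral>\<^sup>+x. ennreal_powr (f x) p \<partial>wm s)"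
    proof -
      have "(\<integral>\<^sup>+x. ennreal_powr (N x) p \<partial>wm u) = (\<integral>\<^sup>+x. ennreal (\<kappa> powr t) * ennreal_powr (maxf (wm u) G x) t \<partial>wm u)"
        unfolding N_def ennreal_powr_powr ct using \<kappa> by (simp add: ennreal_powr_mult)
      also have "\<dots> = ennreal (\<kappa> powr t) * (\<integral>\<^sup>+x. ennreal_powr (maxf (wm u) G x) t \<partial>wm u)"
        by (intro nn_integral_cmult) measurable
      also have "\<dots> \<le> ennreal (\<kappa> powr t) * (ennreal C1 * (\<integral>\<^sup>+x. ennreal_powr (G x) t \<partial>wm u))"
        unfolding C1_def using ct by (intro mult_left_mono U.maxf_strong_type) auto
      also have "(\<integral>\<^sup>+x. ennreal_powr (G x) t \<partial>wm u) = (\<integral>\<^sup>+x. ennreal (u x) * ennreal_powr (G x) t \<partial>lebesgue)"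
        by (intro nn_integral_wm) measurable
      also have "\<dots> = (\<integral>\<^sup>+x. ennreal (s x) * ennreal_powr (maxf (wm s) f x) p \<partial>lebesgue)"
      proof (intro nn_integral_cong_AE, use dual in eventually_elim)
        fix x assume x: "0 < u x \<and> 0 < s x \<and> u x powr \<theta> * s x powr (1 - \<theta>) = 1"
        \<comment> \<open>Duality gives s = u^(1-t), which is what remains of the density u after
          1/u has been raised to the power t.\<close>
        have "s x = (s x powr (1 - \<theta>)) powr t" using x theta by (simp add: powr_powr t_def)
        also have "s x powr (1 - \<theta>) = u x powr (- \<theta>)" using x by (simp add: powr_minus field_simps)
        also have "(u x powr (- \<theta>)) powr t = u x powr (1 - t)" 
          unfolding powr_powr using theta by (intro arg_cong[where f = "(powr) (u x)"]) (simp add: t_def field_simps)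
        also have "\<dots> = u x * (1 / u x) powr t" using x by (simp add: powr_diff powr_divide)
        finally have *: "s x = u x * (1 / u x) powr t" .
        have "ennreal (u x) * ennreal_powr (G x) t = ennreal (u x) * ennreal ((1 / u x) powr t) * ennreal_powr (maxf (wm s) f x) p"
          using x by (simp add: G_def ennreal_powr_mult ennreal_powr_powr ct mult.assoc)
        also have "ennreal (u x) * ennreal ((1 / u x) powr t) = ennreal (s x)"
          unfolding * using x by (simp add: ennreal_mult)
        finally show "ennreal (u x) * ennreal_powr (G x) t = ennreal (s x) * ennreal_powr (maxf (wm s) f x) p" .
      qed
      also have "\<dots> = (\<integral>\<^sup>+x. ennreal_powr (maxf (wm s) f x) p \<partial>wm s)"
        by (intro nn_integral_wm[symmetric]) measurable
      also have "\<dots> \<le> ennreal C2 * (\<integral>\<^sup>+x. ennreal_powr (f x) p \<partial>wm s)"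
        unfolding C2_def using assms by (intro S.maxf_strong_type) auto
      also have "ennreal (\<kappa> powr t) * (ennreal C1 * (ennreal C2 * (\<integral>\<^sup>+x. ennreal_powr (f x) p \<partial>wm s)))
         = ennreal (\<kappa> powr t * (C1 * C2)) * (\<integral>\<^sup>+x. ennreal_powr (f x) p \<partial>wm s)"
        using C12 by (simp add: ennreal_mult mult.assoc)
      finally show ?thesis by (simp add: mult_left_mono)
    qed
    ultimately show "\<exists>N\<in>borel_measurable lebesgue. 
     (\<forall>x r. 0 < r \<longrightarrow> nmean p f x r \<le> N x) \<and>
     (\<integral>\<^sup>+x. ennreal_powr (N x) p \<partial>wm u) \<le> ennreal (\<kappa> powr t * (C1 * C2)) * (\<integral>\<^sup>+x. ennreal_powr (f x) p \<partial>wm s)"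
      by (intro bexI[of _ N]) auto
  qed (use \<kappa> C12 in auto)
qed

end

section \<open>Dyadic decomposition of the Riesz kernel\<close>

lemma ennreal_le_suminf: "(f i :: ennreal) \<le> (\<Sum>i. f i)"
  using sum_le_suminf[OF summableI, of "{i}" f] by simp

lemma measurable_riesz_kernel: "(\<lambda>y. ennreal (norm (x - y) powr b)) \<in> borel_measurable lebesgue"
  for x :: "real^'n"
proof -
  have "(\<lambda>y. ennreal (norm (x - y) powr b)) \<in> borel_measurable lborel" by simp
  then show ?thesis by (rule measurable_completion)
qed

text \<open>Common core of the near and the far estimate. On a shell the kernel is at most (R i /
  2)^(-\<beta>), and the shell is enlarged to its ball because only integrals over balls are
  controlled later. The point \<open>y = x\<close> is harmless, as
  \<open>0 powr - \<beta> = 0\<close>.\<close>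

lemma riesz_dyadic_le:
  fixes x :: "real^'n"
  assumes sets: "sets M = sets lebesgue" and g: "g \<in> borel_measurable lebesgue" and R: "\<And>i. 0 < R i" and "0 \<le> \<beta>"
    and A: "\<And>y. y \<in> A \<Longrightarrow> y \<noteq> x \<Longrightarrow> \<exists>i::nat. R i / 2 \<le> norm (x - y) \<and> norm (x - y) < R i"
  shows "(\<integral>\<^sup>+y\<in>A. ennreal (norm (x - y) powr - \<beta>) * g y \<partial>M)
    \<le> ennreal (2 powr \<beta>) * (\<Sum>i. ennreal (R i powr - \<beta>) * (\<integral>\<^sup>+y\<in>ball x (R i). g y \<partial>M))"
proof -
  have [measurable]: "g \<in> borel_measurable M" "\<And>r. ball x r \<in> sets M"
    using g by (simp_all add: sets cong: measurable_cong_sets)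
  let ?G = "\<lambda>i y. ennreal (2 powr \<beta>) * (ennreal (R i powr - \<beta>) * (g y * indicator (ball x (R i)) y))"
  have "(\<integral>\<^sup>+y\<in>A. ennreal (norm (x - y) powr - \<beta>) * g y \<partial>M) \<le> (\<integral>\<^sup>+y. (\<Sum>i. ?G i y) \<partial>M)"
  proof (rule nn_integral_mono)
    fix y
    show "ennreal (norm (x - y) powr - \<beta>) * g y * indicator A y \<le> (\<Sum>i. ?G i y)"
    proof (cases "y = x \<or> y \<notin> A")
      case False
      then obtain i where i: "R i / 2 \<le> norm (x - y)" "norm (x - y) < R i" using A by blast
      have "norm (x - y) powr - \<beta> \<le> (R i / 2) powr - \<beta>"
        using i(1) R[of i] assms(4) by (intro powr_mono2') auto
      also have "\<dots> = 2 powr \<beta> * R i powr - \<beta>"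
        using R[of i] by (subst powr_divide) (auto simp: powr_minus divide_inverse)
      finally have "ennreal (norm (x - y) powr - \<beta>) * g y \<le> ennreal (2 powr \<beta> * R i powr - \<beta>) * g y"
        by (intro mult_right_mono ennreal_leI) auto
      also have "\<dots> = ?G i y" using i(2) by (simp add: dist_norm ennreal_mult mult.assoc)
      also have "\<dots> \<le> (\<Sum>i. ?G i y)" by (rule ennreal_le_suminf)
      finally show ?thesis using False by simp
    qed auto
  qed
  also have "\<dots> = (\<Sum>i. (\<integral>\<^sup>+y. ?G i y \<partial>M))"
    by (intro nn_integral_suminf) measurable
  also have "\<dots> = (\<Sum>i. ennreal (2 powr \<beta>) * (ennreal (R i powr - \<beta>) * (\<integral>\<^sup>+y\<in>ball x (R i). g y \<partial>M)))"
    by (intro arg_cong[where f = suminf] ext) (subst nn_integral_cmult, measurable, subst nn_integral_cmult, measurable)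
  finally show ?thesis by (simp only: ennreal_suminf_cmult)
qed

lemma riesz_near:
  fixes x :: "real^'n"
  assumes "sets M = sets lebesgue" "g \<in> borel_measurable lebesgue" and R: "0 < R" and "0 \<le> \<beta>"
  shows "(\<integral>\<^sup>+y\<in>ball x R. ennreal (norm (x - y) powr - \<beta>) * g y \<partial>M)
    \<le> ennreal (2 powr \<beta>) * (\<Sum>i. ennreal ((R / 2 ^ i) powr - \<beta>) * (\<integral>\<^sup>+y\<in>ball x (R / 2 ^ i). g y \<partial>M))"
proof (rule riesz_dyadic_le[OF assms(1,2) _ assms(4)])
  fix y assume "y \<in> ball x R" "y \<noteq> x"
  then have d: "0 < norm (x - y)" "norm (x - y) < R" by (auto simp: dist_norm)
  obtain n where "R / norm (x - y) < 2 ^ n" using real_arch_pow[of 2 "R / norm (x - y)"] by auto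
  then have "R / 2 ^ n < norm (x - y)" using d by (simp add: field_simps)
  moreover have "R / 2 ^ Suc n \<le> R / 2 ^ n" using R by (intro divide_left_mono) auto
  ultimately have ex: "\<exists>i. R / 2 ^ Suc i \<le> norm (x - y)" by (intro exI[of _ n]) linarith
  \<comment> \<open>Minimality supplies the upper bound of the shell: the previous index fails, and
    for index 0 the bound is membership in the ball.\<close>
  define i where "i = (LEAST i. R / 2 ^ Suc i \<le> norm (x - y))"
  have "norm (x - y) < R / 2 ^ i"
  proof (cases i)
    case (Suc j)
    then have "\<not> R / 2 ^ Suc j \<le> norm (x - y)"
      using not_less_Least[of j "\<lambda>i. R / 2 ^ Suc i \<le> norm (x - y)"] by (simp add: i_def)
    then show ?thesis using Suc by simp
  qed (use d in simp)
  moreover have "R / 2 ^ Suc i \<le> norm (x - y)" unfolding i_def by (rule LeastI_ex[OF ex])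
  ultimately show "\<exists>i. R / 2 ^ i / 2 \<le> norm (x - y) \<and> norm (x - y) < R / 2 ^ i"
    by (intro exI[of _ i]) (simp add: mult.commute)
qed (use R in auto)

text \<open>The radii start at \<open>2 * R\<close>, since a point outside the ball of radius
  \<open>R\<close> lies in a shell from 2^i R to 2^(i+1) R.\<close>

lemma riesz_far:
  fixes x :: "real^'n"
  assumes "sets M = sets lebesgue" "g \<in> borel_measurable lebesgue" and R: "0 < R" and "0 \<le> \<beta>"
  shows "(\<integral>\<^sup>+y\<in>- ball x R. ennreal (norm (x - y) powr - \<beta>) * g y \<partial>M)
    \<le> ennreal (2 powr \<beta>) * (\<Sum>i. ennreal ((2 ^ Suc i * R) powr - \<beta>) * (\<integral>\<^sup>+y\<in>ball x (2 ^ Suc i * R). g y \<partial>M))"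
proof (rule riesz_dyadic_le[OF assms(1,2) _ assms(4)])
  fix y assume "y \<in> - ball x R"
  then have d: "R \<le> norm (x - y)" by (auto simp: dist_norm)
  obtain n where "norm (x - y) / R < 2 ^ n" using real_arch_pow[of 2 "norm (x - y) / R"] by auto
  then have "norm (x - y) < 2 ^ n * R" using R by (simp add: field_simps)
  moreover have "2 ^ n * R \<le> 2 ^ Suc n * R" using R by (intro mult_right_mono) auto
  ultimately have ex: "\<exists>i. norm (x - y) < 2 ^ Suc i * R" by (intro exI[of _ n]) linarith
  define i where "i = (LEAST i. norm (x - y) < 2 ^ Suc i * R)"
  have "2 ^ i * R \<le> norm (x - y)"
  proof (cases i)
    case (Suc j)
    then have "\<not> norm (x - y) < 2 ^ Suc j * R"
      using not_less_Least[of j "\<lambda>i. norm (x - y) < 2 ^ Suc i * R"] by (simp add: i_def)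
    then show ?thesis using Suc by simp
  qed (use d in simp)
  moreover have "norm (x - y) < 2 ^ Suc i * R" unfolding i_def by (rule LeastI_ex[OF ex])
  ultimately show "\<exists>i. 2 ^ Suc i * R / 2 \<le> norm (x - y) \<and> norm (x - y) < 2 ^ Suc i * R"
    by (intro exI[of _ i]) simp
qed (use R in auto)

lemma suminf_geometric_ennreal:
  assumes "0 \<le> \<rho>" "\<rho> < 1"
  shows "(\<Sum>i. c * ennreal (\<rho> ^ i)) = c * ennreal (1 / (1 - \<rho>))"
proof -
  have "(\<Sum>i. ennreal (\<rho> ^ i)) = ennreal (1 / (1 - \<rho>))"
    using assms geometric_sums[of \<rho>] by (intro suminf_ennreal_eq) auto
  then show ?thesis by simp
qed

lemma inverse_mult_le_flip:
  fixes a b c x :: real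
  assumes "a * x \<le> c * b" "0 < a" "0 < b"
  shows "inverse b * x \<le> c * inverse a"
  using assms by (simp add: field_simps)

section \<open>Hedberg's inequality in terms of the measure of balls\<close>

context muckenhoupt_pair
begin

lemma nn_integral_ball_Holder:
  assumes [measurable]: "f \<in> borel_measurable lebesgue" and "1 < p"
  shows "(\<integral>\<^sup>+y\<in>ball x r. f y \<partial>wm s) 
    \<le> ennreal_powr (\<integral>\<^sup>+y\<in>ball x r. ennreal_powr (f y) p \<partial>wm s) (1 / p) * ennreal (sb x r powr (1 - 1 / p))"
proof -
  have "(\<integral>\<^sup>+y\<in>ball x r. f y \<partial>wm s) = (\<integral>\<^sup>+y. ennreal_powr (ennreal_powr (f y) p * indicator (ball x r) y) (1 / p) 
     * ennreal_powr (indicator (ball x r) y) (1 - 1 / p) \<partial>wm s)"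
    using assms(2) by (intro nn_integral_cong) (auto simp: indicator_def ennreal_powr_powr)
  also have "\<dots> \<le> ennreal_powr (\<integral>\<^sup>+y\<in>ball x r. ennreal_powr (f y) p \<partial>wm s) (1 / p) * ennreal_powr (\<integral>\<^sup>+y. indicator (ball x r) y \<partial>wm s) (1 - 1 / p)"
    using assms(2) by (intro nn_integral_Holder) (auto intro!: borel_measurable_times_ennreal borel_measurable_indicator)
  also have "(\<integral>\<^sup>+y. indicator (ball x r) y \<partial>wm s) = ennreal (sb x r)"
    by (simp add: emeasure_wm_ball)
  finally show ?thesis by simp
qed

text \<open>\<open>ball_cond\<close> raised to the power \<tau> = 1/q + 1 - 1/p. The hypothesis on
  \<theta> says \<theta> \<tau> = 1/q, hence (1-\<theta>) \<tau> = 1 - 1/p. The radius and the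
  \<open>s\<close>-measure are thereby traded for the \<open>u\<close>-measure alone.\<close>

lemma ball_cond_powr:
  assumes "1 < p" "1 < q" and "\<theta> * (1 / q + 1 - 1 / p) = 1 / q" "0 < r"
  shows "r powr - (real CARD('n) * (1 / q + 1 - 1 / p)) * sb x r powr (1 - 1 / p)
     \<le> K powr (1 / q + 1 - 1 / p) * ub x r powr - (1 / q)"
proof -
  define \<tau> where "\<tau> = 1 / q + 1 - 1 / p"
  define U where "U = ub x r"
  define S where "S = sb x r"
  have pos: "0 < U" "0 < S"
    using wm_ball_pos[OF assms(4), of x] wm_s_pos[OF assms(4), of x] by (auto simp: U_def S_def)
  have "1 / p < 1" "0 < 1 / q" using assms by auto
  then have \<tau>: "0 < \<tau>" "\<theta> * \<tau> = 1 / q" using assms(3) unfolding \<tau>_def by linarith+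
  have "(1 - \<theta>) * \<tau> = \<tau> - \<theta> * \<tau>" by (simp add: left_diff_distrib)
  then have \<tau>': "(1 - \<theta>) * \<tau> = 1 - 1 / p" unfolding \<tau>(2) by (simp add: \<tau>_def)
  have "(U powr \<theta> * S powr (1 - \<theta>)) powr \<tau> \<le> (K * r ^ CARD('n)) powr \<tau>"
    using ball_cond[OF assms(4), of x] \<tau> by (intro powr_mono2) (auto simp: U_def S_def)
  also have "\<dots> = K powr \<tau> * r powr (real CARD('n) * \<tau>)"
    using assms(4) K_pos by (simp add: powr_mult powr_powr powr_realpow[symmetric])
  also have "(U powr \<theta> * S powr (1 - \<theta>)) powr \<tau> = U powr (1 / q) * S powr (1 - 1 / p)"
    using pos by (simp add: powr_mult powr_powr \<tau> \<tau>')
  finally have "U powr (1 / q) * S powr (1 - 1 / p) \<le> K powr \<tau> * r powr (real CARD('n) * \<tau>)" .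
  then show ?thesis unfolding U_def[symmetric] S_def[symmetric] \<tau>_def[symmetric]
    unfolding powr_minus using pos assms(4) by (intro inverse_mult_le_flip) auto
qed

lemma wm_ball_geometric:
  assumes "\<forall>x r. 0 < r \<longrightarrow> ub x r \<le> \<rho> * ub x (2 * r)" "0 < \<rho>" "0 < r"
  shows "ub x r \<le> \<rho> ^ i * ub x (2 ^ i * r)"
proof (induction i)
  case (Suc i)
  have "ub x (2 ^ i * r) \<le> \<rho> * ub x (2 * (2 ^ i * r))"
    using assms by simp
  then have "\<rho> ^ i * ub x (2 ^ i * r) \<le> \<rho> ^ i * (\<rho> * ub x (2 * (2 ^ i * r)))"
    using assms by (intro mult_left_mono) auto
  with Suc show ?case by (simp add: mult_ac)
qed simp

text \<open>Reverse doubling drives the measure of balls to 0 and to infinity along dyadic radii.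
  The first dyadic radius whose measure exceeds \<open>a\<close> therefore exists, and
  \<open>R\<close> is half of it.\<close>

lemma exists_radius:
  assumes "0 < a"
  obtains R where "0 < R" "ub x R \<le> a" "a < ub x (2 * R)"
proof -
  obtain \<rho> where \<rho>: "0 < \<rho>" "\<rho> < 1" "\<forall>x r. 0 < r \<longrightarrow> ub x r \<le> \<rho> * ub x (2 * r)"
    using wm_reverse_doubling by blast
  note geo = wm_ball_geometric[OF \<rho>(3,1)]
  define U1 where "U1 = ub x 1"
  have U1: "0 < U1" unfolding U1_def by (rule wm_ball_pos) simp
  obtain n where n: "\<rho> ^ n < a / U1" using real_arch_pow_inv[of "a / U1" \<rho>] \<rho> U1 assms by auto
  define r0 where "r0 = 1 / (2::real) ^ n"
  have r0: "0 < r0" by (simp add: r0_def)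
  have "ub x r0 \<le> \<rho> ^ n * U1"
    using geo[OF r0, of x n] by (simp add: r0_def U1_def)
  also have "\<dots> < a" using n U1 by (simp add: field_simps)
  finally have s: "ub x r0 < a" .
  define U0 where "U0 = ub x r0"
  have U0: "0 < U0" unfolding U0_def using r0 by (rule wm_ball_pos)
  obtain m where m: "\<rho> ^ m < U0 / a" using real_arch_pow_inv[of "U0 / a" \<rho>] \<rho> U0 assms by auto
  have "a * \<rho> ^ m < \<rho> ^ m * ub x (2 ^ m * r0)"
    using m geo[OF r0, of x m] assms by (simp add: U0_def field_simps)
  then have ex: "\<exists>m. a < ub x (2 ^ m * r0)" using \<rho>(1) by (intro exI[of _ m]) (simp add: mult.commute)
  define k where "k = (LEAST m. a < ub x (2 ^ m * r0))"
  have k: "a < ub x (2 ^ k * r0)" unfolding k_def by (rule LeastI_ex[OF ex])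
  then have "k \<noteq> 0" using s by (cases k) auto
  then obtain j where j: "k = Suc j" by (cases k) auto
  then have "\<not> a < ub x (2 ^ j * r0)"
    using not_less_Least[of j "\<lambda>m. a < ub x (2 ^ m * r0)"] by (simp add: k_def)
  then show ?thesis using k j r0 by (intro that[of "2 ^ j * r0"]) (auto simp: mult_ac)
qed

text \<open>Hedberg's argument, with the scale measured by \<open>u (ball x R)\<close> instead of \<open>R\<close>.\<close>

lemma Hedberg_two_terms:
  assumes pq: "1 < p" "p < q" "\<theta> * (1 / q + 1 - 1 / p) = 1 / q"
  obtains C where "0 < C"
    "\<And>f x N a. f \<in> borel_measurable lebesgue \<Longrightarrow> 0 < a \<Longrightarrow>
     (\<And>r. 0 < r \<Longrightarrow> nmean p f x r \<le> N) \<Longrightarrow>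
     (\<integral>\<^sup>+y. ennreal (norm (x - y) powr - (real CARD('n) * (1 / q + 1 - 1 / p))) * f y \<partial>wm s)
      \<le> ennreal C * (ennreal (a powr (1 / p - 1 / q)) * N + 
          ennreal (a powr - (1 / q)) * ennreal_powr (\<integral>\<^sup>+y. ennreal_powr (f y) p \<partial>wm s) (1 / p))"
proof -
  define \<tau> where "\<tau> = 1 / q + 1 - 1 / p"
  define \<beta> where "\<beta> = real CARD('n) * \<tau>"
  define \<delta> where "\<delta> = 1 / p - 1 / q"
  have "1 / p < 1" "0 < 1 / q" using pq by auto
  then have "0 < \<tau>" unfolding \<tau>_def by linarith
  then have \<tau>: "0 < \<tau>" "0 \<le> \<beta>" by (auto simp: \<beta>_def)
  have \<delta>: "0 < \<delta>" using pq by (simp add: \<delta>_def frac_less2)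
  obtain \<rho> where \<rho>: "0 < \<rho>" "\<rho> < 1" "\<forall>x r. 0 < r \<longrightarrow> ub x r \<le> \<rho> * ub x (2 * r)"
    using wm_reverse_doubling by blast
  note geo = wm_ball_geometric[OF \<rho>(3,1)]
  \<comment> \<open>Ratios of two geometric series: halving the radius multiplies the
    \<open>u\<close>-measure by at most \<rho>, which enters the near terms with exponent \<delta>
    and, for growing radii, the far terms with exponent 1/q.\<close>
  define \<rho>1 where "\<rho>1 = \<rho> powr \<delta>"
  define \<rho>2 where "\<rho>2 = \<rho> powr (1 / q)"
  have \<rho>12: "0 < \<rho>1" "\<rho>1 < 1" "0 < \<rho>2" "\<rho>2 < 1"
    using \<rho>(1,2) \<delta> pq powr_less_mono2[of \<delta> \<rho> 1] powr_less_mono2[of "1 / q" \<rho> 1]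
    by (auto simp: \<rho>1_def \<rho>2_def)
  define M where "M = max (1 / (1 - \<rho>1)) (1 / (1 - \<rho>2))"
  have M: "0 < M" unfolding M_def using \<rho>12 by (simp add: less_max_iff_disj)
  define C where "C = 2 powr \<beta> * K powr \<tau> * M"
  have C: "0 < C" unfolding C_def using M K_pos by simp
  show ?thesis
  proof (rule that[OF C])
    fix f :: "real^'n \<Rightarrow> ennreal" and x N and a :: real
    assume [measurable]: "f \<in> borel_measurable lebesgue" and a: "0 < a"
      and N: "\<And>r. 0 < r \<Longrightarrow> nmean p f x r \<le> N"
    define U where "U r = ub x r" for r
    define S where "S r = sb x r" for r
    define I where "I r = (\<integral>\<^sup>+y\<in>ball x r. f y \<partial>wm s)" for r
    define F where "F = ennreal_powr (\<integral>\<^sup>+y. ennreal_powr (f y) p \<partial>wm s) (1 / p)"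
    have U: "0 < U r" "0 < S r" if "0 < r" for r
      using wm_ball_pos[OF that, of x] wm_s_pos[OF that, of x] by (auto simp: U_def S_def)
    have cond: "r powr - \<beta> * S r powr (1 - 1 / p) \<le> K powr \<tau> * U r powr - (1 / q)" if "0 < r" for r
      using ball_cond_powr[OF _ _ pq(3) that, of x] pq that by (simp add: \<tau>_def \<beta>_def U_def S_def)
    \<comment> \<open>The bound for large scales: Hoelder on the ball uses the full norm of
      \<open>f\<close>, and the result decays as the \<open>u\<close>-measure grows.\<close>
    have large: "ennreal (r powr - \<beta>) * I r \<le> ennreal (K powr \<tau> * U r powr - (1 / q)) * F" if "0 < r" for r
    proof -
      have "I r \<le> F * ennreal (S r powr (1 - 1 / p))"
      proof -
        have "I r \<le> ennreal_powr (\<integral>\<^sup>+y\<in>ball x r. ennreal_powr (f y) p \<partial>wm s) (1 / p) * ennreal (S r powr (1 - 1 / p))"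
          unfolding I_def S_def using pq by (intro nn_integral_ball_Holder) auto
        also have "\<dots> \<le> F * ennreal (S r powr (1 - 1 / p))"
          unfolding F_def using pq by (intro mult_right_mono ennreal_powr_mono nn_integral_mono) (auto simp: indicator_def)
        finally show ?thesis .
      qed
      then have "ennreal (r powr - \<beta>) * I r \<le> ennreal (r powr - \<beta>) * (F * ennreal (S r powr (1 - 1 / p)))"
        by (rule mult_left_mono) simp
      also have "\<dots> = ennreal (r powr - \<beta> * S r powr (1 - 1 / p)) * F"
        by (simp add: ennreal_mult mult_ac)
      also have "\<dots> \<le> ennreal (K powr \<tau> * U r powr - (1 / q)) * F"
        by (intro mult_right_mono ennreal_leI cond that) simp
      finally show ?thesis .
    qed
    \<comment> \<open>The bound for small scales: splitting off the normalized average leaves a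
      positive power of the \<open>u\<close>-measure, which decays as the ball shrinks.\<close>
    have small: "ennreal (r powr - \<beta>) * I r \<le> ennreal (K powr \<tau> * U r powr \<delta>) * N" if "0 < r" for r
    proof -
      let ?c = "K powr \<tau> * U r powr \<delta>"
      have "r powr - \<beta> * S r = r powr - \<beta> * S r powr (1 - 1 / p) * S r powr (1 / p)"
        using U[OF that] by (simp add: powr_diff)
      also have "\<dots> \<le> K powr \<tau> * U r powr - (1 / q) * S r powr (1 / p)"
        using cond[OF that] by (rule mult_right_mono) simp
      also have "\<dots> = K powr \<tau> * U r powr \<delta> * (S r / U r) powr (1 / p)"
        using U[OF that] by (simp add: \<delta>_def powr_divide powr_diff powr_minus_divide)
      finally have 1: "r powr - \<beta> * S r \<le> ?c * (S r / U r) powr (1 / p)" .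
      have "ennreal (r powr - \<beta>) * I r = ennreal (r powr - \<beta>) * (ennreal (S r) * (I r / ennreal (S r)))"
        using U[OF that] by (simp add: ennreal_mult_divide_cancel)
      also have "\<dots> = ennreal (r powr - \<beta> * S r) * (I r / ennreal (S r))"
        using U[OF that] by (simp add: ennreal_mult mult.assoc)
      also have "\<dots> \<le> ennreal (?c * (S r / U r) powr (1 / p)) * (I r / ennreal (S r))"
        using 1 by (intro mult_right_mono ennreal_leI) auto
      also have "\<dots> = ennreal ?c * (ennreal ((S r / U r) powr (1 / p)) * (I r / ennreal (S r)))"
        by (simp add: ennreal_mult mult.assoc)
      also have "\<dots> \<le> ennreal ?c * N"
        using N[OF that] by (intro mult_left_mono) (auto simp: S_def U_def I_def emeasure_wm_ball)
      finally show ?thesis .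
    qed
    \<comment> \<open>The scale at which the \<open>u\<close>-measure crosses \<open>a\<close>. The
      near terms decrease geometrically from a^\<delta> and the far terms from a^(-1/q).\<close>
    obtain R where R: "0 < R" "U R \<le> a" "a < U (2 * R)"
      using exists_radius[OF a, of x] by (auto simp: U_def)
    have near: "(\<integral>\<^sup>+y\<in>ball x R. ennreal (norm (x - y) powr - \<beta>) * f y \<partial>wm s) \<le> ennreal C * (ennreal (a powr \<delta>) * N)"
    proof -
      have "(\<integral>\<^sup>+y\<in>ball x R. ennreal (norm (x - y) powr - \<beta>) * f y \<partial>wm s)
        \<le> ennreal (2 powr \<beta>) * (\<Sum>i. ennreal ((R / 2 ^ i) powr - \<beta>) * I (R / 2 ^ i))"
        unfolding I_def using R \<tau> by (intro riesz_near) auto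
      also have "\<dots> \<le> ennreal (2 powr \<beta>) * (\<Sum>i. (ennreal (K powr \<tau> * a powr \<delta>) * N) * ennreal (\<rho>1 ^ i))"
      proof (intro mult_left_mono suminf_le summableI)
        fix i
        have pos: "0 < R / 2 ^ i" using R by simp
        have "U (R / 2 ^ i) \<le> \<rho> ^ i * U R" using geo[OF pos, of x i] by (simp add: U_def)
        also have "\<dots> \<le> \<rho> ^ i * a" using R \<rho> by simp
        finally have "U (R / 2 ^ i) powr \<delta> \<le> (\<rho> ^ i * a) powr \<delta>"
          using \<delta> U[OF pos] by (intro powr_mono2) auto
        also have "\<dots> = \<rho>1 ^ i * a powr \<delta>"
          using \<rho> a by (simp add: powr_mult \<rho>1_def powr_powr mult.commute flip: powr_realpow)
        finally have 2: "K powr \<tau> * U (R / 2 ^ i) powr \<delta> \<le> K powr \<tau> * (\<rho>1 ^ i * a powr \<delta>)"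
          by (rule mult_left_mono) simp
        have "ennreal ((R / 2 ^ i) powr - \<beta>) * I (R / 2 ^ i) \<le> ennreal (K powr \<tau> * U (R / 2 ^ i) powr \<delta>) * N"
          using pos by (rule small)
        also have "\<dots> \<le> ennreal (K powr \<tau> * (\<rho>1 ^ i * a powr \<delta>)) * N"
          using 2 by (intro mult_right_mono ennreal_leI) auto
        also have "\<dots> = (ennreal (K powr \<tau> * a powr \<delta>) * N) * ennreal (\<rho>1 ^ i)"
          using \<rho>12 by (simp add: ennreal_mult mult_ac)
        finally show "ennreal ((R / 2 ^ i) powr - \<beta>) * I (R / 2 ^ i) \<le> (ennreal (K powr \<tau> * a powr \<delta>) * N) * ennreal (\<rho>1 ^ i)" .
      qed auto
      also have "\<dots> = ennreal (2 powr \<beta>) * (ennreal (K powr \<tau> * a powr \<delta>) * N * ennreal (1 / (1 - \<rho>1)))"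
        using \<rho>12 by (subst suminf_geometric_ennreal) auto
      also have "\<dots> \<le> ennreal (2 powr \<beta>) * (ennreal (K powr \<tau> * a powr \<delta>) * N * ennreal M)"
        by (intro mult_left_mono ennreal_leI) (auto simp: M_def)
      also have "\<dots> = ennreal C * (ennreal (a powr \<delta>) * N)"
        unfolding C_def using M by (simp add: ennreal_mult mult_ac)
      finally show ?thesis .
    qed
    have far: "(\<integral>\<^sup>+y\<in>- ball x R. ennreal (norm (x - y) powr - \<beta>) * f y \<partial>wm s) \<le> ennreal C * (ennreal (a powr - (1 / q)) * F)"
    proof -
      have "(\<integral>\<^sup>+y\<in>- ball x R. ennreal (norm (x - y) powr - \<beta>) * f y \<partial>wm s)
        \<le> ennreal (2 powr \<beta>) * (\<Sum>i. ennreal ((2 ^ Suc i * R) powr - \<beta>) * I (2 ^ Suc i * R))"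
        unfolding I_def using R \<tau> by (intro riesz_far) auto
      also have "\<dots> \<le> ennreal (2 powr \<beta>) * (\<Sum>i. (ennreal (K powr \<tau> * a powr - (1 / q)) * F) * ennreal (\<rho>2 ^ i))"
      proof (intro mult_left_mono suminf_le summableI)
        fix i
        have pos: "0 < 2 ^ Suc i * R" "0 < 2 * R" using R by auto
        have "a \<le> \<rho> ^ i * U (2 ^ Suc i * R)"
          using geo[OF pos(2), of x i] R(3) by (simp add: U_def mult_ac)
        then have "a powr (1 / q) \<le> (\<rho> ^ i * U (2 ^ Suc i * R)) powr (1 / q)"
          using a pq by (intro powr_mono2) auto
        also have "\<dots> = \<rho>2 ^ i * U (2 ^ Suc i * R) powr (1 / q)"
          using \<rho> U[OF pos(1)] by (simp add: powr_mult \<rho>2_def powr_powr mult.commute flip: powr_realpow)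
        finally have "U (2 ^ Suc i * R) powr - (1 / q) \<le> \<rho>2 ^ i * a powr - (1 / q)"
          using U[OF pos(1)] a inverse_mult_le_flip[of "a powr (1 / q)" 1 "\<rho>2 ^ i" "U (2 ^ Suc i * R) powr (1 / q)"]
          unfolding powr_minus by (simp del: power_Suc)
        then have 2: "K powr \<tau> * U (2 ^ Suc i * R) powr - (1 / q) \<le> K powr \<tau> * (\<rho>2 ^ i * a powr - (1 / q))"
          by (rule mult_left_mono) simp
        have "ennreal ((2 ^ Suc i * R) powr - \<beta>) * I (2 ^ Suc i * R) \<le> ennreal (K powr \<tau> * U (2 ^ Suc i * R) powr - (1 / q)) * F"
          using pos(1) by (rule large)
        also have "\<dots> \<le> ennreal (K powr \<tau> * (\<rho>2 ^ i * a powr - (1 / q))) * F"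
          using 2 by (intro mult_right_mono ennreal_leI) auto
        also have "\<dots> = (ennreal (K powr \<tau> * a powr - (1 / q)) * F) * ennreal (\<rho>2 ^ i)"
          using \<rho>12 by (simp add: ennreal_mult mult_ac)
        finally show "ennreal ((2 ^ Suc i * R) powr - \<beta>) * I (2 ^ Suc i * R) \<le> (ennreal (K powr \<tau> * a powr - (1 / q)) * F) * ennreal (\<rho>2 ^ i)" .
      qed auto
      also have "\<dots> = ennreal (2 powr \<beta>) * (ennreal (K powr \<tau> * a powr - (1 / q)) * F * ennreal (1 / (1 - \<rho>2)))"
        using \<rho>12 by (subst suminf_geometric_ennreal) auto
      also have "\<dots> \<le> ennreal (2 powr \<beta>) * (ennreal (K powr \<tau> * a powr - (1 / q)) * F * ennreal M)"
        by (intro mult_left_mono ennreal_leI) (auto simp: M_def)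
      also have "\<dots> = ennreal C * (ennreal (a powr - (1 / q)) * F)"
        unfolding C_def using M by (simp add: ennreal_mult mult_ac)
      finally show ?thesis .
    qed
    have "(\<integral>\<^sup>+y. ennreal (norm (x - y) powr - \<beta>) * f y \<partial>wm s) = 
      (\<integral>\<^sup>+y. ennreal (norm (x - y) powr - \<beta>) * f y * indicator (ball x R) y + ennreal (norm (x - y) powr - \<beta>) * f y * indicator (- ball x R) y \<partial>wm s)"
      by (intro nn_integral_cong) (auto simp: indicator_def)
    also have "\<dots> = (\<integral>\<^sup>+y\<in>ball x R. ennreal (norm (x - y) powr - \<beta>) * f y \<partial>wm s) + (\<integral>\<^sup>+y\<in>- ball x R. ennreal (norm (x - y) powr - \<beta>) * f y \<partial>wm s)"
    proof (intro nn_integral_add)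
      have [measurable]: "f \<in> borel_measurable (wm s)" "ball x R \<in> sets (wm s)" 
        "(\<lambda>y. ennreal (norm (x - y) powr - \<beta>)) \<in> borel_measurable (wm s)"
        using measurable_riesz_kernel[of x "- \<beta>"] by (simp_all cong: measurable_cong_sets)
      show "(\<lambda>y. ennreal (norm (x - y) powr - \<beta>) * f y * indicator (ball x R) y) \<in> borel_measurable (wm s)"
        "(\<lambda>y. ennreal (norm (x - y) powr - \<beta>) * f y * indicator (- ball x R) y) \<in> borel_measurable (wm s)"
        by measurable
    qed
    also have "\<dots> \<le> ennreal C * (ennreal (a powr \<delta>) * N) + ennreal C * (ennreal (a powr - (1 / q)) * F)"
      by (intro add_mono near far)
    finally show "(\<integral>\<^sup>+y. ennreal (norm (x - y) powr - (real CARD('n) * (1 / q + 1 - 1 / p))) * f y \<partial>wm s)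
      \<le> ennreal C * (ennreal (a powr (1 / p - 1 / q)) * N + 
          ennreal (a powr - (1 / q)) * ennreal_powr (\<integral>\<^sup>+y. ennreal_powr (f y) p \<partial>wm s) (1 / p))"
      by (simp add: \<delta>_def F_def \<beta>_def \<tau>_def distrib_left)
  qed
qed

end

text \<open>Minimization over the level \<open>a\<close>. An infinite \<open>N\<close> makes the
  right-hand side infinite because \<open>J\<close> and \<open>C\<close> are positive;
  \<open>N = 0\<close> corresponds to letting \<open>a\<close> tend to infinity.\<close>

lemma Hedberg_optimize:
  fixes I N J :: ennreal and C p q :: real
  assumes "\<And>a. 0 < a \<Longrightarrow> I \<le> ennreal C * (ennreal (a powr (1 / p - 1 / q)) * N + ennreal (a powr - (1 / q)) * ennreal_powr J (1 / p))"
    and "0 < C" "1 < p" "p < q" "0 < J" "J < \<infinity>"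
  shows "I \<le> ennreal (2 * C) * (ennreal_powr J (1 / p - 1 / q) * ennreal_powr N (p / q))"
proof -
  obtain j where j: "J = ennreal j" "0 < j" using assms(5,6) by (cases J) (auto simp: zero_less_iff_neq_zero)
  show ?thesis
  proof (cases N)
    case top
    then show ?thesis using j assms by (simp add: ennreal_mult_top)
  next
    case (real \<nu>)
    show ?thesis
    proof (cases "\<nu> = 0")
      case True
      have "I \<le> 0"
      proof (rule ennreal_le_epsilon)
        fix e :: real assume e: "0 < e"
        \<comment> \<open>With this level the only surviving term equals \<open>e\<close>
          exactly.\<close>
        define a where "a = (C * j powr (1 / p) / e) powr q"
        have a: "0 < a" using assms e j by (simp add: a_def)
        have "I \<le> ennreal C * (ennreal (a powr - (1 / q)) * ennreal_powr J (1 / p))"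
          using assms(1)[OF a] True real by simp
        also have "a powr - (1 / q) = inverse (C * j powr (1 / p) / e)"
          using assms e j by (simp add: a_def powr_powr powr_minus)
        also have "ennreal C * (ennreal (inverse (C * j powr (1 / p) / e)) * ennreal_powr J (1 / p)) = ennreal e"
          using assms e j by (simp add: ennreal_mult[symmetric])
        finally show "I \<le> 0 + ennreal e" by simp
      qed
      then show ?thesis by simp
    next
      case False
      then have \<nu>: "0 < \<nu>" using real by simp
      \<comment> \<open>The level at which the two terms agree; both become j^(1/p - 1/q)
        \<nu>^(p/q).\<close>
      define a where "a = j / \<nu> powr p"
      have a: "0 < a" using \<nu> j by (simp add: a_def)
      have "a powr (1 / p - 1 / q) * \<nu> = j powr (1 / p - 1 / q) * (\<nu> powr 1 / \<nu> powr (p * (1 / p - 1 / q)))"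
        using \<nu> j by (simp add: a_def powr_divide powr_powr)
      also have "\<dots> = j powr (1 / p - 1 / q) * \<nu> powr (1 - p * (1 / p - 1 / q))"
        by (simp only: powr_diff)
      also have "1 - p * (1 / p - 1 / q) = p / q" using assms by (simp add: field_simps)
      finally have 1: "a powr (1 / p - 1 / q) * \<nu> = j powr (1 / p - 1 / q) * \<nu> powr (p / q)" .
      have "a powr - (1 / q) * j powr (1 / p) = j powr (- (1 / q)) * j powr (1 / p) / \<nu> powr (p * (- (1 / q)))"
        using \<nu> j by (simp add: a_def powr_divide powr_powr)
      also have "\<dots> = j powr (1 / p - 1 / q) * \<nu> powr (p / q)"
        using \<nu> by (simp add: powr_minus powr_diff field_simps)
      finally have 2: "a powr - (1 / q) * j powr (1 / p) = j powr (1 / p - 1 / q) * \<nu> powr (p / q)" .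
      have "I \<le> ennreal (C * (a powr (1 / p - 1 / q) * \<nu> + a powr - (1 / q) * j powr (1 / p)))"
        using assms(1)[OF a] j \<nu> real(2) assms(2)
        by (simp add: ennreal_mult[symmetric] ennreal_plus[symmetric] del: ennreal_plus)
      also have "\<dots> = ennreal (2 * C) * (ennreal_powr J (1 / p - 1 / q) * ennreal_powr N (p / q))"
        unfolding 1 2 using j \<nu> real(2) assms(2) by (simp add: ennreal_mult[symmetric])
      finally show ?thesis .
    qed
  qed
qed

section \<open>The strong type bound for the positive fractional integral\<close>

context muckenhoupt_pair
begin

text \<open>Hedberg's inequality raised to the power \<open>q\<close> leaves J^(q/p - 1) N^p. The
  integral of N^p against \<open>u\<close> is at most a multiple of \<open>J\<close>, which
  completes the exponent to q/p.\<close>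

proposition fractional_integral_strong_type:
  assumes pq: "1 < p" "p < q" "\<theta> * (1 / q + 1 - 1 / p) = 1 / q"
  obtains C where "0 < C" "\<And>f. f \<in> borel_measurable lebesgue \<Longrightarrow>
    (\<integral>\<^sup>+x. ennreal_powr (\<integral>\<^sup>+y. ennreal (norm (x - y) powr - (real CARD('n) * (1 / q + 1 - 1 / p))) * f y \<partial>wm s) q \<partial>wm u)
      \<le> ennreal C * ennreal_powr (\<integral>\<^sup>+y. ennreal_powr (f y) p \<partial>wm s) (q / p)"
proof -
  obtain C1 where C1: "0 < C1" "\<And>f x N a. f \<in> borel_measurable lebesgue \<Longrightarrow> 0 < a \<Longrightarrow>
     (\<And>r. 0 < r \<Longrightarrow> nmean p f x r \<le> N) \<Longrightarrow>
     (\<integral>\<^sup>+y. ennreal (norm (x - y) powr - (real CARD('n) * (1 / q + 1 - 1 / p))) * f y \<partial>wm s)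
      \<le> ennreal C1 * (ennreal (a powr (1 / p - 1 / q)) * N + 
          ennreal (a powr - (1 / q)) * ennreal_powr (\<integral>\<^sup>+y. ennreal_powr (f y) p \<partial>wm s) (1 / p))"
    using Hedberg_two_terms[OF pq] by blast
  obtain C2 where C2: "0 < C2" "\<And>f. f \<in> borel_measurable lebesgue \<Longrightarrow> \<exists>N\<in>borel_measurable lebesgue. 
     (\<forall>x r. 0 < r \<longrightarrow> nmean p f x r \<le> N x) \<and>
     (\<integral>\<^sup>+x. ennreal_powr (N x) p \<partial>wm u) \<le> ennreal C2 * (\<integral>\<^sup>+x. ennreal_powr (f x) p \<partial>wm s)"
    using normalized_maximal[OF pq(1)] by blast
  define C where "C = (2 * C1) powr q * C2"
  have C: "0 < C" using C1(1) C2(1) by (simp add: C_def)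
  show ?thesis
  proof (rule that[OF C])
    fix f :: "real^'n \<Rightarrow> ennreal" assume f [measurable]: "f \<in> borel_measurable lebesgue"
    have [measurable]: "f \<in> borel_measurable (wm s)" using f by (simp cong: measurable_cong_sets)
    define J where "J = (\<integral>\<^sup>+y. ennreal_powr (f y) p \<partial>wm s)"
    define I where "I x = (\<integral>\<^sup>+y. ennreal (norm (x - y) powr - (real CARD('n) * (1 / q + 1 - 1 / p))) * f y \<partial>wm s)" for x
    obtain N where N [measurable]: "N \<in> borel_measurable lebesgue"
      and N1: "\<And>x r. 0 < r \<Longrightarrow> nmean p f x r \<le> N x"
      and N2: "(\<integral>\<^sup>+x. ennreal_powr (N x) p \<partial>wm u) \<le> ennreal C2 * J"
      using C2(2)[OF f] unfolding J_def by blast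
    have [measurable]: "N \<in> borel_measurable (wm u)" using N by (simp cong: measurable_cong_sets)
    consider "J = 0" | "J = \<infinity>" | "0 < J" "J < \<infinity>" by (cases J) (auto simp: less_top zero_less_iff_neq_zero)
    then have "(\<integral>\<^sup>+x. ennreal_powr (I x) q \<partial>wm u) \<le> ennreal C * ennreal_powr J (q / p)"
    proof cases
      case 1
      then have ae: "AE y in wm s. f y = 0" unfolding J_def by (subst (asm) nn_integral_0_iff_AE) auto
      have "I x = 0" for x
      proof -
        have "I x = (\<integral>\<^sup>+y. 0 \<partial>wm s)" unfolding I_def using ae by (intro nn_integral_cong_AE) auto
        then show ?thesis by simp
      qed
      then show ?thesis by simp
    next
      case 2
      then show ?thesis using C by (simp add: ennreal_mult_top)
    next
      case 3
      have "ennreal_powr (I x) q \<le> ennreal ((2 * C1) powr q) * ennreal_powr J (q / p - 1) * ennreal_powr (N x) p" for x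
      proof -
        have "I x \<le> ennreal (2 * C1) * (ennreal_powr J (1 / p - 1 / q) * ennreal_powr (N x) (p / q))"
          using C1(2)[OF f _ N1] pq C1(1) 3 unfolding I_def J_def by (intro Hedberg_optimize) auto
        then have "ennreal_powr (I x) q \<le> ennreal_powr (ennreal (2 * C1) * (ennreal_powr J (1 / p - 1 / q) * ennreal_powr (N x) (p / q))) q"
          using pq by (intro ennreal_powr_mono) auto
        also have "\<dots> = ennreal ((2 * C1) powr q) * (ennreal_powr J ((1 / p - 1 / q) * q) * ennreal_powr (N x) (p / q * q))"
          using C1(1) by (simp add: ennreal_powr_mult ennreal_powr_powr)
        also have "(1 / p - 1 / q) * q = q / p - 1" using pq by (simp add: field_simps)
        also have "p / q * q = p" using pq by simp
        finally show ?thesis by (simp add: mult.assoc)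
      qed
      then have "(\<integral>\<^sup>+x. ennreal_powr (I x) q \<partial>wm u)
        \<le> (\<integral>\<^sup>+x. ennreal ((2 * C1) powr q) * ennreal_powr J (q / p - 1) * ennreal_powr (N x) p \<partial>wm u)"
        by (intro nn_integral_mono) auto
      also have "\<dots> = ennreal ((2 * C1) powr q) * ennreal_powr J (q / p - 1) * (\<integral>\<^sup>+x. ennreal_powr (N x) p \<partial>wm u)"
        by (intro nn_integral_cmult) measurable
      also have "\<dots> \<le> ennreal ((2 * C1) powr q) * ennreal_powr J (q / p - 1) * (ennreal C2 * J)"
        by (intro mult_left_mono N2) auto
      also have "\<dots> = ennreal C * (ennreal_powr J (q / p - 1) * ennreal_powr J 1)"
        using C2(1) by (simp add: C_def ennreal_mult mult_ac)
      also have "\<dots> = ennreal C * ennreal_powr J (q / p)"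
        by (simp only: ennreal_powr_add[symmetric]) simp
      finally show ?thesis .
    qed
    then show "(\<integral>\<^sup>+x. ennreal_powr (\<integral>\<^sup>+y. ennreal (norm (x - y) powr - (real CARD('n) * (1 / q + 1 - 1 / p))) * f y \<partial>wm s) q \<partial>wm u)
      \<le> ennreal C * ennreal_powr (\<integral>\<^sup>+y. ennreal_powr (f y) p \<partial>wm s) (q / p)"
      unfolding I_def J_def .
  qed
qed

end

section \<open>Dyadic stopping cubes\<close>

\<comment> \<open>rewrites every \<open>emeasure lebesgue A\<close> to the main part of \<open>A\<close>\<close>
declare emeasure_completion [simp del]

text \<open>Half-open, so that the dyadic cubes of one generation are exactly disjoint and no
  boundary null sets have to be discussed for the weighted measures.\<close>

definition hcube :: "real^'n \<Rightarrow> real \<Rightarrow> (real^'n) set" where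
  "hcube a l = {x. \<forall>i. a $ i \<le> x $ i \<and> x $ i < a $ i + l}"

text \<open>The cube of generation \<open>k\<close> through \<open>x\<close>, in the grid of all
  space of which \<open>hcube a l\<close> is a cell of generation 0. Indexing by a point turns
  membership into equality of floors.\<close>

definition dcube :: "real^'n \<Rightarrow> real \<Rightarrow> nat \<Rightarrow> real^'n \<Rightarrow> (real^'n) set" where
  "dcube a l k x = hcube (\<chi> i. a $ i + l / 2 ^ k * \<lfloor>2 ^ k * (x $ i - a $ i) / l\<rfloor>) (l / 2 ^ k)"

lemma hcube_borel: "hcube a l \<in> sets borel"
  unfolding hcube_def by measurable

lemma hcube_sets [measurable, simp]: "hcube a l \<in> sets lebesgue"
  using hcube_borel[of a l] by (simp add: sets_completionI_sets)

lemma emeasure_completion_eq: "A \<in> sets M \<Longrightarrow> emeasure (completion M) A = emeasure M A"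
  by (simp add: emeasure_completion)

lemma emeasure_hcube:
  fixes a :: "real^'n"
  assumes "0 < l" shows "emeasure lebesgue (hcube a l) = ennreal (l ^ CARD('n))"
proof -
  have box: "box a (a + (\<chi> i. l)) \<subseteq> hcube a l" "hcube a l \<subseteq> cbox a (a + (\<chi> i. l))"
    by (auto simp: hcube_def mem_box_cart less_imp_le)
  have "a \<in> cbox a (a + (\<chi> i. l))" using assms by (simp add: mem_box_cart)
  then have "cbox a (a + (\<chi> i. l)) \<noteq> {}" by blast
  from content_cbox_cart[OF this] have "measure lborel (cbox a (a + (\<chi> i. l))) = l ^ CARD('n)" by simp
  then have "emeasure lborel (cbox a (a + (\<chi> i. l))) = ennreal (l ^ CARD('n))"
    using emeasure_lborel_cbox_finite[of a "a + (\<chi> i. l)"] by (subst emeasure_eq_ennreal_measure) auto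
  moreover have "emeasure lborel (box a (a + (\<chi> i. l))) = emeasure lborel (cbox a (a + (\<chi> i. l)))"
    by (simp add: emeasure_lborel_box_eq emeasure_lborel_cbox_eq)
  moreover have "emeasure lborel (box a (a + (\<chi> i. l))) \<le> emeasure lborel (hcube a l)"
     "emeasure lborel (hcube a l) \<le> emeasure lborel (cbox a (a + (\<chi> i. l)))"
    using box hcube_borel[of a l] by (auto intro!: emeasure_mono)
  ultimately have "emeasure lborel (hcube a l) = ennreal (l ^ CARD('n))" by simp
  moreover have "hcube a l \<in> sets lborel" using hcube_borel[of a l] by simp
  ultimately show ?thesis by (simp only: emeasure_completion_eq)
qed

lemma measure_hcube: "0 < l \<Longrightarrow> measure lebesgue (hcube a l) = l ^ CARD('n)" for a :: "real^'n"
  unfolding measure_def by (subst emeasure_hcube) auto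

lemma hcube_subset_ball:
  fixes a :: "real^'n"
  assumes "0 < l"
  shows "hcube a l \<subseteq> ball a (2 * real CARD('n) * l)"
proof
  fix x assume x: "x \<in> hcube a l"
  have "norm (x - a) \<le> (\<Sum>i\<in>UNIV. \<bar>(x - a) $ i\<bar>)" by (rule norm_le_l1_cart)
  also have "\<dots> \<le> (\<Sum>i\<in>(UNIV::'n set). l)"
    using x by (intro sum_mono) (auto simp: hcube_def abs_le_iff intro: less_imp_le, smt (verit))
  also have "\<dots> < 2 * real CARD('n) * l" using assms by simp
  finally show "x \<in> ball a (2 * real CARD('n) * l)" by (simp add: dist_norm norm_minus_commute)
qed

lemma ball_subset_hcube: "ball x r \<subseteq> hcube (x - (\<chi> i. r)) (2 * r)" for x :: "real^'n"
proof
  fix y assume "y \<in> ball x r"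
  then have "\<bar>(x - y) $ i\<bar> < r" for i
    using component_le_norm_cart[of "x - y" i] by (simp add: dist_norm)
  then have "\<bar>x $ i - y $ i\<bar> < r" for i by simp
  then show "y \<in> hcube (x - (\<chi> i. r)) (2 * r)"
    by (auto simp: hcube_def abs_less_iff) (smt (verit))+
qed

lemma mem_dcube_iff:
  assumes "0 < l"
  shows "y \<in> dcube a l k x \<longleftrightarrow> (\<forall>i. \<lfloor>2 ^ k * (y $ i - a $ i) / l\<rfloor> = \<lfloor>2 ^ k * (x $ i - a $ i) / l\<rfloor>)"
proof -
  have "(a $ i + l / 2 ^ k * z \<le> y $ i \<and> y $ i < a $ i + l / 2 ^ k * z + l / 2 ^ k) \<longleftrightarrow> \<lfloor>2 ^ k * (y $ i - a $ i) / l\<rfloor> = z" for i and z :: int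
    unfolding floor_eq_iff using assms by (simp add: field_simps)
  then show ?thesis unfolding dcube_def hcube_def by simp
qed

lemma dcube_self: "0 < l \<Longrightarrow> x \<in> dcube a l k x"
  by (simp add: mem_dcube_iff)

lemma dcube_eq: "0 < l \<Longrightarrow> y \<in> dcube a l k x \<Longrightarrow> dcube a l k y = dcube a l k x"
  unfolding mem_dcube_iff by (simp add: dcube_def)

lemma dcube_Suc_subset:
  assumes "0 < l" shows "dcube a l (Suc k) x \<subseteq> dcube a l k x"
proof
  fix y assume y: "y \<in> dcube a l (Suc k) x"
  \<comment> \<open>The floors of generation \<open>k\<close> are determined by those of generation
    \<open>Suc k\<close>, which is the nesting of the grid.\<close>
  have *: "\<lfloor>2 ^ k * t / l\<rfloor> = \<lfloor>2 ^ Suc k * t / l\<rfloor> div 2" for t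
  proof -
    have "\<lfloor>2 ^ Suc k * t / l\<rfloor> div 2 = \<lfloor>2 ^ Suc k * t / l / real_of_int 2\<rfloor>"
      by (subst floor_divide_real_eq_div) auto
    then show ?thesis by simp
  qed
  show "y \<in> dcube a l k x" using y unfolding mem_dcube_iff[OF assms] * by simp
qed

lemma dcube_mono:
  assumes "0 < l" "j \<le> k" shows "dcube a l k x \<subseteq> dcube a l j x"
  using assms(2)
proof (induction k rule: dec_induct)
  case (step k)
  then show ?case using dcube_Suc_subset[OF assms(1), of a k x] by blast
qed simp

lemma dcube_0: "0 < l \<Longrightarrow> x \<in> hcube a l \<Longrightarrow> dcube a l 0 x = hcube a l"
proof -
  assume l: "0 < l" and "x \<in> hcube a l"
  then have "\<lfloor>(x $ i - a $ i) / l\<rfloor> = 0" for i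
    by (auto simp: floor_eq_iff hcube_def) (smt (verit))
  then show ?thesis by (simp add: dcube_def vec_lambda_unique)
qed

lemma countable_dcubes: "countable (range (dcube (a :: real^'n) l k))"
proof -
  have "countable (range (\<lambda>z :: 'n \<Rightarrow> int. hcube (\<chi> i. a $ i + l / 2 ^ k * real_of_int (z i)) (l / 2 ^ k)))"
    by simp
  moreover have "range (dcube a l k) \<subseteq> range (\<lambda>z :: 'n \<Rightarrow> int. hcube (\<chi> i. a $ i + l / 2 ^ k * real_of_int (z i)) (l / 2 ^ k))"
    unfolding dcube_def by (intro image_subsetI range_eqI[where x = "\<lambda>i. \<lfloor>2 ^ k * (_ $ i - a $ i) / l\<rfloor>"]) (rule refl)
  ultimately show ?thesis by (rule countable_subset[rotated])
qed

text \<open>The maximal cubes with property \<open>P\<close> among the dyadic cubes of generation at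
  least 0 that meet \<open>X\<close>.\<close>

definition stopping_cubes :: "real^'n \<Rightarrow> real \<Rightarrow> (real^'n) set \<Rightarrow> ((real^'n) set \<Rightarrow> bool) \<Rightarrow> (real^'n) set set" where
  "stopping_cubes a l X P = {dcube a l k x | x k. x \<in> X \<and> P (dcube a l k x) \<and> (\<forall>j<k. \<not> P (dcube a l j x))}"

lemma countable_stopping_cubes: "countable (stopping_cubes a l X P)"
proof -
  have "stopping_cubes a l X P \<subseteq> (\<Union>k. range (dcube a l k))" by (auto simp: stopping_cubes_def)
  then show ?thesis by (rule countable_subset) (simp add: countable_dcubes)
qed

text \<open>Two dyadic cubes that meet are nested, and a strictly larger cube with property
  \<open>P\<close> would have stopped the descent to the smaller one.\<close>

lemma disjoint_stopping_cubes:
  assumes "0 < l" shows "disjoint (stopping_cubes a l X P)"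
proof (rule disjointI)
  have *: "dcube a l k x = dcube a l j y"
    if xy: "P (dcube a l k x)" "\<forall>i<j. \<not> P (dcube a l i y)" and z: "z \<in> dcube a l k x" "z \<in> dcube a l j y" 
      and "k \<le> j" for x y z k j
  proof -
    have "z \<in> dcube a l k y" using z(2) dcube_mono[OF assms \<open>k \<le> j\<close>] by blast
    then have eq: "dcube a l k y = dcube a l k x" using z(1) dcube_eq[OF assms] by metis
    then have "\<not> k < j" using xy by metis
    then show ?thesis using \<open>k \<le> j\<close> eq by simp
  qed
  fix Q R assume QR: "Q \<in> stopping_cubes a l X P" "R \<in> stopping_cubes a l X P" "Q \<noteq> R"
  obtain x k where x: "Q = dcube a l k x" "P Q" "\<forall>j<k. \<not> P (dcube a l j x)"
    using QR(1) by (auto simp: stopping_cubes_def)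
  obtain y j where y: "R = dcube a l j y" "P R" "\<forall>i<j. \<not> P (dcube a l i y)"
    using QR(2) by (auto simp: stopping_cubes_def)
  show "Q \<inter> R = {}"
  proof (rule ccontr)
    assume "Q \<inter> R \<noteq> {}"
    then obtain z where "z \<in> Q" "z \<in> R" by blast
    then have "Q = R"
      using *[of k x j y z] *[of j y k x z] x y by (cases "k \<le> j") auto
    then show False using QR(3) by simp
  qed
qed

lemma mem_Union_stopping_cubes:
  assumes "0 < l" "x \<in> X" "P (dcube a l k x)"
  shows "x \<in> \<Union>(stopping_cubes a l X P)"
proof -
  define m where "m = (LEAST k. P (dcube a l k x))"
  have "P (dcube a l m x)" unfolding m_def by (rule LeastI[of _ k]) (rule assms)
  moreover have "\<forall>j<m. \<not> P (dcube a l j x)" using not_less_Least by (auto simp: m_def)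
  ultimately have "dcube a l m x \<in> stopping_cubes a l X P" using assms(2) by (auto simp: stopping_cubes_def)
  then show ?thesis using dcube_self[OF assms(1), of x a m] by blast
qed

lemma stopping_cubes_sets: "Q \<in> stopping_cubes a l X P \<Longrightarrow> Q \<in> sets lebesgue"
  by (auto simp: stopping_cubes_def dcube_def)

lemma dcube_small:
  fixes x :: "real^'n"
  assumes "0 < l" "0 < e" obtains k where "dcube a l k x \<subseteq> ball x e"
proof -
  obtain k where "4 * real CARD('n) * l / e < 2 ^ k" using real_arch_pow[of 2] by auto
  then have "2 * (2 * real CARD('n) * (l / 2 ^ k)) < e" using assms by (simp add: field_simps)
  moreover define h where "h = 2 * real CARD('n) * (l / 2 ^ k)"
  ultimately have k: "2 * h < e" by simp
  obtain c where c: "dcube a l k x = hcube c (l / 2 ^ k)" by (auto simp: dcube_def)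
  have sub: "dcube a l k x \<subseteq> ball c h"
    unfolding c h_def using assms by (intro hcube_subset_ball) auto
  show ?thesis
  proof (rule that[of k], rule subsetI)
    fix y assume "y \<in> dcube a l k x"
    then have "dist c y < h" "dist c x < h"
      using sub dcube_self[OF assms(1), of x a k] by auto
    then show "y \<in> ball x e" using k dist_triangle3[of x y c] by simp
  qed
qed

text \<open>Sums an estimate over a disjoint family. It serves with \<open>A Q = Q\<close> to
  compare densities, and with \<open>A Q\<close> an exceptional subset to iterate the decay in the
  John--Nirenberg argument.\<close>

lemma emeasure_Union_le:
  fixes M N :: "(real^'n) measure"
  assumes sets: "sets M = sets lebesgue" "sets N = sets lebesgue" and S: "countable S" "disjoint S" "S \<subseteq> sets lebesgue"
    and A: "\<And>Q. Q \<in> S \<Longrightarrow> A Q \<in> sets lebesgue" "\<And>Q. Q \<in> S \<Longrightarrow> A Q \<subseteq> Q"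
    and le: "\<And>Q. Q \<in> S \<Longrightarrow> emeasure M (A Q) \<le> c * emeasure N Q"
  shows "emeasure M (\<Union>Q\<in>S. A Q) \<le> c * emeasure N (\<Union>S)"
proof -
  have dj: "disjoint_family_on A S" "disjoint_family_on (\<lambda>Q. Q) S"
    using S(2) A(2) unfolding disjoint_family_on_def disjoint_def by (metis Int_mono subset_empty, blast)
  have "emeasure M (\<Union>Q\<in>S. A Q) = (\<integral>\<^sup>+Q. emeasure M (A Q) \<partial>count_space S)"
    using S(1) A(1) dj(1) sets by (intro emeasure_UN_countable) auto
  also have "\<dots> \<le> (\<integral>\<^sup>+Q. c * emeasure N Q \<partial>count_space S)"
    using le by (intro nn_integral_mono) auto
  also have "\<dots> = c * (\<integral>\<^sup>+Q. emeasure N Q \<partial>count_space S)" by (simp add: nn_integral_cmult)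
  also have "(\<integral>\<^sup>+Q. emeasure N Q \<partial>count_space S) = emeasure N (\<Union>Q\<in>S. Q)"
    using S dj(2) sets by (intro emeasure_UN_countable[symmetric]) auto
  finally show ?thesis by simp
qed

lemma emeasure_density_Union_le:
  fixes g :: "real^'n \<Rightarrow> ennreal"
  assumes [measurable]: "g \<in> borel_measurable lebesgue" and S: "countable S" "disjoint S" "S \<subseteq> sets lebesgue"
    and le: "\<And>Q. Q \<in> S \<Longrightarrow> (\<integral>\<^sup>+x\<in>Q. g x \<partial>lebesgue) \<le> c * emeasure lebesgue Q"
  shows "(\<integral>\<^sup>+x\<in>\<Union>S. g x \<partial>lebesgue) \<le> c * emeasure lebesgue (\<Union>S)"
proof -
  have "\<Union>S \<in> sets lebesgue" using S by (intro sets.countable_Union) auto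
  then have "(\<integral>\<^sup>+x\<in>\<Union>S. g x \<partial>lebesgue) = emeasure (density lebesgue g) (\<Union>Q\<in>S. Q)"
    by (simp add: emeasure_density)
  also have "\<dots> \<le> c * emeasure lebesgue (\<Union>S)"
  proof (rule emeasure_Union_le[OF _ _ S])
    fix Q assume "Q \<in> S"
    then show "emeasure (density lebesgue g) Q \<le> c * emeasure lebesgue Q"
      using le[of Q] S(3) by (subst emeasure_density) auto
  qed (use S in auto)
  finally show ?thesis .
qed

text \<open>A differentiation theorem in disguise: covering by maximal dyadic cubes inside an open
  neighbourhood avoids the Lebesgue differentiation theorem.\<close>

lemma AE_le_of_dyadic_averages_le:
  fixes a :: "real^'n" and g :: "real^'n \<Rightarrow> ennreal"
  assumes [measurable]: "g \<in> borel_measurable lebesgue" and l: "0 < l" and X: "X \<in> sets lebesgue" "X \<subseteq> hcube a l"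
    and avg: "\<And>x k. x \<in> X \<Longrightarrow> (\<integral>\<^sup>+y\<in>dcube a l k x. g y \<partial>lebesgue) \<le> ennreal \<mu> * emeasure lebesgue (dcube a l k x)"
  shows "AE x in lebesgue. x \<in> X \<longrightarrow> g x \<le> ennreal \<mu>"
proof -
  define F where "F = {x \<in> X. ennreal \<mu> < g x}"
  have [measurable]: "X \<in> sets lebesgue" by fact
  have "F = X \<inter> {x \<in> space lebesgue. ennreal \<mu> < g x}" by (auto simp: F_def)
  also have "\<dots> \<in> sets lebesgue" by measurable
  finally have F [measurable]: "F \<in> sets lebesgue" .
  have "emeasure lebesgue F \<le> emeasure lebesgue (hcube a l)"
    using X by (intro emeasure_mono) (auto simp: F_def)
  then have Ffin: "emeasure lebesgue F < \<infinity>" using l by (simp add: emeasure_hcube le_less_trans)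
  have le: "(\<integral>\<^sup>+x\<in>F. g x \<partial>lebesgue) \<le> ennreal \<mu> * emeasure lebesgue F"
  proof (rule ennreal_le_epsilon)
    fix e :: real assume e: "0 < e"
    \<comment> \<open>The excess of the open set over \<open>F\<close> is multiplied by \<mu> in the
      end; this choice keeps that product below \<open>e\<close>, whatever \<mu> is.\<close>
    define d where "d = e / (\<bar>\<mu>\<bar> + 1)"
    have d: "0 < d" using e by (simp add: d_def add_nonneg_pos)
    obtain V where V: "open V" "F \<subseteq> V" "V - F \<in> lmeasurable" "emeasure lebesgue (V - F) < ennreal d"
      using sets_lebesgue_outer_open[OF F d] by auto
    have [measurable]: "V \<in> sets lebesgue" using V(1) by simp
    \<comment> \<open>The largest dyadic cubes through points of \<open>F\<close> that fit into
      \<open>V\<close>. They cover \<open>F\<close> because small cubes do fit, they stay in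
      \<open>V\<close>, and each carries the assumed bound on its average.\<close>
    define S where "S = stopping_cubes a l F (\<lambda>Q. Q \<subseteq> V)"
    have S: "countable S" "disjoint S" "S \<subseteq> sets lebesgue"
      using l by (auto simp: S_def countable_stopping_cubes disjoint_stopping_cubes dest: stopping_cubes_sets)
    have FS: "F \<subseteq> \<Union>S"
    proof
      fix x assume x: "x \<in> F"
      then obtain e where e: "0 < e" "ball x e \<subseteq> V" using V(1,2) open_contains_ball by blast
      obtain k where "dcube a l k x \<subseteq> ball x e" by (rule dcube_small[OF l e(1)])
      then show "x \<in> \<Union>S" unfolding S_def using e x by (intro mem_Union_stopping_cubes[OF l, of _ _ _ _ k]) auto
    qed
    have "\<Union>S \<subseteq> V" by (auto simp: S_def stopping_cubes_def)
    have [measurable]: "\<Union>S \<in> sets lebesgue" using S by (intro sets.countable_Union) auto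
    have "(\<integral>\<^sup>+x\<in>F. g x \<partial>lebesgue) \<le> (\<integral>\<^sup>+x\<in>\<Union>S. g x \<partial>lebesgue)"
    proof (intro nn_integral_mono mult_left_mono)
      fix x show "indicator F x \<le> (indicator (\<Union>S) x :: ennreal)" 
        by (intro indicator_leI subsetD[OF FS])
    qed auto
    also have "\<dots> \<le> ennreal \<mu> * emeasure lebesgue (\<Union>S)"
    proof (rule emeasure_density_Union_le[OF _ S])
      fix Q assume "Q \<in> S"
      then obtain x k where "x \<in> X" "Q = dcube a l k x" by (auto simp: S_def stopping_cubes_def F_def)
      then show "(\<integral>\<^sup>+x\<in>Q. g x \<partial>lebesgue) \<le> ennreal \<mu> * emeasure lebesgue Q" using avg by simp
    qed simp
    also have "\<dots> \<le> ennreal \<mu> * emeasure lebesgue V"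
      using \<open>\<Union>S \<subseteq> V\<close> by (intro mult_left_mono emeasure_mono) auto
    also have "emeasure lebesgue V = emeasure lebesgue (V - F) + emeasure lebesgue F"
      using V(2) by (subst plus_emeasure) (auto simp: Un_absorb2)
    also have "ennreal \<mu> * \<dots> \<le> ennreal \<mu> * emeasure lebesgue F + ennreal e"
    proof -
      have "ennreal \<mu> * emeasure lebesgue (V - F) \<le> ennreal (\<bar>\<mu>\<bar>) * ennreal d"
        using V(4) by (intro mult_mono ennreal_leI) auto
      also have "\<dots> = ennreal (\<bar>\<mu>\<bar> * d)" using d by (simp add: ennreal_mult)
      also have "\<dots> \<le> ennreal e" using e by (intro ennreal_leI) (simp add: d_def field_simps)
      finally show ?thesis by (simp add: distrib_left add.commute add_left_mono)
    qed
    finally show "(\<integral>\<^sup>+x\<in>F. g x \<partial>lebesgue) \<le> ennreal \<mu> * emeasure lebesgue F + ennreal e" .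
  qed
  \<comment> \<open>On \<open>F\<close> the function exceeds \<mu>, while its integral is at most
    \<mu> times the measure. As that measure is finite it can be cancelled, so the excess has
    integral 0.\<close>
  have "(\<integral>\<^sup>+x\<in>F. g x \<partial>lebesgue) = (\<integral>\<^sup>+x. (g x - ennreal \<mu>) * indicator F x + ennreal \<mu> * indicator F x \<partial>lebesgue)"
    by (intro nn_integral_cong) (auto simp: F_def indicator_def diff_add_cancel_ennreal less_imp_le)
  also have "\<dots> = (\<integral>\<^sup>+x\<in>F. (g x - ennreal \<mu>) \<partial>lebesgue) + ennreal \<mu> * emeasure lebesgue F"
    by (subst nn_integral_add) (auto simp: nn_integral_cmult_indicator)
  finally have "(\<integral>\<^sup>+x\<in>F. (g x - ennreal \<mu>) \<partial>lebesgue) + ennreal \<mu> * emeasure lebesgue F \<le> 0 + ennreal \<mu> * emeasure lebesgue F"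
    using le by simp
  moreover have "ennreal \<mu> * emeasure lebesgue F \<noteq> \<infinity>" using Ffin by (auto simp: ennreal_mult_eq_top_iff)
  ultimately have "(\<integral>\<^sup>+x\<in>F. (g x - ennreal \<mu>) \<partial>lebesgue) = 0" 
    using ennreal_add_left_cancel_le[of "ennreal \<mu> * emeasure lebesgue F" "\<integral>\<^sup>+x\<in>F. (g x - ennreal \<mu>) \<partial>lebesgue" 0]
    by (simp only: add.commute[of _ "ennreal \<mu> * emeasure lebesgue F"]) simp
  then have "AE x in lebesgue. (g x - ennreal \<mu>) * indicator F x = 0"
    by (subst (asm) nn_integral_0_iff_AE) auto
  then show ?thesis
  proof eventually_elim
    case (elim x)
    show ?case
    proof (intro impI leI notI)
      assume "x \<in> X" "ennreal \<mu> < g x"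
      then have "x \<in> F" by (simp add: F_def)
      then have "g x - ennreal \<mu> = 0" using elim by simp
      then show False using \<open>ennreal \<mu> < g x\<close> by (metis diff_gr0_ennreal less_irrefl)
    qed
  qed
qed

text \<open>A cube stops when its average exceeds \<mu>. The initial cube does not stop, so every
  stopping cube has a parent with average at most \<mu>, which costs the volume ratio 2^n. A point
  outside the stopping cubes has only dyadic averages at most \<mu>.\<close>

proposition Calderon_Zygmund_cubes:
  fixes a :: "real^'n" and g :: "real^'n \<Rightarrow> ennreal"
  assumes [measurable]: "g \<in> borel_measurable lebesgue" and l: "0 < l" and "0 < \<mu>"
    and Q0: "(\<integral>\<^sup>+y\<in>hcube a l. g y \<partial>lebesgue) \<le> ennreal \<mu> * emeasure lebesgue (hcube a l)"
  obtains S where "countable S" "disjoint S"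
    "\<And>Q. Q \<in> S \<Longrightarrow> Q \<subseteq> hcube a l"
    "\<And>Q. Q \<in> S \<Longrightarrow> \<exists>c h. 0 < h \<and> Q = hcube c h"
    "\<And>Q. Q \<in> S \<Longrightarrow> ennreal \<mu> * emeasure lebesgue Q \<le> (\<integral>\<^sup>+y\<in>Q. g y \<partial>lebesgue)"
    "\<And>Q. Q \<in> S \<Longrightarrow> (\<integral>\<^sup>+y\<in>Q. g y \<partial>lebesgue) \<le> ennreal (2 ^ CARD('n) * \<mu>) * emeasure lebesgue Q"
    "AE x in lebesgue. x \<in> hcube a l - \<Union>S \<longrightarrow> g x \<le> ennreal \<mu>"
proof -
  define P where "P Q \<longleftrightarrow> ennreal \<mu> * emeasure lebesgue Q < (\<integral>\<^sup>+y\<in>Q. g y \<partial>lebesgue)" for Q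
  define S where "S = stopping_cubes a l (hcube a l) P"
  have S: "countable S" "disjoint S" "S \<subseteq> sets lebesgue"
    using l by (auto simp: S_def countable_stopping_cubes disjoint_stopping_cubes dest: stopping_cubes_sets)
  have [measurable]: "\<Union>S \<in> sets lebesgue" using S by (intro sets.countable_Union) auto
  show ?thesis
  proof (rule that[OF S(1,2)])
    fix Q assume "Q \<in> S"
    then obtain x k where xk: "x \<in> hcube a l" "Q = dcube a l k x" "P Q" "\<And>j. j < k \<Longrightarrow> \<not> P (dcube a l j x)"
      by (auto simp: S_def stopping_cubes_def)
    show "Q \<subseteq> hcube a l" using dcube_mono[OF l, of 0 k a x] dcube_0[OF l xk(1)] xk(2) by simp
    show "\<exists>c h. 0 < h \<and> Q = hcube c h" unfolding xk(2) dcube_def using l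
      by (intro exI[of _ "l / 2 ^ k"] exI conjI refl) auto
    show "ennreal \<mu> * emeasure lebesgue Q \<le> (\<integral>\<^sup>+y\<in>Q. g y \<partial>lebesgue)" using xk(3) by (simp add: P_def)
    have "\<not> P (hcube a l)" using Q0 by (simp add: P_def not_less)
    then have "k \<noteq> 0" using xk(2,3) dcube_0[OF l xk(1)] by (intro notI) simp
    then obtain j where j: "k = Suc j" by (cases k) auto
    have vol: "emeasure lebesgue (dcube a l i x) = ennreal ((l / 2 ^ i) ^ CARD('n))" for i
      unfolding dcube_def using l by (subst emeasure_hcube) auto
    have "(\<integral>\<^sup>+y\<in>Q. g y \<partial>lebesgue) \<le> (\<integral>\<^sup>+y\<in>dcube a l j x. g y \<partial>lebesgue)"
      using dcube_Suc_subset[OF l, of a j x] unfolding xk(2) j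
      by (intro nn_integral_mono mult_left_mono) (auto split: split_indicator)
    also have "\<dots> \<le> ennreal \<mu> * emeasure lebesgue (dcube a l j x)"
      using xk(4)[of j] j by (simp add: P_def)
    also have "\<dots> = ennreal (2 ^ CARD('n) * \<mu>) * emeasure lebesgue Q"
      unfolding xk(2) j vol using l assms(3) by (simp add: ennreal_mult[symmetric] power_divide power_mult_distrib)
    finally show "(\<integral>\<^sup>+y\<in>Q. g y \<partial>lebesgue) \<le> ennreal (2 ^ CARD('n) * \<mu>) * emeasure lebesgue Q" .
  next
    show "AE x in lebesgue. x \<in> hcube a l - \<Union>S \<longrightarrow> g x \<le> ennreal \<mu>"
    proof (rule AE_le_of_dyadic_averages_le[OF _ l])
      fix x k assume x: "x \<in> hcube a l - \<Union>S"
      then have "\<not> P (dcube a l k x)" using mem_Union_stopping_cubes[OF l, of x "hcube a l" P a k] by (auto simp: S_def)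
      then show "(\<integral>\<^sup>+y\<in>dcube a l k x. g y \<partial>lebesgue) \<le> ennreal \<mu> * emeasure lebesgue (dcube a l k x)"
        by (simp add: P_def not_less)
    qed auto
  qed
qed

section \<open>The weighted John--Nirenberg inequality\<close>

text \<open>The triangle inequality |c - c'| \<le> |b - c| + |b - c'|, averaged over
  \<open>A\<close>.\<close>

lemma oscillation_centre_diff:
  fixes b :: "real^'n \<Rightarrow> complex"
  assumes [measurable]: "b \<in> borel_measurable lebesgue" "A \<in> sets lebesgue" and m: "emeasure lebesgue A = ennreal m" "0 < m"
    and c: "(\<integral>\<^sup>+y\<in>A. ennreal (norm (b y - c)) \<partial>lebesgue) \<le> ennreal (\<alpha> * m)"
    and c': "(\<integral>\<^sup>+y\<in>A. ennreal (norm (b y - c')) \<partial>lebesgue) \<le> ennreal (\<beta> * m)" and "0 \<le> \<alpha>" "0 \<le> \<beta>"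
  shows "norm (c - c') \<le> \<alpha> + \<beta>"
proof -
  have "ennreal (norm (c - c') * m) = (\<integral>\<^sup>+y\<in>A. ennreal (norm (c - c')) \<partial>lebesgue)"
    using m by (subst nn_integral_cmult_indicator) (auto simp: ennreal_mult)
  also have "\<dots> \<le> (\<integral>\<^sup>+y. ennreal (norm (b y - c)) * indicator A y + ennreal (norm (b y - c')) * indicator A y \<partial>lebesgue)"
  proof (rule nn_integral_mono)
    fix y
    have "norm (c - c') \<le> norm (b y - c) + norm (b y - c')" 
      using norm_triangle_ineq4[of "b y - c'" "b y - c"] by simp
    then have "ennreal (norm (c - c')) \<le> ennreal (norm (b y - c)) + ennreal (norm (b y - c'))"
      by (simp add: ennreal_plus[symmetric] ennreal_leI del: ennreal_plus)
    then show "ennreal (norm (c - c')) * indicator A y \<le> ennreal (norm (b y - c)) * indicator A y + ennreal (norm (b y - c')) * indicator A y"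
      by (simp split: split_indicator)
  qed
  also have "\<dots> = (\<integral>\<^sup>+y\<in>A. ennreal (norm (b y - c)) \<partial>lebesgue) + (\<integral>\<^sup>+y\<in>A. ennreal (norm (b y - c')) \<partial>lebesgue)"
    by (intro nn_integral_add) measurable
  also have "\<dots> \<le> ennreal (\<alpha> * m) + ennreal (\<beta> * m)" by (intro add_mono c c')
  also have "\<dots> = ennreal ((\<alpha> + \<beta>) * m)"
    using assms by (simp add: ennreal_plus[symmetric] distrib_right del: ennreal_plus)
  finally have "norm (c - c') * m \<le> (\<alpha> + \<beta>) * m" using assms m(2) by simp
  then show ?thesis using m(2) by simp
qed

lemma nn_integral_mono_set: "A \<subseteq> B \<Longrightarrow> (\<integral>\<^sup>+x\<in>A. g x \<partial>M) \<le> (\<integral>\<^sup>+x\<in>B. g x \<partial>M)"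
  by (intro nn_integral_mono mult_left_mono indicator_leI) auto

text \<open>\<open>c x r\<close> plays the role of the average of \<open>b\<close> over the ball.\<close>

definition bounded_oscillation :: "(real^'n \<Rightarrow> complex) \<Rightarrow> (real^'n \<Rightarrow> real \<Rightarrow> complex) \<Rightarrow> real \<Rightarrow> bool" where
  "bounded_oscillation b c M \<longleftrightarrow> b \<in> borel_measurable lebesgue \<and> 0 < M \<and>
     (\<forall>x r. 0 < r \<longrightarrow> (\<integral>\<^sup>+y\<in>ball x r. ennreal (norm (b y - c x r)) \<partial>lebesgue) \<le> ennreal (M * r ^ CARD('n)))"

context muckenhoupt_pair
begin

text \<open>The stopping cubes cover at most half of the cube, hence at most a fixed fraction \<open>\<eta> < 1\<close> of its
  \<open>u\<close>-measure; as they are exactly disjoint, the decay can be iterated directly for \<open>u\<close>.\<close>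

lemma John_Nirenberg_cubes:
  assumes "bounded_oscillation b c M"
  defines "cQ \<equiv> \<lambda>a l. c a (2 * real CARD('n) * l)"
  obtains \<eta> T where "0 < \<eta>" "\<eta> < 1" "0 < T"
    "\<And>a l m. 0 < l \<Longrightarrow> emeasure (wm u) {x \<in> hcube a l. real m * T < norm (b x - cQ a l)} \<le> ennreal (\<eta> ^ m) * emeasure (wm u) (hcube a l)"
proof -
  have [measurable]: "b \<in> borel_measurable lebesgue" and M: "0 < M"
    and osc: "\<And>x r. 0 < r \<Longrightarrow> (\<integral>\<^sup>+y\<in>ball x r. ennreal (norm (b y - c x r)) \<partial>lebesgue) \<le> ennreal (M * r ^ CARD('n))"
    using assms(1) by (auto simp: bounded_oscillation_def)
  \<comment> \<open>A cube of side \<open>l\<close> lies in the ball of radius \<open>N * l\<close>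
    about its corner, so \<open>M'\<close> bounds the mean oscillation over cubes.\<close>
  define N where "N = 2 * real CARD('n)"
  have N: "0 < N" by (simp add: N_def)
  define M' where "M' = M * N ^ CARD('n)"
  have M': "0 < M'" using M N by (simp add: M'_def)
  \<comment> \<open>Twice the mean oscillation, so that by Chebyshev the stopping cubes cover at
    most half of the cube. \<open>T\<close> then bounds the shift of centre from a cube to a
    stopping cube: \<open>M'\<close> from the stopping cube itself, 2^n \<mu> from the bound on its
    average.\<close>
  define \<mu> where "\<mu> = 2 * M'"
  define T where "T = M' + 2 ^ CARD('n) * \<mu>"
  have \<mu>: "0 < \<mu>" using M' by (simp add: \<mu>_def)
  have T: "0 < T" using M' \<mu> by (simp add: T_def add_pos_pos)
  have \<mu>T: "\<mu> \<le> T"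
  proof -
    have "1 * \<mu> \<le> 2 ^ CARD('n) * \<mu>" using \<mu> by (intro mult_right_mono) auto
    then show ?thesis using M' by (simp add: T_def)
  qed
  have oscQ: "(\<integral>\<^sup>+y\<in>hcube a l. ennreal (norm (b y - cQ a l)) \<partial>lebesgue) \<le> ennreal (M' * l ^ CARD('n))" if "0 < l" for a l
  proof -
    have "(\<integral>\<^sup>+y\<in>hcube a l. ennreal (norm (b y - cQ a l)) \<partial>lebesgue) \<le> (\<integral>\<^sup>+y\<in>ball a (N * l). ennreal (norm (b y - cQ a l)) \<partial>lebesgue)"
      using hcube_subset_ball[OF that, of a] by (intro nn_integral_mono_set) (simp add: N_def)
    also have "\<dots> \<le> ennreal (M * (N * l) ^ CARD('n))"
      using osc[of "N * l" a] N that by (simp add: cQ_def N_def)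
    finally show ?thesis by (simp add: M'_def power_mult_distrib mult_ac)
  qed
  \<comment> \<open>Half the volume of a cube of side \<open>l\<close>, expressed through the radius
    \<open>N * l\<close> of the ball containing it.\<close>
  have "0 < 1 / (2 * N ^ CARD('n))" using N by simp
  from wm_compl_le[OF this] obtain \<eta> where \<eta>: "0 < \<eta>" "\<eta> < 1" "\<And>E F x r. 0 < r \<Longrightarrow> E \<in> sets lebesgue \<Longrightarrow> F \<in> sets lebesgue \<Longrightarrow> E \<subseteq> F \<Longrightarrow> F \<subseteq> ball x r 
    \<Longrightarrow> 1 / (2 * N ^ CARD('n)) * r ^ CARD('n) \<le> measure lebesgue (F - E) \<Longrightarrow> measure (wm u) E \<le> \<eta> * measure (wm u) F" by blast
  show ?thesis
  proof (rule that[OF \<eta>(1,2) T])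
    fix a :: "real^'n" and l :: real and m :: nat assume "0 < l"
    then show "emeasure (wm u) {x \<in> hcube a l. real m * T < norm (b x - cQ a l)} \<le> ennreal (\<eta> ^ m) * emeasure (wm u) (hcube a l)"
    proof (induction m arbitrary: a l)
      case 0
      then show ?case by (auto intro!: emeasure_mono)
    next
      case (Suc m)
      note l = \<open>0 < l\<close>
      define g where "g x = ennreal (norm (b x - cQ a l))" for x
      have [measurable]: "g \<in> borel_measurable lebesgue" unfolding g_def by measurable
      have "(\<integral>\<^sup>+y\<in>hcube a l. g y \<partial>lebesgue) \<le> ennreal \<mu> * emeasure lebesgue (hcube a l)"
        using oscQ[OF l, of a] M' l unfolding g_def emeasure_hcube[OF l]
        by (elim order_trans) (simp add: ennreal_mult[symmetric] \<mu>_def)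
      from Calderon_Zygmund_cubes[OF _ l \<mu> this] obtain S where S: "countable S" "disjoint S"
        "\<And>Q. Q \<in> S \<Longrightarrow> Q \<subseteq> hcube a l"
        "\<And>Q. Q \<in> S \<Longrightarrow> \<exists>c h. 0 < h \<and> Q = hcube c h"
        "\<And>Q. Q \<in> S \<Longrightarrow> ennreal \<mu> * emeasure lebesgue Q \<le> (\<integral>\<^sup>+y\<in>Q. g y \<partial>lebesgue)"
        "\<And>Q. Q \<in> S \<Longrightarrow> (\<integral>\<^sup>+y\<in>Q. g y \<partial>lebesgue) \<le> ennreal (2 ^ CARD('n) * \<mu>) * emeasure lebesgue Q"
        "AE x in lebesgue. x \<in> hcube a l - \<Union>S \<longrightarrow> g x \<le> ennreal \<mu>"
        by auto
      have Ssets: "S \<subseteq> sets lebesgue" using S(4) by force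
      obtain cf hf where ch: "\<And>Q. Q \<in> S \<Longrightarrow> 0 < hf Q \<and> Q = hcube (cf Q) (hf Q)" using S(4) by metis
      define E where "E = \<Union>S"
      have E [measurable]: "E \<in> sets lebesgue" unfolding E_def using S(1) Ssets by (intro sets.countable_Union) auto
      have EQ: "E \<subseteq> hcube a l" using S(3) by (auto simp: E_def)
      have "ennreal \<mu> * emeasure lebesgue E = emeasure (density lebesgue (\<lambda>_. ennreal \<mu>)) (\<Union>Q\<in>S. Q)"
        using E by (simp add: emeasure_density_const E_def)
      also have "\<dots> \<le> 1 * emeasure (density lebesgue g) (\<Union>S)"
      proof (rule emeasure_Union_le[OF _ _ S(1,2) Ssets])
        fix Q assume "Q \<in> S"
        then show "emeasure (density lebesgue (\<lambda>_. ennreal \<mu>)) Q \<le> 1 * emeasure (density lebesgue g) Q"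
          using S(5) Ssets by (auto simp: emeasure_density_const emeasure_density subset_eq)
      qed (use Ssets in auto)
      also have "\<dots> = (\<integral>\<^sup>+y\<in>E. g y \<partial>lebesgue)"
        using E by (simp add: emeasure_density flip: E_def)
      also have "\<dots> \<le> (\<integral>\<^sup>+y\<in>hcube a l. g y \<partial>lebesgue)" by (intro nn_integral_mono_set EQ)
      also have "\<dots> \<le> ennreal (M' * l ^ CARD('n))" unfolding g_def by (rule oscQ[OF l])
      finally have E1: "ennreal \<mu> * emeasure lebesgue E \<le> ennreal (M' * l ^ CARD('n))" .
      have Efin: "emeasure lebesgue E < \<infinity>"
        using emeasure_mono[OF EQ, of lebesgue] by (simp add: emeasure_hcube[OF l] le_less_trans)
      then have "\<mu> * measure lebesgue E \<le> M' * l ^ CARD('n)"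
        using E1 \<mu> M' l by (simp add: emeasure_eq_ennreal_measure less_top ennreal_mult[symmetric])
      then have "measure lebesgue E \<le> l ^ CARD('n) / 2" using M' by (simp add: \<mu>_def)
      then have "l ^ CARD('n) / 2 \<le> measure lebesgue (hcube a l) - measure lebesgue E"
        by (simp only: measure_hcube[OF l])
      also have "\<dots> = measure lebesgue (hcube a l - E)"
        using EQ E Efin l by (intro measurable_measure_Diff[symmetric]) (auto intro!: fmeasurableI simp: emeasure_hcube)
      finally have "1 / (2 * N ^ CARD('n)) * (N * l) ^ CARD('n) \<le> measure lebesgue (hcube a l - E)"
        using N by (simp add: power_mult_distrib)
      then have "measure (wm u) E \<le> \<eta> * measure (wm u) (hcube a l)"
        using E EQ N l hcube_subset_ball[OF l, of a] by (intro \<eta>(3)[of "N * l" _ _ a]) (auto simp: N_def)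
      then have E2: "emeasure (wm u) E \<le> ennreal \<eta> * emeasure (wm u) (hcube a l)"
        using fmeasurable_wm(1)[of "hcube a l" a "N * l"] fmeasurable_wm(1)[of E a "N * l"] hcube_subset_ball[OF l, of a] EQ E \<eta>(1)
        by (simp add: emeasure_eq_measure2 ennreal_mult[symmetric] N_def ennreal_leI)
      \<comment> \<open>Recentring at the stopping cube lowers the level by \<open>T\<close>, so
        only the level \<open>real m * T\<close> remains and the induction hypothesis applies inside
        each cube.\<close>
      define A where "A Q = {x \<in> Q. real m * T < norm (b x - cQ (cf Q) (hf Q))}" for Q
      have Ameas: "A Q \<in> sets lebesgue" if "Q \<in> S" for Q
      proof -
        have [measurable]: "Q \<in> sets lebesgue" using that Ssets by auto
        have "A Q = Q \<inter> {x \<in> space lebesgue. real m * T < norm (b x - cQ (cf Q) (hf Q))}" by (auto simp: A_def)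
        also have "\<dots> \<in> sets lebesgue" by measurable
        finally show ?thesis .
      qed
      have UA: "(\<Union>Q\<in>S. A Q) \<in> sets lebesgue" using S(1) Ameas by (intro sets.countable_UN') auto
      have close: "norm (cQ (cf Q) (hf Q) - cQ a l) \<le> T" if "Q \<in> S" for Q
      proof -
        have Q: "0 < hf Q" "Q = hcube (cf Q) (hf Q)" using ch[OF that] by auto
        have vol: "emeasure lebesgue Q = ennreal (hf Q ^ CARD('n))" by (subst Q(2), rule emeasure_hcube[OF Q(1)])
        show ?thesis unfolding T_def
        proof (rule oscillation_centre_diff[where A = Q and b = b and m = "hf Q ^ CARD('n)"])
          show "(\<integral>\<^sup>+y\<in>Q. ennreal (norm (b y - cQ (cf Q) (hf Q))) \<partial>lebesgue) \<le> ennreal (M' * hf Q ^ CARD('n))"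
            using oscQ[OF Q(1), of "cf Q"] Q(2) by simp
          show "(\<integral>\<^sup>+y\<in>Q. ennreal (norm (b y - cQ a l)) \<partial>lebesgue) \<le> ennreal (2 ^ CARD('n) * \<mu> * hf Q ^ CARD('n))"
            using S(6)[OF that] Q(1) \<mu> unfolding vol g_def by (simp add: ennreal_mult)
          show "Q \<in> sets lebesgue" using that Ssets by auto
        qed (use vol Q \<mu> M' in auto)
      qed
      have "AE x in wm u. x \<in> hcube a l - \<Union>S \<longrightarrow> g x \<le> ennreal \<mu>"
        unfolding wm_def using S(7) by (subst AE_density) auto
      then have "emeasure (wm u) {x \<in> hcube a l. real (Suc m) * T < norm (b x - cQ a l)} \<le> emeasure (wm u) (\<Union>Q\<in>S. A Q)"
      proof (intro emeasure_mono_AE, eventually_elim)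
        case (elim x)
        show ?case
        proof
          assume x: "x \<in> {x \<in> hcube a l. real (Suc m) * T < norm (b x - cQ a l)}"
          \<comment> \<open>Off the stopping cubes the deviation is at most \<mu>, which is below
            \<open>T\<close> and hence below the level in question.\<close>
          have "x \<in> \<Union>S"
          proof (rule ccontr)
            assume "x \<notin> \<Union>S"
            then have "g x \<le> ennreal \<mu>" using elim x by simp
            then have "norm (b x - cQ a l) \<le> \<mu>" using \<mu> by (simp add: g_def)
            moreover have "0 \<le> real m * T" using T by simp
            ultimately show False using x \<mu>T by (simp add: distrib_right)
          qed
          then obtain Q where Q: "Q \<in> S" "x \<in> Q" by blast
          have "norm (b x - cQ a l) \<le> norm (b x - cQ (cf Q) (hf Q)) + norm (cQ (cf Q) (hf Q) - cQ a l)"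
            using norm_triangle_ineq[of "b x - cQ (cf Q) (hf Q)" "cQ (cf Q) (hf Q) - cQ a l"] by simp
          then have "real m * T < norm (b x - cQ (cf Q) (hf Q))" using x close[OF Q(1)] by (simp add: distrib_right)
          then show "x \<in> (\<Union>Q\<in>S. A Q)" using Q by (auto simp: A_def)
        qed
      qed (use UA in auto)
      also have "\<dots> \<le> ennreal (\<eta> ^ m) * emeasure (wm u) (\<Union>S)"
      proof (rule emeasure_Union_le[OF _ _ S(1,2) Ssets])
        fix Q assume Q: "Q \<in> S"
        have "emeasure (wm u) {x \<in> hcube (cf Q) (hf Q). real m * T < norm (b x - cQ (cf Q) (hf Q))}
           \<le> ennreal (\<eta> ^ m) * emeasure (wm u) (hcube (cf Q) (hf Q))"
          using ch[OF Q] by (intro Suc.IH) auto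
        then show "emeasure (wm u) (A Q) \<le> ennreal (\<eta> ^ m) * emeasure (wm u) Q"
          using ch[OF Q] by (simp add: A_def)
      qed (simp_all add: Ameas, auto simp: A_def)
      also have "\<dots> \<le> ennreal (\<eta> ^ m) * (ennreal \<eta> * emeasure (wm u) (hcube a l))"
        using E2 by (intro mult_left_mono) (auto simp: E_def)
      also have "\<dots> = ennreal (\<eta> ^ Suc m) * emeasure (wm u) (hcube a l)"
        using \<eta>(1) by (simp add: ennreal_mult mult_ac)
      finally show ?case .
    qed
  qed
qed

end

text \<open>A discrete layer cake: the single term with m T < t \<le> (m + 1) T already dominates,
  and the summand 1 takes care of \<open>t = 0\<close>.\<close>

lemma exp_le_layer_sum:
  assumes "0 < T" "0 \<le> \<epsilon>" "0 \<le> t"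
  shows "ennreal (exp (\<epsilon> * t)) \<le> 1 + (\<Sum>m. ennreal (exp (\<epsilon> * T) ^ Suc m) * indicator {real m * T<..} t)"
proof (cases "t = 0")
  case False
  then have t: "0 < t" using assms by simp
  \<comment> \<open>The ceiling minus 1 gives the strict inequality m T < t, matching the strict
    superlevel sets of the distribution estimate.\<close>
  define m where "m = nat \<lceil>t / T\<rceil> - 1"
  have "1 \<le> \<lceil>t / T\<rceil>" using t assms by simp
  then have m: "real (Suc m) = of_int \<lceil>t / T\<rceil>" by (simp add: m_def)
  then have "t / T \<le> real (Suc m)" "real m < t / T" 
    using ceiling_correct[of "t / T"] by auto
  then have m2: "t \<le> real (Suc m) * T" "real m * T < t" using assms(1) by (simp_all add: field_simps)
  have "exp (\<epsilon> * t) \<le> exp (real (Suc m) * (\<epsilon> * T))"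
    using mult_left_mono[OF m2(1) assms(2)] by (simp add: mult_ac)
  also have "\<dots> = exp (\<epsilon> * T) ^ Suc m" by (rule exp_of_nat_mult)
  finally have "ennreal (exp (\<epsilon> * t)) \<le> ennreal (exp (\<epsilon> * T) ^ Suc m) * indicator {real m * T<..} t"
    using m2(2) by (simp add: ennreal_leI del: power_Suc)
  also have "\<dots> \<le> (\<Sum>m. ennreal (exp (\<epsilon> * T) ^ Suc m) * indicator {real m * T<..} t)"
    by (rule ennreal_le_suminf)
  also have "\<dots> \<le> 1 + \<dots>" by simp
  finally show ?thesis .
qed simp

section \<open>Exponential integrability on cubes\<close>

context muckenhoupt_pair
begin

lemma John_Nirenberg_exp_cubes:
  assumes "bounded_oscillation b c M"
  defines "cQ \<equiv> \<lambda>a l. c a (2 * real CARD('n) * l)"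
  obtains \<epsilon> C where "0 < \<epsilon>" "0 < C"
    "\<And>a l. 0 < l \<Longrightarrow> (\<integral>\<^sup>+x\<in>hcube a l. ennreal (exp (\<epsilon> * norm (b x - cQ a l))) \<partial>wm u) \<le> ennreal C * emeasure (wm u) (hcube a l)"
proof -
  have b [measurable]: "b \<in> borel_measurable lebesgue" using assms(1) by (auto simp: bounded_oscillation_def)
  have bu [measurable]: "b \<in> borel_measurable (wm u)" using b by (simp cong: measurable_cong_sets)
  obtain \<eta> T where \<eta>: "0 < \<eta>" "\<eta> < 1" "0 < T"
    and dist: "\<And>a l m. 0 < l \<Longrightarrow> emeasure (wm u) {x \<in> hcube a l. real m * T < norm (b x - cQ a l)} \<le> ennreal (\<eta> ^ m) * emeasure (wm u) (hcube a l)"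
    using John_Nirenberg_cubes[OF assms(1)] unfolding cQ_def by blast
  \<comment> \<open>Half of the decay is spent on the exponential: \<epsilon> is chosen so that
    exp(\<epsilon> T) = 1/\<zeta>, and \<zeta>^(-m-1) against \<eta>^m = \<zeta>^(2m) leaves the
    summable \<zeta>^m / \<zeta>.\<close>
  define \<zeta> where "\<zeta> = sqrt \<eta>"
  have \<zeta>: "0 < \<zeta>" "\<zeta> < 1" "\<eta> = \<zeta> * \<zeta>" using \<eta> by (auto simp: \<zeta>_def)
  define \<epsilon> where "\<epsilon> = ln (1 / \<zeta>) / T"
  have \<epsilon>: "0 < \<epsilon>" "exp (\<epsilon> * T) = 1 / \<zeta>" using \<zeta> \<eta> by (auto simp: \<epsilon>_def)
  define C where "C = 1 + 1 / \<zeta> * (1 / (1 - \<zeta>))"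
  have C: "0 < C" using \<zeta> by (simp add: C_def add_pos_pos)
  show ?thesis
  proof (rule that[OF \<epsilon>(1) C])
    fix a :: "real^'n" and l :: real assume l: "0 < l"
    have [measurable]: "hcube a l \<in> sets (wm u)" by simp
    have "(\<integral>\<^sup>+x\<in>hcube a l. ennreal (exp (\<epsilon> * norm (b x - cQ a l))) \<partial>wm u)
      \<le> (\<integral>\<^sup>+x. indicator (hcube a l) x + (\<Sum>m. ennreal (exp (\<epsilon> * T) ^ Suc m) * indicator {x \<in> hcube a l. real m * T < norm (b x - cQ a l)} x) \<partial>wm u)"
    proof (rule nn_integral_mono)
      fix x
      show "ennreal (exp (\<epsilon> * norm (b x - cQ a l))) * indicator (hcube a l) x
        \<le> indicator (hcube a l) x + (\<Sum>m. ennreal (exp (\<epsilon> * T) ^ Suc m) * indicator {x \<in> hcube a l. real m * T < norm (b x - cQ a l)} x)"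
        using exp_le_layer_sum[OF \<eta>(3), of \<epsilon> "norm (b x - cQ a l)"] \<epsilon>(1)
        by (cases "x \<in> hcube a l") (simp_all add: indicator_def)
    qed
    also have "\<dots> = emeasure (wm u) (hcube a l) + (\<integral>\<^sup>+x. (\<Sum>m. ennreal (exp (\<epsilon> * T) ^ Suc m) * indicator {x \<in> hcube a l. real m * T < norm (b x - cQ a l)} x) \<partial>wm u)"
      by (subst nn_integral_add) auto
    also have "(\<integral>\<^sup>+x. (\<Sum>m. ennreal (exp (\<epsilon> * T) ^ Suc m) * indicator {x \<in> hcube a l. real m * T < norm (b x - cQ a l)} x) \<partial>wm u)
      = (\<Sum>m. (\<integral>\<^sup>+x. ennreal (exp (\<epsilon> * T) ^ Suc m) * indicator {x \<in> hcube a l. real m * T < norm (b x - cQ a l)} x \<partial>wm u))"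
      by (intro nn_integral_suminf) measurable
    also have "\<dots> = (\<Sum>m. ennreal (exp (\<epsilon> * T) ^ Suc m) * emeasure (wm u) {x \<in> hcube a l. real m * T < norm (b x - cQ a l)})"
    proof (intro arg_cong[where f = suminf] ext nn_integral_cmult_indicator)
      fix m
      have "{x \<in> space (wm u). x \<in> hcube a l \<and> real m * T < norm (b x - cQ a l)} \<in> sets (wm u)" by measurable
      then show "{x \<in> hcube a l. real m * T < norm (b x - cQ a l)} \<in> sets (wm u)" by simp
    qed
    also have "\<dots> \<le> (\<Sum>m. (ennreal (1 / \<zeta>) * emeasure (wm u) (hcube a l)) * ennreal (\<zeta> ^ m))"
    proof (intro suminf_le summableI)
      fix m
      have "ennreal (exp (\<epsilon> * T) ^ Suc m) * emeasure (wm u) {x \<in> hcube a l. real m * T < norm (b x - cQ a l)}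
        \<le> ennreal (exp (\<epsilon> * T) ^ Suc m) * (ennreal (\<eta> ^ m) * emeasure (wm u) (hcube a l))"
        by (intro mult_left_mono dist[OF l]) simp
      also have "\<dots> = ennreal (exp (\<epsilon> * T) ^ Suc m * \<eta> ^ m) * emeasure (wm u) (hcube a l)"
        using \<eta> by (simp add: ennreal_mult mult.assoc del: power_Suc)
      also have "exp (\<epsilon> * T) ^ Suc m * \<eta> ^ m = 1 / \<zeta> * \<zeta> ^ m"
        unfolding \<epsilon>(2) \<zeta>(3) using \<zeta>(1) by (simp add: power_mult_distrib power_divide)
      also have "ennreal (1 / \<zeta> * \<zeta> ^ m) * emeasure (wm u) (hcube a l) = (ennreal (1 / \<zeta>) * emeasure (wm u) (hcube a l)) * ennreal (\<zeta> ^ m)"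
        using \<zeta> by (subst ennreal_mult) (auto simp only: mult_ac zero_le_divide_iff zero_le_power less_imp_le zero_le_one)
      finally show "ennreal (exp (\<epsilon> * T) ^ Suc m) * emeasure (wm u) {x \<in> hcube a l. real m * T < norm (b x - cQ a l)}
        \<le> (ennreal (1 / \<zeta>) * emeasure (wm u) (hcube a l)) * ennreal (\<zeta> ^ m)" .
    qed
    also have "\<dots> = (ennreal (1 / \<zeta>) * emeasure (wm u) (hcube a l)) * ennreal (1 / (1 - \<zeta>))"
      using \<zeta> by (intro suminf_geometric_ennreal) auto
    also have "emeasure (wm u) (hcube a l) + \<dots> = (1 + ennreal (1 / \<zeta>) * ennreal (1 / (1 - \<zeta>))) * emeasure (wm u) (hcube a l)"
      by (simp only: distrib_left mult_ac mult_1_left)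
    also have "1 + ennreal (1 / \<zeta>) * ennreal (1 / (1 - \<zeta>)) = ennreal C"
      unfolding C_def using \<zeta> by (subst ennreal_plus) (auto simp: ennreal_mult[symmetric])
    finally show "(\<integral>\<^sup>+x\<in>hcube a l. ennreal (exp (\<epsilon> * norm (b x - cQ a l))) \<partial>wm u) \<le> ennreal C * emeasure (wm u) (hcube a l)"
      by (simp add: add_left_mono)
  qed
qed

end

text \<open>Both centres are compared on the smaller ball, where the oscillation about the centre of
  the larger one costs the volume ratio t^n.\<close>

lemma bounded_oscillation_centre_diff:
  fixes b :: "real^'n \<Rightarrow> complex"
  assumes "bounded_oscillation b c M" "0 < r" "0 < t" "ball x r \<subseteq> ball z (t * r)"
  shows "norm (c x r - c z (t * r)) \<le> M / unit_ball_vol (real CARD('n)) * (1 + t ^ CARD('n))"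
proof -
  have M: "0 < M" and b: "b \<in> borel_measurable lebesgue"
    and osc: "\<And>x r. 0 < r \<Longrightarrow> (\<integral>\<^sup>+y\<in>ball x r. ennreal (norm (b y - c x r)) \<partial>lebesgue) \<le> ennreal (M * r ^ CARD('n))"
    using assms(1) by (auto simp: bounded_oscillation_def)
  define \<omega> where "\<omega> = unit_ball_vol (real CARD('n))"
  have \<omega>: "0 < \<omega>" by (simp add: \<omega>_def)
  have "norm (c x r - c z (t * r)) \<le> M / \<omega> + M / \<omega> * t ^ CARD('n)"
  proof (rule oscillation_centre_diff[OF b])
    show "emeasure lebesgue (ball x r) = ennreal (\<omega> * r ^ CARD('n))"
      using assms(2) by (simp add: emeasure_completion_eq emeasure_ball \<omega>_def)
    show "(\<integral>\<^sup>+y\<in>ball x r. ennreal (norm (b y - c x r)) \<partial>lebesgue) \<le> ennreal (M / \<omega> * (\<omega> * r ^ CARD('n)))"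
      using osc[OF assms(2), of x] \<omega> by simp
    have "(\<integral>\<^sup>+y\<in>ball x r. ennreal (norm (b y - c z (t * r))) \<partial>lebesgue) \<le> (\<integral>\<^sup>+y\<in>ball z (t * r). ennreal (norm (b y - c z (t * r))) \<partial>lebesgue)"
      using assms(4) by (rule nn_integral_mono_set)
    also have "\<dots> \<le> ennreal (M * (t * r) ^ CARD('n))" using assms by (intro osc) simp
    finally show "(\<integral>\<^sup>+y\<in>ball x r. ennreal (norm (b y - c z (t * r))) \<partial>lebesgue) \<le> ennreal (M / \<omega> * t ^ CARD('n) * (\<omega> * r ^ CARD('n)))"
      using \<omega> by (simp add: power_mult_distrib mult_ac)
  qed (use assms M \<omega> in auto)
  then show ?thesis by (simp add: distrib_left \<omega>_def)
qed

section \<open>Exponential integrability on balls and stability of the weight class\<close>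

context muckenhoupt_pair
begin

text \<open>A ball of radius r lies in a cube of side 2 r, which lies in a ball of radius 4 n r. The
  centre moves by a bounded amount between the two balls, and doubling returns to the original one.
  A threshold on \<open>e\<close>, rather than a fixed value, lets several exponents share the
  estimate.\<close>

proposition John_Nirenberg:
  assumes "bounded_oscillation b c M"
  obtains \<epsilon> C where "0 < \<epsilon>" "0 < C"
    "\<And>x r e. 0 < r \<Longrightarrow> e \<le> \<epsilon> \<Longrightarrow> 
      (\<integral>\<^sup>+y\<in>ball x r. ennreal (exp (e * norm (b y - c x r))) \<partial>wm u) \<le> ennreal C * emeasure (wm u) (ball x r)"
proof -
  have b [measurable]: "b \<in> borel_measurable lebesgue" using assms(1) by (auto simp: bounded_oscillation_def)
  have bu [measurable]: "b \<in> borel_measurable (wm u)" using b by (simp cong: measurable_cong_sets)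
  obtain \<epsilon> C where \<epsilon>: "0 < \<epsilon>" "0 < C"
    "\<And>a l. 0 < l \<Longrightarrow> (\<integral>\<^sup>+x\<in>hcube a l. ennreal (exp (\<epsilon> * norm (b x - c a (2 * real CARD('n) * l)))) \<partial>wm u) \<le> ennreal C * emeasure (wm u) (hcube a l)"
    using John_Nirenberg_exp_cubes[OF assms] by blast
  define t where "t = 4 * real CARD('n)"
  have t: "0 < t" by (simp add: t_def)
  obtain D where D: "0 < D" "\<And>x z r. 0 < r \<Longrightarrow> ball x r \<subseteq> ball z (t * r) \<Longrightarrow>
    ub z (t * r) \<le> D * ub x r"
    using wm_doubling[OF t] by blast
  define \<delta> where "\<delta> = M / unit_ball_vol (real CARD('n)) * (1 + t ^ CARD('n))"
  define C' where "C' = exp (\<epsilon> * \<delta>) * (C * D)"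
  have C': "0 < C'" using \<epsilon> D by (simp add: C'_def)
  show ?thesis
  proof (rule that[OF \<epsilon>(1) C'])
    fix x :: "real^'n" and r e :: real assume r: "0 < r" and e: "e \<le> \<epsilon>"
    define a where "a = x - (\<chi> i. r)"
    have sub1: "ball x r \<subseteq> hcube a (2 * r)" unfolding a_def by (rule ball_subset_hcube)
    have sub2: "hcube a (2 * r) \<subseteq> ball a (t * r)" using hcube_subset_ball[of "2 * r" a] r by (simp add: t_def mult.assoc)
    have cd: "norm (c x r - c a (t * r)) \<le> \<delta>" unfolding \<delta>_def
      using sub1 sub2 r t by (intro bounded_oscillation_centre_diff[OF assms]) auto
    have "(\<integral>\<^sup>+y\<in>ball x r. ennreal (exp (e * norm (b y - c x r))) \<partial>wm u)
      \<le> (\<integral>\<^sup>+y. ennreal (exp (\<epsilon> * \<delta>)) * (ennreal (exp (\<epsilon> * norm (b y - c a (t * r)))) * indicator (hcube a (2 * r)) y) \<partial>wm u)"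
    proof (rule nn_integral_mono)
      fix y
      have "norm (b y - c x r) \<le> norm (b y - c a (t * r)) + \<delta>"
        using norm_triangle_ineq4[of "b y - c a (t * r)" "c x r - c a (t * r)"] cd by simp
      then have "\<epsilon> * norm (b y - c x r) \<le> \<epsilon> * (norm (b y - c a (t * r)) + \<delta>)"
        using \<epsilon>(1) by (intro mult_left_mono) auto
      moreover have "e * norm (b y - c x r) \<le> \<epsilon> * norm (b y - c x r)" using e by (intro mult_right_mono) auto
      ultimately have "exp (e * norm (b y - c x r)) \<le> exp (\<epsilon> * \<delta>) * exp (\<epsilon> * norm (b y - c a (t * r)))"
        by (simp add: exp_add[symmetric] distrib_left)
      then have "ennreal (exp (e * norm (b y - c x r))) \<le> ennreal (exp (\<epsilon> * \<delta>)) * ennreal (exp (\<epsilon> * norm (b y - c a (t * r))))"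
        by (simp add: ennreal_mult[symmetric] ennreal_leI)
      then show "ennreal (exp (e * norm (b y - c x r))) * indicator (ball x r) y
         \<le> ennreal (exp (\<epsilon> * \<delta>)) * (ennreal (exp (\<epsilon> * norm (b y - c a (t * r)))) * indicator (hcube a (2 * r)) y)"
        using sub1 by (cases "y \<in> ball x r") (auto simp: subset_eq)
    qed
    also have "\<dots> = ennreal (exp (\<epsilon> * \<delta>)) * (\<integral>\<^sup>+y\<in>hcube a (2 * r). ennreal (exp (\<epsilon> * norm (b y - c a (t * r)))) \<partial>wm u)"
    proof (rule nn_integral_cmult)
      have [measurable]: "hcube a (2 * r) \<in> sets (wm u)" by simp
      show "(\<lambda>y. ennreal (exp (\<epsilon> * norm (b y - c a (t * r)))) * indicator (hcube a (2 * r)) y) \<in> borel_measurable (wm u)"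
        by measurable
    qed
    also have "\<dots> \<le> ennreal (exp (\<epsilon> * \<delta>)) * (ennreal C * emeasure (wm u) (hcube a (2 * r)))"
      using \<epsilon>(3)[of "2 * r" a] r by (intro mult_left_mono) (auto simp: t_def mult_ac)
    also have "\<dots> \<le> ennreal (exp (\<epsilon> * \<delta>)) * (ennreal C * emeasure (wm u) (ball a (t * r)))"
      using sub2 by (intro mult_left_mono emeasure_mono) auto
    also have "\<dots> \<le> ennreal (exp (\<epsilon> * \<delta>)) * (ennreal C * (ennreal D * emeasure (wm u) (ball x r)))"
      using D(2)[OF r, of x a] D(1) sub1 sub2 unfolding emeasure_wm_ball
      by (intro mult_left_mono) (auto simp: ennreal_mult[symmetric] intro!: ennreal_leI)
    also have "\<dots> = ennreal C' * emeasure (wm u) (ball x r)"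
      using \<epsilon> D by (simp add: C'_def ennreal_mult mult_ac)
    finally show "(\<integral>\<^sup>+y\<in>ball x r. ennreal (exp (e * norm (b y - c x r))) \<partial>wm u) \<le> ennreal C' * emeasure (wm u) (ball x r)" .
  qed
qed

text \<open>As \<phi> is 1-Lipschitz, exp(e \<phi>(b)) is at most exp(e \<phi>(c)) times an
  exponentially integrable factor. The point is to isolate exp(e \<phi>(c)), which later cancels
  between the two weights of a pair.\<close>

lemma exp_perturbed_ball:
  fixes \<phi> :: "complex \<Rightarrow> real"
  assumes v: "v \<in> borel_measurable lebesgue" "b \<in> borel_measurable lebesgue" "\<phi> \<in> borel_measurable borel" "AE x in lebesgue. 0 < v x"
    and \<phi>: "\<And>z w. \<bar>\<phi> z - \<phi> w\<bar> \<le> norm (z - w)"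
    and fin: "emeasure (wm v) B < \<infinity>" "B \<in> sets lebesgue"
    and C: "(\<integral>\<^sup>+y\<in>B. ennreal (exp (\<bar>e\<bar> * norm (b y - c))) \<partial>wm v) \<le> ennreal C * emeasure (wm v) B" "0 \<le> C"
  shows "emeasure (wm (\<lambda>x. v x * exp (e * \<phi> (b x)))) B \<le> ennreal (C * exp (e * \<phi> c) * measure (wm v) B)"
proof -
  have [measurable]: "v \<in> borel_measurable lebesgue" "b \<in> borel_measurable lebesgue" "\<phi> \<in> borel_measurable borel" "B \<in> sets lebesgue" by fact+
  have "emeasure (wm (\<lambda>x. v x * exp (e * \<phi> (b x)))) B = (\<integral>\<^sup>+y\<in>B. ennreal (v y * exp (e * \<phi> (b y))) \<partial>lebesgue)"
    unfolding wm_def by (subst emeasure_density) auto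
  also have "\<dots> \<le> (\<integral>\<^sup>+y. ennreal (exp (e * \<phi> c)) * (ennreal (v y) * (ennreal (exp (\<bar>e\<bar> * norm (b y - c))) * indicator B y)) \<partial>lebesgue)"
  proof (intro nn_integral_mono_AE, use v(4) in eventually_elim)
    fix y assume y: "0 < v y"
    have "e * (\<phi> (b y) - \<phi> c) \<le> \<bar>e\<bar> * \<bar>\<phi> (b y) - \<phi> c\<bar>" by (metis abs_ge_self abs_mult)
    also have "\<dots> \<le> \<bar>e\<bar> * norm (b y - c)" by (intro mult_left_mono \<phi>) simp
    finally have "exp (e * \<phi> (b y)) \<le> exp (e * \<phi> c) * exp (\<bar>e\<bar> * norm (b y - c))"
      by (simp add: exp_add[symmetric] right_diff_distrib)
    then have "v y * exp (e * \<phi> (b y)) \<le> exp (e * \<phi> c) * (v y * exp (\<bar>e\<bar> * norm (b y - c)))"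
      using y mult_left_mono[of _ _ "v y"] by (simp add: mult.left_commute)
    then show "ennreal (v y * exp (e * \<phi> (b y))) * indicator B y
      \<le> ennreal (exp (e * \<phi> c)) * (ennreal (v y) * (ennreal (exp (\<bar>e\<bar> * norm (b y - c))) * indicator B y))"
      using y by (simp add: ennreal_mult[symmetric] ennreal_leI split: split_indicator)
  qed
  also have "\<dots> = ennreal (exp (e * \<phi> c)) * (\<integral>\<^sup>+y. (ennreal (v y) * (ennreal (exp (\<bar>e\<bar> * norm (b y - c))) * indicator B y)) \<partial>lebesgue)"
    by (rule nn_integral_cmult) measurable
  also have "(\<integral>\<^sup>+y. (ennreal (v y) * (ennreal (exp (\<bar>e\<bar> * norm (b y - c))) * indicator B y)) \<partial>lebesgue)
    = (\<integral>\<^sup>+y\<in>B. ennreal (exp (\<bar>e\<bar> * norm (b y - c))) \<partial>wm v)"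
    unfolding wm_def by (rule nn_integral_density[symmetric]) measurable
  also have "ennreal (exp (e * \<phi> c)) * \<dots> \<le> ennreal (exp (e * \<phi> c)) * (ennreal C * emeasure (wm v) B)"
    by (intro mult_left_mono C) simp
  also have "\<dots> = ennreal (C * exp (e * \<phi> c) * measure (wm v) B)"
    using fin C(2) by (simp add: emeasure_eq_ennreal_measure less_top ennreal_mult[symmetric] mult_ac)
  finally show ?thesis .
qed

text \<open>The balance \<theta> \<gamma> = (1-\<theta>) \<gamma>' cancels the exponentials twice:
  pointwise in the duality relation, and at the centre \<open>c x r\<close> in the ball condition.
  John--Nirenberg is needed for both measures, the second by symmetry of the pair. The resulting
  constant is the same for all admissible \<open>e\<close> and \<phi>.\<close>

lemma exp_perturbation:
  fixes \<gamma> \<gamma>' :: real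
  assumes "bounded_oscillation b c M" and \<gamma>: "0 < \<gamma>" "0 < \<gamma>'" "\<theta> * \<gamma> = (1 - \<theta>) * \<gamma>'"
  obtains \<epsilon> where "0 < \<epsilon>"
    "\<And>e \<phi>. 0 < e \<Longrightarrow> e \<le> \<epsilon> \<Longrightarrow> \<phi> \<in> borel_measurable borel \<Longrightarrow> (\<And>z w. \<bar>\<phi> z - \<phi> w\<bar> \<le> norm (z - w)) \<Longrightarrow>
      \<exists>K'. muckenhoupt_pair (\<lambda>x. u x * exp (\<gamma> * e * \<phi> (b x))) (\<lambda>x. s x * exp (- \<gamma>' * e * \<phi> (b x))) \<theta> K'"
proof -
  have b [measurable]: "b \<in> borel_measurable lebesgue" using assms(1) by (auto simp: bounded_oscillation_def)
  obtain \<epsilon>1 C1 where 1: "0 < \<epsilon>1" "0 < C1"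
    "\<And>x r e. 0 < r \<Longrightarrow> e \<le> \<epsilon>1 \<Longrightarrow> 
      (\<integral>\<^sup>+y\<in>ball x r. ennreal (exp (e * norm (b y - c x r))) \<partial>wm u) \<le> ennreal C1 * emeasure (wm u) (ball x r)"
    using John_Nirenberg[OF assms(1)] by blast
  obtain \<epsilon>2 C2 where 2: "0 < \<epsilon>2" "0 < C2"
    "\<And>x r e. 0 < r \<Longrightarrow> e \<le> \<epsilon>2 \<Longrightarrow> 
      (\<integral>\<^sup>+y\<in>ball x r. ennreal (exp (e * norm (b y - c x r))) \<partial>wm s) \<le> ennreal C2 * emeasure (wm s) (ball x r)"
    using muckenhoupt_pair.John_Nirenberg[OF swap assms(1)] by blast
  define \<epsilon> where "\<epsilon> = min (\<epsilon>1 / \<gamma>) (\<epsilon>2 / \<gamma>')"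
  have \<epsilon>: "0 < \<epsilon>" using 1 2 \<gamma> by (simp add: \<epsilon>_def)
  show ?thesis
  proof (rule that[OF \<epsilon>])
    fix e and \<phi> :: "complex \<Rightarrow> real"
    assume e: "0 < e" "e \<le> \<epsilon>" and [measurable]: "\<phi> \<in> borel_measurable borel" and \<phi>: "\<And>z w. \<bar>\<phi> z - \<phi> w\<bar> \<le> norm (z - w)"
    define u' where "u' x = u x * exp (\<gamma> * e * \<phi> (b x))" for x
    define s' where "s' x = s x * exp (- \<gamma>' * e * \<phi> (b x))" for x
    have e1: "\<bar>\<gamma> * e\<bar> \<le> \<epsilon>1" "\<bar>- \<gamma>' * e\<bar> \<le> \<epsilon>2"
      using e \<gamma> by (auto simp: \<epsilon>_def abs_mult field_simps)
    have U: "emeasure (wm u') (ball x r) \<le> ennreal (C1 * exp (\<gamma> * e * \<phi> (c x r)) * ub x r)" if "0 < r" for x r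
      unfolding u'_def using dual 1(1,2) 1(3)[OF that e1(1)] finite_u
      by (intro exp_perturbed_ball \<phi>) auto
    have S: "emeasure (wm s') (ball x r) \<le> ennreal (C2 * exp (- \<gamma>' * e * \<phi> (c x r)) * sb x r)" if "0 < r" for x r
      unfolding s'_def using dual 2(1,2) 2(3)[OF that e1(2)] finite_s
      by (intro exp_perturbed_ball \<phi>) auto
    have "muckenhoupt_pair u' s' \<theta> (C1 powr \<theta> * C2 powr (1 - \<theta>) * K)"
    proof
      show "0 < \<theta>" "\<theta> < 1" by (fact theta)+
      show "u' \<in> borel_measurable lebesgue" "s' \<in> borel_measurable lebesgue" unfolding u'_def s'_def by measurable
      show "AE x in lebesgue. 0 < u' x \<and> 0 < s' x \<and> u' x powr \<theta> * s' x powr (1 - \<theta>) = 1"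
        using dual
      proof eventually_elim
        case (elim x)
        let ?h = "e * \<phi> (b x)"
        have "u' x powr \<theta> * s' x powr (1 - \<theta>) = (u x powr \<theta> * s x powr (1 - \<theta>)) * (exp (\<gamma> * e * \<phi> (b x)) powr \<theta> * exp (- \<gamma>' * e * \<phi> (b x)) powr (1 - \<theta>))"
          unfolding u'_def s'_def using elim by (simp add: powr_mult mult_ac)
        also have "exp (\<gamma> * e * \<phi> (b x)) powr \<theta> * exp (- \<gamma>' * e * \<phi> (b x)) powr (1 - \<theta>) = exp ((\<theta> * \<gamma> - (1 - \<theta>) * \<gamma>') * ?h)"
          by (simp add: powr_def exp_add[symmetric] algebra_simps)
        also have "\<dots> = 1" by (simp add: \<gamma>(3))
        finally show ?case using elim by (simp add: u'_def s'_def)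
      qed
      fix x :: "real^'n" and r :: real
      show "emeasure (wm u') (ball x r) < \<infinity>"
        using U[of r x] by (cases "0 < r") (auto intro: le_less_trans simp: ball_empty not_less)
      show "emeasure (wm s') (ball x r) < \<infinity>"
        using S[of r x] by (cases "0 < r") (auto intro: le_less_trans simp: ball_empty not_less)
      assume r: "0 < r"
      let ?h = "e * \<phi> (c x r)"
      have "measure (wm u') (ball x r) \<le> C1 * exp (\<gamma> * e * \<phi> (c x r)) * ub x r"
        unfolding measure_def[of "wm u'"] by (intro enn2real_leI U r) (use 1 in auto)
      moreover have "measure (wm s') (ball x r) \<le> C2 * exp (- \<gamma>' * e * \<phi> (c x r)) * sb x r"
        unfolding measure_def[of "wm s'"] by (intro enn2real_leI S r) (use 2 in auto)
      ultimately have "measure (wm u') (ball x r) powr \<theta> * measure (wm s') (ball x r) powr (1 - \<theta>)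
        \<le> (C1 * exp (\<gamma> * e * \<phi> (c x r)) * ub x r) powr \<theta> * (C2 * exp (- \<gamma>' * e * \<phi> (c x r)) * sb x r) powr (1 - \<theta>)"
        using theta by (intro mult_mono powr_mono2) auto
      also have "\<dots> = C1 powr \<theta> * C2 powr (1 - \<theta>) * (ub x r powr \<theta> * sb x r powr (1 - \<theta>))
         * (exp (\<gamma> * e * \<phi> (c x r)) powr \<theta> * exp (- \<gamma>' * e * \<phi> (c x r)) powr (1 - \<theta>))"
        using 1 2 by (simp add: powr_mult mult_ac)
      also have "exp (\<gamma> * e * \<phi> (c x r)) powr \<theta> * exp (- \<gamma>' * e * \<phi> (c x r)) powr (1 - \<theta>) = exp ((\<theta> * \<gamma> - (1 - \<theta>) * \<gamma>') * ?h)"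
        by (simp add: powr_def exp_add[symmetric] algebra_simps)
      also have "\<dots> = 1" by (simp add: \<gamma>(3))
      also have "C1 powr \<theta> * C2 powr (1 - \<theta>) * (ub x r powr \<theta> * sb x r powr (1 - \<theta>)) * 1
        \<le> C1 powr \<theta> * C2 powr (1 - \<theta>) * (K * r ^ CARD('n))"
        using ball_cond[OF r, of x] by (simp add: mult_left_mono)
      finally show "measure (wm u') (ball x r) powr \<theta> * measure (wm s') (ball x r) powr (1 - \<theta>) \<le> C1 powr \<theta> * C2 powr (1 - \<theta>) * K * r ^ CARD('n)"
        by (simp add: mult_ac)
    qed
    then show "\<exists>K'. muckenhoupt_pair (\<lambda>x. u x * exp (\<gamma> * e * \<phi> (b x))) (\<lambda>x. s x * exp (- \<gamma>' * e * \<phi> (b x))) \<theta> K'"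
      unfolding u'_def s'_def by blast
  qed
qed

end

section \<open>Exponential commutators on Morrey spaces\<close>

definition riesz :: "real \<Rightarrow> real^'n \<Rightarrow> real^'n \<Rightarrow> ennreal" where
  "riesz \<beta> x y = ennreal (norm (x - y) powr - \<beta>)"

abbreviation "riesz_exp \<beta> e b f x \<equiv>
  (\<integral>\<^sup>+y. riesz \<beta> x y * (ennreal (exp (e * norm (b x - b y))) * f y) \<partial>lebesgue)"

lemma sigma_finite_lebesgue: "sigma_finite_measure (lebesgue :: (real^'n) measure)"
proof
  have "\<Union>(range (\<lambda>n::nat. ball (0::real^'n) (real n))) = UNIV"
    using reals_Archimedean2 by auto
  moreover have "emeasure lebesgue (ball (0::real^'n) (real n)) \<noteq> \<infinity>" for n
    by (simp add: emeasure_completion_eq emeasure_ball)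
  ultimately show "\<exists>A. countable A \<and> A \<subseteq> sets (lebesgue :: (real^'n) measure) \<and> \<Union> A = space lebesgue \<and> (\<forall>a\<in>A. emeasure lebesgue a \<noteq> \<infinity>)"
    by (intro exI[of _ "range (\<lambda>n::nat. ball (0::real^'n) (real n))"]) auto
qed

lemma measurable_id_lebesgue: "(\<lambda>x. x) \<in> measurable lebesgue borel"
  by (rule measurable_completion) simp

lemma measurable_riesz_pair: "(\<lambda>(x, y). riesz \<beta> x y) \<in> borel_measurable (lebesgue \<Otimes>\<^sub>M lebesgue)"
proof -
  have [measurable]: "(\<lambda>z. fst z) \<in> measurable (lebesgue \<Otimes>\<^sub>M lebesgue) borel" "(\<lambda>z. snd z) \<in> measurable (lebesgue \<Otimes>\<^sub>M lebesgue) borel"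
    using measurable_compose[OF measurable_fst measurable_id_lebesgue] measurable_compose[OF measurable_snd measurable_id_lebesgue] by auto
  show ?thesis unfolding riesz_def split_beta' by measurable
qed

text \<open>The function \<open>h\<close> depends on both variables because the exponential factor
  couples \<open>b x\<close> with \<open>b y\<close>.\<close>

lemma borel_measurable_riesz_kernel:
  fixes h :: "real^'n \<Rightarrow> real^'n \<Rightarrow> ennreal"
  assumes [measurable]: "(\<lambda>(x, y). h x y) \<in> borel_measurable (lebesgue \<Otimes>\<^sub>M lebesgue)"
  shows "(\<lambda>x. \<integral>\<^sup>+y. riesz \<beta> x y * h x y \<partial>lebesgue) \<in> borel_measurable lebesgue"
proof -
  have [measurable]: "(\<lambda>(x, y). riesz \<beta> x y :: ennreal) \<in> borel_measurable (lebesgue \<Otimes>\<^sub>M (lebesgue :: (real^'n) measure))"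
    by (rule measurable_riesz_pair)
  have "(\<lambda>z. (case z of (x, y) \<Rightarrow> riesz \<beta> x y) * (case z of (x, y) \<Rightarrow> h x y)) \<in> borel_measurable (lebesgue \<Otimes>\<^sub>M lebesgue)"
    by measurable
  then show ?thesis
    by (intro sigma_finite_measure.borel_measurable_nn_integral[OF sigma_finite_lebesgue]) (simp add: split_beta')
qed

lemma borel_measurable_riesz_potential:
  fixes f :: "real^'n \<Rightarrow> ennreal"
  assumes [measurable]: "f \<in> borel_measurable lebesgue"
  shows "(\<lambda>x. \<integral>\<^sup>+y. riesz \<beta> x y * f y \<partial>lebesgue) \<in> borel_measurable lebesgue"
  by (rule borel_measurable_riesz_kernel) measurable

lemma measurable_riesz [measurable]: "riesz \<beta> x \<in> borel_measurable lebesgue"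
  using measurable_riesz_kernel[of x "- \<beta>"] by (simp add: riesz_def[abs_def])

lemma ennreal_powr_sum_le:
  fixes A :: "'a \<Rightarrow> ennreal"
  assumes "finite I" "0 \<le> q"
  shows "ennreal_powr (\<Sum>i\<in>I. A i) q \<le> ennreal (real (card I) powr q) * (\<Sum>i\<in>I. ennreal_powr (A i) q)"
proof (cases "I = {}")
  case False
  define m where "m = Max (A ` I)"
  have "m \<in> A ` I" unfolding m_def using assms False by (intro Max_in) auto
  then obtain j where j: "j \<in> I" "m = A j" by auto
  have "(\<Sum>i\<in>I. A i) \<le> (\<Sum>i\<in>I. m)" unfolding m_def using assms by (intro sum_mono Max_ge) auto
  then have "(\<Sum>i\<in>I. A i) \<le> ennreal (real (card I)) * m" by (simp add: ennreal_of_nat_eq_real_of_nat)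
  then have "ennreal_powr (\<Sum>i\<in>I. A i) q \<le> ennreal_powr (ennreal (real (card I)) * m) q"
    using assms by (intro ennreal_powr_mono)
  also have "\<dots> = ennreal (real (card I) powr q) * ennreal_powr (A j) q"
    by (simp add: ennreal_powr_mult j)
  also have "\<dots> \<le> ennreal (real (card I) powr q) * (\<Sum>i\<in>I. ennreal_powr (A i) q)"
    using j(1) assms(1) by (intro mult_left_mono member_le_sum) auto
  finally show ?thesis .
qed simp

text \<open>The kernel \<open>exp (e * norm (b x - b y))\<close> dominates both \<open>1\<close> and \<open>e * norm (b x - b y)\<close>, and is
  itself dominated by a sum of kernels of conjugated form \<open>exp (h x - h y)\<close>.\<close>

definition signed_parts :: "(complex \<Rightarrow> real) set" where
  "signed_parts = {Re, Im, \<lambda>z. - Re z, \<lambda>z. - Im z}"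

lemma signed_parts:
  "finite signed_parts" "\<phi> \<in> signed_parts \<Longrightarrow> \<phi> \<in> borel_measurable borel"
  "\<phi> \<in> signed_parts \<Longrightarrow> \<bar>\<phi> z - \<phi> w\<bar> \<le> norm (z - w)"
  using abs_Re_le_cmod[of "z - w"] abs_Im_le_cmod[of "z - w"]
  by (auto simp: signed_parts_def abs_minus_commute)

text \<open>The modulus of a complex number is at most |Re| + |Im|, so one of the four signed parts
  is at least half of it; this is the origin of the factor 2 in the exponent.\<close>

lemma exp_norm_diff_le:
  assumes "0 \<le> e"
  shows "exp (e * norm (z - w)) \<le> (\<Sum>\<phi>\<in>signed_parts. exp (2 * e * (\<phi> z - \<phi> w)))"
proof -
  have "\<exists>\<phi>\<in>signed_parts. norm (z - w) \<le> 2 * (\<phi> z - \<phi> w)"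
    using cmod_le[of "z - w"] by (auto simp: signed_parts_def)
  then obtain \<phi> where \<phi>: "\<phi> \<in> signed_parts" "norm (z - w) \<le> 2 * (\<phi> z - \<phi> w)" by blast
  have "exp (e * norm (z - w)) \<le> exp (2 * e * (\<phi> z - \<phi> w))"
    using mult_left_mono[OF \<phi>(2) assms] by (simp add: mult_ac)
  also have "\<dots> \<le> (\<Sum>\<phi>\<in>signed_parts. exp (2 * e * (\<phi> z - \<phi> w)))"
    using \<phi>(1) signed_parts(1) by (intro member_le_sum) auto
  finally show ?thesis .
qed

section \<open>Weighted bounds for the exponential kernels\<close>

context muckenhoupt_pair
begin

text \<open>For \<open>s = w powr - p'\<close> the factor \<open>s y powr (1 - p)\<close> is
  \<open>w y powr p\<close>, so this is the p-th power of the norm in L^p(w^p), expressed through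
  the pair.\<close>

abbreviation "energy p f \<equiv> (\<integral>\<^sup>+y. ennreal_powr (f y) p * ennreal (s y powr (1 - p)) \<partial>lebesgue)"
abbreviation "energy_on A p f \<equiv> (\<integral>\<^sup>+y\<in>A. ennreal_powr (f y) p * ennreal (s y powr (1 - p)) \<partial>lebesgue)"

text \<open>The substitution of \<open>f / s\<close> for \<open>f\<close> moves the density
  \<open>s\<close> from the integration to the norm, so that the kernel acts in Lebesgue measure and
  no longer depends on the weight.\<close>

lemma fractional_integral_lebesgue:
  assumes pq: "1 < p" "p < q" "\<theta> * (1 / q + 1 - 1 / p) = 1 / q"
  obtains C where "0 < C" "\<And>f. f \<in> borel_measurable lebesgue \<Longrightarrow>
    (\<integral>\<^sup>+x. ennreal (u x) * ennreal_powr (\<integral>\<^sup>+y. riesz (real CARD('n) * (1 / q + 1 - 1 / p)) x y * f y \<partial>lebesgue) q \<partial>lebesgue)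
      \<le> ennreal C * ennreal_powr (energy p f) (q / p)"
proof -
  define \<beta> where "\<beta> = real CARD('n) * (1 / q + 1 - 1 / p)"
  obtain C where C: "0 < C" "\<And>f. f \<in> borel_measurable lebesgue \<Longrightarrow>
    (\<integral>\<^sup>+x. ennreal_powr (\<integral>\<^sup>+y. riesz \<beta> x y * f y \<partial>wm s) q \<partial>wm u)
      \<le> ennreal C * ennreal_powr (\<integral>\<^sup>+y. ennreal_powr (f y) p \<partial>wm s) (q / p)"
    using fractional_integral_strong_type[OF pq] unfolding riesz_def \<beta>_def by blast
  show ?thesis
  proof (rule that[OF C(1)])
    fix f :: "real^'n \<Rightarrow> ennreal" assume [measurable]: "f \<in> borel_measurable lebesgue"
    define g where "g y = ennreal (1 / s y) * f y" for y
    have [measurable]: "g \<in> borel_measurable lebesgue" unfolding g_def by measurable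
    have 1: "(\<integral>\<^sup>+y. riesz \<beta> x y * g y \<partial>wm s) = (\<integral>\<^sup>+y. riesz \<beta> x y * f y \<partial>lebesgue)" for x
    proof -
      have "(\<integral>\<^sup>+y. riesz \<beta> x y * g y \<partial>wm s) = (\<integral>\<^sup>+y. ennreal (s y) * (riesz \<beta> x y * g y) \<partial>lebesgue)"
        by (intro nn_integral_wm) measurable
      also have "\<dots> = (\<integral>\<^sup>+y. riesz \<beta> x y * f y \<partial>lebesgue)"
      proof (intro nn_integral_cong_AE, use dual in eventually_elim)
        fix y assume y: "0 < u y \<and> 0 < s y \<and> u y powr \<theta> * s y powr (1 - \<theta>) = 1"
        have "ennreal (s y) * (riesz \<beta> x y * g y) = (ennreal (s y) * ennreal (1 / s y)) * (riesz \<beta> x y * f y)"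
          unfolding g_def by (simp only: mult_ac)
        also have "ennreal (s y) * ennreal (1 / s y) = 1" using y by (simp add: ennreal_mult[symmetric])
        finally show "ennreal (s y) * (riesz \<beta> x y * g y) = riesz \<beta> x y * f y" by simp
      qed
      finally show ?thesis .
    qed
    have "(\<integral>\<^sup>+y. ennreal_powr (g y) p \<partial>wm s) = (\<integral>\<^sup>+y. ennreal (s y) * ennreal_powr (g y) p \<partial>lebesgue)"
      by (intro nn_integral_wm) measurable
    also have "\<dots> = energy p f"
    proof (intro nn_integral_cong_AE, use dual in eventually_elim)
      fix y assume y: "0 < u y \<and> 0 < s y \<and> u y powr \<theta> * s y powr (1 - \<theta>) = 1"
      have "ennreal (s y) * ennreal_powr (g y) p = (ennreal (s y) * ennreal ((1 / s y) powr p)) * ennreal_powr (f y) p"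
        using y by (simp add: g_def ennreal_powr_mult mult.assoc)
      also have "ennreal (s y) * ennreal ((1 / s y) powr p) = ennreal (s y powr (1 - p))"
        using y by (simp add: ennreal_mult[symmetric] powr_divide powr_diff)
      finally show "ennreal (s y) * ennreal_powr (g y) p = ennreal_powr (f y) p * ennreal (s y powr (1 - p))"
        by (simp add: mult.commute)
    qed
    finally have 2: "(\<integral>\<^sup>+y. ennreal_powr (g y) p \<partial>wm s) = energy p f" .
    have [measurable]: "(\<lambda>x. \<integral>\<^sup>+y. riesz \<beta> x y * f y \<partial>lebesgue) \<in> borel_measurable lebesgue"
      by (rule borel_measurable_riesz_potential) measurable
    have "(\<integral>\<^sup>+x. ennreal_powr (\<integral>\<^sup>+y. riesz \<beta> x y * f y \<partial>lebesgue) q \<partial>wm u)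
      = (\<integral>\<^sup>+x. ennreal (u x) * ennreal_powr (\<integral>\<^sup>+y. riesz \<beta> x y * f y \<partial>lebesgue) q \<partial>lebesgue)"
      by (intro nn_integral_wm) measurable
    then show "(\<integral>\<^sup>+x. ennreal (u x) * ennreal_powr (\<integral>\<^sup>+y. riesz (real CARD('n) * (1 / q + 1 - 1 / p)) x y * f y \<partial>lebesgue) q \<partial>lebesgue)
      \<le> ennreal C * ennreal_powr (energy p f) (q / p)"
      using C(2)[of g] unfolding 1 2 \<beta>_def[symmetric] by simp
  qed
qed

text \<open>Conjugating the fractional integral with \<open>exp (2 * e * \<phi> (b x))\<close> amounts to a change of
  weights within the same class.\<close>

lemma exponential_commutator_strong_type:
  assumes pq: "1 < p" "p < q" "\<theta> * (1 / q + 1 - 1 / p) = 1 / q" and bo: "bounded_oscillation b c M"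
  obtains \<epsilon> where "0 < \<epsilon>" "\<And>e. 0 < e \<Longrightarrow> e \<le> \<epsilon> \<Longrightarrow> \<exists>C>0. \<forall>f \<in> borel_measurable lebesgue.
    (\<integral>\<^sup>+x. ennreal (u x) * ennreal_powr (riesz_exp (real CARD('n) * (1 / q + 1 - 1 / p)) e b f x) q \<partial>lebesgue)
      \<le> ennreal C * ennreal_powr (energy p f) (q / p)"
proof -
  have b [measurable]: "b \<in> borel_measurable lebesgue" using bo by (auto simp: bounded_oscillation_def)
  define \<tau> where "\<tau> = 1 / q + 1 - 1 / p"
  define \<beta> where "\<beta> = real CARD('n) * \<tau>"
  define p' where "p' = p / (p - 1)"
  have "1 / p < 1" "0 < 1 / q" using pq by auto
  then have \<tau>: "0 < \<tau>" unfolding \<tau>_def by linarith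
  have p': "0 < p'" "p' * (1 - 1 / p) = 1" "p' * (p - 1) = p" using pq by (auto simp: p'_def field_simps)
  have "(1 - \<theta>) * \<tau> = \<tau> - \<theta> * \<tau>" by (simp add: left_diff_distrib)
  then have "(1 - \<theta>) * \<tau> = 1 - 1 / p" using pq(3) by (simp add: \<tau>_def)
  moreover have "(1 - \<theta>) * p' * \<tau> = p' * ((1 - \<theta>) * \<tau>)" by (simp only: mult_ac)
  ultimately have "(1 - \<theta>) * p' * \<tau> = 1" using p'(2) by simp
  moreover have "\<theta> * q * \<tau> = 1" using pq by (simp add: \<tau>_def mult.assoc mult.commute[of q]) (simp add: mult.assoc[symmetric])
  \<comment> \<open>Both sides are 1/\<tau>. This is the balance required by
    \<open>exp_perturbation\<close> for the exponents \<open>q\<close> on \<open>u\<close> and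
    \<open>p'\<close> on \<open>s\<close>.\<close>
  ultimately have rel: "\<theta> * q = (1 - \<theta>) * p'" using \<tau> by (metis less_irrefl mult_right_cancel)
  have "0 < q" using pq by simp
  obtain \<epsilon> where \<epsilon>: "0 < \<epsilon>" 
    "\<And>e \<phi>. 0 < e \<Longrightarrow> e \<le> \<epsilon> \<Longrightarrow> \<phi> \<in> borel_measurable borel \<Longrightarrow> (\<And>z w. \<bar>\<phi> z - \<phi> w\<bar> \<le> norm (z - w)) \<Longrightarrow>
      \<exists>K'. muckenhoupt_pair (\<lambda>x. u x * exp (q * e * \<phi> (b x))) (\<lambda>x. s x * exp (- p' * e * \<phi> (b x))) \<theta> K'"
    using exp_perturbation[OF bo \<open>0 < q\<close> p'(1) rel] by blast
  show ?thesis
  \<comment> \<open>The conjugated kernels carry the exponent \<open>2 * e\<close>, which has to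
    stay below \<epsilon>.\<close>
  proof (rule that[of "\<epsilon> / 2"])
    show "0 < \<epsilon> / 2" using \<epsilon>(1) by simp
    fix e assume e: "0 < e" "e \<le> \<epsilon> / 2"
    define A where "A f \<phi> x = ennreal (exp (2 * e * \<phi> (b x))) * (\<integral>\<^sup>+y. riesz \<beta> x y * (ennreal (exp (- (2 * e * \<phi> (b y)))) * f y) \<partial>lebesgue)"
      for f and \<phi> :: "complex \<Rightarrow> real" and x
    have Ameas: "A f \<phi> \<in> borel_measurable lebesgue" 
      if f: "f \<in> borel_measurable lebesgue" and \<phi>: "\<phi> \<in> signed_parts" for f \<phi>
    proof -
      have [measurable]: "\<phi> \<in> borel_measurable borel" "f \<in> borel_measurable lebesgue" using f \<phi> signed_parts(2) by auto
      have [measurable]: "(\<lambda>x. \<integral>\<^sup>+y. riesz \<beta> x y * (ennreal (exp (- (2 * e * \<phi> (b y)))) * f y) \<partial>lebesgue) \<in> borel_measurable lebesgue"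
        by (rule borel_measurable_riesz_potential) measurable
      show ?thesis unfolding A_def by measurable
    qed
    have "\<exists>C>0. \<forall>f\<in>borel_measurable lebesgue. (\<integral>\<^sup>+x. ennreal (u x) * ennreal_powr (A f \<phi> x) q \<partial>lebesgue)
       \<le> ennreal C * ennreal_powr (energy p f) (q / p)"
      if \<phi>S: "\<phi> \<in> signed_parts" for \<phi>
    proof -
      note \<phi> [measurable] = signed_parts(2)[OF \<phi>S]
      obtain K' where "muckenhoupt_pair (\<lambda>x. u x * exp (q * (2 * e) * \<phi> (b x))) (\<lambda>x. s x * exp (- p' * (2 * e) * \<phi> (b x))) \<theta> K'"
        using \<epsilon>(2)[of "2 * e" \<phi>] e \<phi> signed_parts(3)[OF \<phi>S] by auto
      from muckenhoupt_pair.fractional_integral_lebesgue[OF this pq] obtain C where C: "0 < C"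
        "\<And>f. f \<in> borel_measurable lebesgue \<Longrightarrow>
          (\<integral>\<^sup>+x. ennreal (u x * exp (q * (2 * e) * \<phi> (b x))) * ennreal_powr (\<integral>\<^sup>+y. riesz \<beta> x y * f y \<partial>lebesgue) q \<partial>lebesgue)
          \<le> ennreal C * ennreal_powr (\<integral>\<^sup>+y. ennreal_powr (f y) p * ennreal ((s y * exp (- p' * (2 * e) * \<phi> (b y))) powr (1 - p)) \<partial>lebesgue) (q / p)"
        unfolding \<beta>_def \<tau>_def by blast
      show ?thesis
      proof (intro exI[of _ C] conjI C(1) ballI)
        fix f :: "real^'n \<Rightarrow> ennreal" assume [measurable]: "f \<in> borel_measurable lebesgue"
        define g where "g y = ennreal (exp (- (2 * e * \<phi> (b y)))) * f y" for y
        have [measurable]: "g \<in> borel_measurable lebesgue" unfolding g_def by measurable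
        have "(\<integral>\<^sup>+x. ennreal (u x) * ennreal_powr (A f \<phi> x) q \<partial>lebesgue)
          = (\<integral>\<^sup>+x. ennreal (u x * exp (q * (2 * e) * \<phi> (b x))) * ennreal_powr (\<integral>\<^sup>+y. riesz \<beta> x y * g y \<partial>lebesgue) q \<partial>lebesgue)"
        proof (intro nn_integral_cong_AE, use dual in eventually_elim)
          fix x assume x: "0 < u x \<and> 0 < s x \<and> u x powr \<theta> * s x powr (1 - \<theta>) = 1"
          have "exp (2 * e * \<phi> (b x)) powr q = exp (q * (2 * e) * \<phi> (b x))" by (simp add: powr_def mult_ac)
          then show "ennreal (u x) * ennreal_powr (A f \<phi> x) q
            = ennreal (u x * exp (q * (2 * e) * \<phi> (b x))) * ennreal_powr (\<integral>\<^sup>+y. riesz \<beta> x y * g y \<partial>lebesgue) q"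
            using x by (simp add: A_def g_def ennreal_powr_mult ennreal_mult mult.assoc)
        qed
        also have "\<dots> \<le> ennreal C * ennreal_powr (\<integral>\<^sup>+y. ennreal_powr (g y) p * ennreal ((s y * exp (- p' * (2 * e) * \<phi> (b y))) powr (1 - p)) \<partial>lebesgue) (q / p)"
          by (rule C(2)) measurable
        \<comment> \<open>The modulation of \<open>f\<close> and the change of \<open>s\<close>
          cancel because p' (p - 1) = p, so the perturbed energy of \<open>g\<close> is the original
          energy of \<open>f\<close>.\<close>
        also have "(\<integral>\<^sup>+y. ennreal_powr (g y) p * ennreal ((s y * exp (- p' * (2 * e) * \<phi> (b y))) powr (1 - p)) \<partial>lebesgue)
          = energy p f"
        proof (intro nn_integral_cong_AE, use dual in eventually_elim)
          fix y assume y: "0 < u y \<and> 0 < s y \<and> u y powr \<theta> * s y powr (1 - \<theta>) = 1"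
          have "exp (- p' * (2 * e) * \<phi> (b y)) powr (1 - p) = exp (p' * (p - 1) * (2 * e * \<phi> (b y)))"
            by (simp add: powr_def algebra_simps)
          also have "\<dots> = exp (p * (2 * e * \<phi> (b y)))" by (simp add: p'(3))
          finally have "(s y * exp (- p' * (2 * e) * \<phi> (b y))) powr (1 - p) = s y powr (1 - p) * exp (p * (2 * e * \<phi> (b y)))"
            using y by (simp add: powr_mult)
          moreover have "exp (- (2 * e * \<phi> (b y))) powr p = exp (- (p * (2 * e * \<phi> (b y))))" by (simp add: powr_def mult_ac)
          ultimately have "ennreal_powr (g y) p * ennreal ((s y * exp (- p' * (2 * e) * \<phi> (b y))) powr (1 - p))
            = (ennreal (exp (- (p * (2 * e * \<phi> (b y))))) * ennreal (exp (p * (2 * e * \<phi> (b y))))) * (ennreal_powr (f y) p * ennreal (s y powr (1 - p)))"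
            using y by (simp add: g_def ennreal_powr_mult ennreal_mult mult_ac)
          also have "ennreal (exp (- (p * (2 * e * \<phi> (b y))))) * ennreal (exp (p * (2 * e * \<phi> (b y)))) = 1"
            by (simp add: ennreal_mult[symmetric] exp_add[symmetric])
          finally show "ennreal_powr (g y) p * ennreal ((s y * exp (- p' * (2 * e) * \<phi> (b y))) powr (1 - p))
            = ennreal_powr (f y) p * ennreal (s y powr (1 - p))" by simp
        qed
        finally show "(\<integral>\<^sup>+x. ennreal (u x) * ennreal_powr (A f \<phi> x) q \<partial>lebesgue)
          \<le> ennreal C * ennreal_powr (energy p f) (q / p)" .
      qed
    qed
    then have "\<forall>\<phi>\<in>signed_parts. \<exists>C. 0 < C \<and> (\<forall>f\<in>borel_measurable lebesgue. (\<integral>\<^sup>+x. ennreal (u x) * ennreal_powr (A f \<phi> x) q \<partial>lebesgue)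
       \<le> ennreal C * ennreal_powr (energy p f) (q / p))"
      by blast
    from bchoice[OF this] obtain C where C: "\<And>\<phi>. \<phi> \<in> signed_parts \<Longrightarrow> 0 < C \<phi>" "\<And>\<phi> f. \<phi> \<in> signed_parts \<Longrightarrow> f \<in> borel_measurable lebesgue \<Longrightarrow>
       (\<integral>\<^sup>+x. ennreal (u x) * ennreal_powr (A f \<phi> x) q \<partial>lebesgue)
       \<le> ennreal (C \<phi>) * ennreal_powr (energy p f) (q / p)"
      by blast
    define k where "k = real (card signed_parts) powr q"
    have ne: "signed_parts \<noteq> {}" by (simp add: signed_parts_def)
    have k: "0 < k" using ne signed_parts(1) by (simp add: k_def card_gt_0_iff)
    have CC: "0 < (\<Sum>\<phi>\<in>signed_parts. C \<phi>)" using C(1) ne signed_parts(1) by (intro sum_pos) auto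
    show "\<exists>C>0. \<forall>f \<in> borel_measurable lebesgue.
      (\<integral>\<^sup>+x. ennreal (u x) * ennreal_powr (riesz_exp (real CARD('n) * (1 / q + 1 - 1 / p)) e b f x) q \<partial>lebesgue)
      \<le> ennreal C * ennreal_powr (energy p f) (q / p)"
      unfolding \<tau>_def[symmetric] \<beta>_def[symmetric]
    proof (intro exI[of _ "k * (\<Sum>\<phi>\<in>signed_parts. C \<phi>)"] conjI ballI)
      show "0 < k * (\<Sum>\<phi>\<in>signed_parts. C \<phi>)" using k CC by simp
      fix f :: "real^'n \<Rightarrow> ennreal" assume f [measurable]: "f \<in> borel_measurable lebesgue"
      define J where "J = ennreal_powr (energy p f) (q / p)"
      have pt: "riesz_exp \<beta> e b f x \<le> (\<Sum>\<phi>\<in>signed_parts. A f \<phi> x)" for x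
      proof -
        have "(riesz_exp \<beta> e b f x)
          \<le> (\<integral>\<^sup>+y. (\<Sum>\<phi>\<in>signed_parts. ennreal (exp (2 * e * \<phi> (b x))) * (riesz \<beta> x y * (ennreal (exp (- (2 * e * \<phi> (b y)))) * f y))) \<partial>lebesgue)"
        proof (rule nn_integral_mono)
          fix y
          have "ennreal (exp (e * norm (b x - b y))) \<le> ennreal (\<Sum>\<phi>\<in>signed_parts. exp (2 * e * (\<phi> (b x) - \<phi> (b y))))"
            using e by (intro ennreal_leI exp_norm_diff_le) auto
          also have "\<dots> = (\<Sum>\<phi>\<in>signed_parts. ennreal (exp (2 * e * \<phi> (b x))) * ennreal (exp (- (2 * e * \<phi> (b y)))))"
            by (subst sum_ennreal[symmetric]) (auto simp: ennreal_mult[symmetric] exp_add[symmetric] right_diff_distrib)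
          finally have "riesz \<beta> x y * (ennreal (exp (e * norm (b x - b y))) * f y)
            \<le> riesz \<beta> x y * ((\<Sum>\<phi>\<in>signed_parts. ennreal (exp (2 * e * \<phi> (b x))) * ennreal (exp (- (2 * e * \<phi> (b y))))) * f y)"
            by (intro mult_left_mono mult_right_mono) auto
          also have "\<dots> = (\<Sum>\<phi>\<in>signed_parts. ennreal (exp (2 * e * \<phi> (b x))) * (riesz \<beta> x y * (ennreal (exp (- (2 * e * \<phi> (b y)))) * f y)))"
            by (simp only: sum_distrib_left sum_distrib_right mult_ac)
          finally show "riesz \<beta> x y * (ennreal (exp (e * norm (b x - b y))) * f y)
            \<le> (\<Sum>\<phi>\<in>signed_parts. ennreal (exp (2 * e * \<phi> (b x))) * (riesz \<beta> x y * (ennreal (exp (- (2 * e * \<phi> (b y)))) * f y)))" .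
        qed
        also have "\<dots> = (\<Sum>\<phi>\<in>signed_parts. (\<integral>\<^sup>+y. ennreal (exp (2 * e * \<phi> (b x))) * (riesz \<beta> x y * (ennreal (exp (- (2 * e * \<phi> (b y)))) * f y)) \<partial>lebesgue))"
        proof (rule nn_integral_sum)
          fix \<phi> assume "\<phi> \<in> signed_parts"
          then have [measurable]: "\<phi> \<in> borel_measurable borel" by (rule signed_parts(2))
          show "(\<lambda>y. ennreal (exp (2 * e * \<phi> (b x))) * (riesz \<beta> x y * (ennreal (exp (- (2 * e * \<phi> (b y)))) * f y))) \<in> borel_measurable lebesgue"
            by measurable
        qed
        also have "\<dots> = (\<Sum>\<phi>\<in>signed_parts. A f \<phi> x)"
        proof (intro sum.cong refl)
          fix \<phi> assume "\<phi> \<in> signed_parts"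
          then have [measurable]: "\<phi> \<in> borel_measurable borel" by (rule signed_parts(2))
          show "(\<integral>\<^sup>+y. ennreal (exp (2 * e * \<phi> (b x))) * (riesz \<beta> x y * (ennreal (exp (- (2 * e * \<phi> (b y)))) * f y)) \<partial>lebesgue) = A f \<phi> x"
            unfolding A_def by (rule nn_integral_cmult) measurable
        qed
        finally show ?thesis .
      qed
      have "(\<integral>\<^sup>+x. ennreal (u x) * ennreal_powr (riesz_exp \<beta> e b f x) q \<partial>lebesgue)
        \<le> (\<integral>\<^sup>+x. ennreal k * (\<Sum>\<phi>\<in>signed_parts. ennreal (u x) * ennreal_powr (A f \<phi> x) q) \<partial>lebesgue)"
      proof (rule nn_integral_mono)
        fix x
        have "ennreal_powr (riesz_exp \<beta> e b f x) q
          \<le> ennreal_powr (\<Sum>\<phi>\<in>signed_parts. A f \<phi> x) q"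
          using \<open>0 < q\<close> by (intro ennreal_powr_mono pt) auto
        also have "\<dots> \<le> ennreal k * (\<Sum>\<phi>\<in>signed_parts. ennreal_powr (A f \<phi> x) q)"
          unfolding k_def using \<open>0 < q\<close> signed_parts(1) by (intro ennreal_powr_sum_le) auto
        finally have "ennreal (u x) * ennreal_powr (riesz_exp \<beta> e b f x) q
          \<le> ennreal (u x) * (ennreal k * (\<Sum>\<phi>\<in>signed_parts. ennreal_powr (A f \<phi> x) q))" by (rule mult_left_mono) simp
        also have "\<dots> = ennreal k * (\<Sum>\<phi>\<in>signed_parts. ennreal (u x) * ennreal_powr (A f \<phi> x) q)"
          by (simp only: sum_distrib_left mult_ac)
        finally show "ennreal (u x) * ennreal_powr (riesz_exp \<beta> e b f x) q
          \<le> ennreal k * (\<Sum>\<phi>\<in>signed_parts. ennreal (u x) * ennreal_powr (A f \<phi> x) q)" .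
      qed
      also have "\<dots> = ennreal k * (\<Sum>\<phi>\<in>signed_parts. (\<integral>\<^sup>+x. ennreal (u x) * ennreal_powr (A f \<phi> x) q \<partial>lebesgue))"
        using Ameas[OF f] by (subst nn_integral_cmult) (auto intro!: borel_measurable_sum borel_measurable_times_ennreal measurable_ennreal_powr simp: nn_integral_sum)
      also have "\<dots> \<le> ennreal k * (\<Sum>\<phi>\<in>signed_parts. ennreal (C \<phi>) * J)"
        unfolding J_def by (intro mult_left_mono sum_mono C(2) f) auto
      also have "\<dots> = ennreal k * (ennreal (\<Sum>\<phi>\<in>signed_parts. C \<phi>) * J)"
        using C(1) by (simp add: sum_distrib_right[symmetric] sum_ennreal less_imp_le)
      also have "\<dots> = ennreal (k * (\<Sum>\<phi>\<in>signed_parts. C \<phi>)) * J"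
        using k CC by (simp add: ennreal_mult mult.assoc)
      finally show "(\<integral>\<^sup>+x. ennreal (u x) * ennreal_powr (riesz_exp \<beta> e b f x) q \<partial>lebesgue)
        \<le> ennreal (k * (\<Sum>\<phi>\<in>signed_parts. C \<phi>)) * J" .
    qed
  qed
qed

end

section \<open>The contribution from far away\<close>

context muckenhoupt_pair
begin

text \<open>Hoelder after inserting s^((1-p)/p) with \<open>f\<close> and the inverse power
  s^(1-1/p) with \<open>g\<close>. It will be applied with \<open>g\<close> the exponential factor,
  whose integral against \<open>s\<close> John--Nirenberg controls.\<close>

lemma nn_integral_Holder_dual_weight:
  assumes [measurable]: "f \<in> borel_measurable lebesgue" "g \<in> borel_measurable lebesgue" "A \<in> sets lebesgue" and "1 < p"
  shows "(\<integral>\<^sup>+y\<in>A. g y * f y \<partial>lebesgue)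
    \<le> ennreal_powr (energy_on A p f) (1 / p)
      * ennreal_powr (\<integral>\<^sup>+y\<in>A. ennreal_powr (g y) (p / (p - 1)) \<partial>wm s) (1 - 1 / p)"
proof -
  let ?F = "\<lambda>y. ennreal_powr (f y) p * ennreal (s y powr (1 - p)) * indicator A y"
  let ?G = "\<lambda>y. ennreal (s y) * (ennreal_powr (g y) (p / (p - 1)) * indicator A y)"
  have p: "0 < 1 / p" "1 / p < 1" "p * (1 - 1 / p) / (p - 1) = 1" using assms(4) by (auto simp: field_simps)
  have "(\<integral>\<^sup>+y\<in>A. g y * f y \<partial>lebesgue) = (\<integral>\<^sup>+y. ennreal_powr (?F y) (1 / p) * ennreal_powr (?G y) (1 - 1 / p) \<partial>lebesgue)"
  proof (intro nn_integral_cong_AE, use dual in eventually_elim)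
    fix y assume y: "0 < u y \<and> 0 < s y \<and> u y powr \<theta> * s y powr (1 - \<theta>) = 1"
    have "(s y powr (1 - p)) powr (1 / p) * s y powr (1 - 1 / p) = s y powr ((1 - p) * (1 / p) + (1 - 1 / p))"
      by (simp only: powr_powr powr_add)
    also have "(1 - p) * (1 / p) + (1 - 1 / p) = 0" using assms(4) by (simp add: field_simps)
    finally have "ennreal ((s y powr (1 - p)) powr (1 / p)) * ennreal (s y powr (1 - 1 / p)) = 1"
      using y by (simp add: ennreal_mult[symmetric])
    then have "f y * ennreal ((s y powr (1 - p)) powr (1 / p)) * (ennreal (s y powr (1 - 1 / p)) * g y) = g y * f y"
      by (metis (no_types, lifting) mult.assoc mult.commute mult_1)
    then show "g y * f y * indicator A y = ennreal_powr (?F y) (1 / p) * ennreal_powr (?G y) (1 - 1 / p)"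
      using y assms(4) by (cases "y \<in> A") (simp_all add: ennreal_powr_mult ennreal_powr_powr p(3))
  qed
  also have "\<dots> \<le> ennreal_powr (\<integral>\<^sup>+y. ?F y \<partial>lebesgue) (1 / p) * ennreal_powr (\<integral>\<^sup>+y. ?G y \<partial>lebesgue) (1 - 1 / p)"
    by (intro nn_integral_Holder p) measurable
  also have "(\<integral>\<^sup>+y. ?G y \<partial>lebesgue) = (\<integral>\<^sup>+y\<in>A. ennreal_powr (g y) (p / (p - 1)) \<partial>wm s)"
    by (intro nn_integral_wm[symmetric]) measurable
  finally show ?thesis .
qed

end

text \<open>Telescoping over successive doublings. The growth is linear in \<open>j\<close>, so
  after exponentiation it is geometric with a ratio close to 1 for small \<open>e\<close>.\<close>

lemma bounded_oscillation_centre_dyadic: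
  fixes x :: "real^'n"
  assumes bo: "bounded_oscillation b c M" and "0 < r"
  shows "norm (c x r - c x (2 ^ j * r)) \<le> real j * (M / unit_ball_vol (real CARD('n)) * (1 + 2 ^ CARD('n)))"
proof (induction j)
  case (Suc j)
  have "norm (c x (2 ^ j * r) - c x (2 * (2 ^ j * r))) \<le> M / unit_ball_vol (real CARD('n)) * (1 + 2 ^ CARD('n))"
    using assms(2) by (intro bounded_oscillation_centre_diff[OF bo] subset_ball) auto
  moreover have "norm (c x r - c x (2 ^ Suc j * r)) \<le> norm (c x r - c x (2 ^ j * r)) + norm (c x (2 ^ j * r) - c x (2 * (2 ^ j * r)))"
    using norm_triangle_ineq[of "c x r - c x (2 ^ j * r)" "c x (2 ^ j * r) - c x (2 * (2 ^ j * r))"] by (simp add: mult.assoc)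
  ultimately have "norm (c x r - c x (2 ^ Suc j * r)) \<le> (real j + 1) * (M / unit_ball_vol (real CARD('n)) * (1 + 2 ^ CARD('n)))"
    using Suc.IH unfolding distrib_right[of "real j" 1] by linarith
  then show ?case by (simp only: of_nat_Suc add.commute)
qed simp

context muckenhoupt_pair
begin

text \<open>On the ball of radius 2^j r the Morrey bound and John--Nirenberg for \<open>s\<close>
  produce u(B) powr (k/p - 1/q). This exponent is negative since k < p/q, so reverse doubling yields
  decay in \<open>j\<close>. The dependence on \<open>x\<close> is confined to one exponential
  factor, left for a later integration.\<close>

lemma commutator_tail:
  assumes pq: "1 < p" "p < q" "\<theta> * (1 / q + 1 - 1 / p) = 1 / q" and k: "0 < k" "k < p / q" and bo: "bounded_oscillation b c M"
  obtains \<epsilon> where "0 < \<epsilon>" "\<And>e. 0 < e \<Longrightarrow> e \<le> \<epsilon> \<Longrightarrow> \<exists>C>0. \<forall>f L x0 r x. f \<in> borel_measurable lebesgue \<longrightarrow> 0 \<le> L \<longrightarrow>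
    (\<forall>x r. 0 < r \<longrightarrow> energy_on (ball x r) p f \<le> ennreal (L * ub x r powr k)) \<longrightarrow>
    0 < r \<longrightarrow> x \<in> ball x0 r \<longrightarrow>
    (\<integral>\<^sup>+y\<in>- ball x0 (2 * r). riesz (real CARD('n) * (1 / q + 1 - 1 / p)) x y * (ennreal (exp (e * norm (b x - b y))) * f y) \<partial>lebesgue)
      \<le> ennreal (C * L powr (1 / p) * ub x0 r powr (k / p - 1 / q) * exp (e * norm (b x - c x0 r)))"
proof -
  have b [measurable]: "b \<in> borel_measurable lebesgue" and M: "0 < M" using bo by (auto simp: bounded_oscillation_def)
  define \<tau> where "\<tau> = 1 / q + 1 - 1 / p"
  define \<beta> where "\<beta> = real CARD('n) * \<tau>"
  define p' where "p' = p / (p - 1)"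
  have p': "0 < p'" using pq by (simp add: p'_def)
  have "1 / p < 1" "0 < 1 / q" using pq by auto
  then have "0 < \<tau>" unfolding \<tau>_def by linarith
  then have \<beta>: "0 \<le> \<beta>" by (simp add: \<beta>_def)
  define \<kappa> where "\<kappa> = 1 / q - k / p"
  have \<kappa>: "0 < \<kappa>" using pq k by (simp add: \<kappa>_def field_simps)
  obtain \<rho> where \<rho>: "0 < \<rho>" "\<rho> < 1" "\<forall>x r. 0 < r \<longrightarrow> ub x r \<le> \<rho> * ub x (2 * r)"
    using wm_reverse_doubling by blast
  note geo = wm_ball_geometric[OF \<rho>(3,1)]
  \<comment> \<open>Reverse doubling gives decay \<zeta>^(2j). One factor \<zeta>^j pays for the
    drift of the centres and the other makes the series converge.\<close>
  define \<zeta> where "\<zeta> = \<rho> powr (\<kappa> / 2)"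
  have \<zeta>: "0 < \<zeta>" "\<zeta> < 1" using \<rho>(1,2) \<kappa> powr_less_mono2[of "\<kappa> / 2" \<rho> 1] by (auto simp: \<zeta>_def)
  define \<delta> where "\<delta> = M / unit_ball_vol (real CARD('n)) * (1 + 2 ^ CARD('n))"
  have \<delta>: "0 < \<delta>" unfolding \<delta>_def using M by (intro mult_pos_pos) (auto simp: add_pos_pos)
  obtain \<epsilon>2 C2 where 2: "0 < \<epsilon>2" "0 < C2"
    "\<And>x r e. 0 < r \<Longrightarrow> e \<le> \<epsilon>2 \<Longrightarrow> 
      (\<integral>\<^sup>+y\<in>ball x r. ennreal (exp (e * norm (b y - c x r))) \<partial>wm s) \<le> ennreal C2 * emeasure (wm s) (ball x r)"
    using muckenhoupt_pair.John_Nirenberg[OF swap bo] by blast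
  \<comment> \<open>The first bound makes the p'-th power of the exponential integrable against
    \<open>s\<close>; the second gives exp(e \<delta>) \<le> 1/\<zeta>, one unit of drift per
    doubling.\<close>
  define \<epsilon> where "\<epsilon> = min (\<epsilon>2 / p') (ln (1 / \<zeta>) / \<delta>)"
  have \<epsilon>: "0 < \<epsilon>" using 2 p' \<delta> \<zeta> by (simp add: \<epsilon>_def)
  show ?thesis
  proof (rule that[OF \<epsilon>])
    fix e assume e: "0 < e" "e \<le> \<epsilon>"
    have e2: "e * p' \<le> \<epsilon>2" and e3: "e * \<delta> \<le> ln (1 / \<zeta>)"
      using e(2) p' \<delta> by (auto simp: \<epsilon>_def field_simps)
    have "exp (e * \<delta>) \<le> exp (ln (1 / \<zeta>))" using e3 by (simp only: exp_le_cancel_iff)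
    then have e4: "exp (e * \<delta>) \<le> 1 / \<zeta>" using \<zeta> by simp
    define A where "A = C2 powr (1 - 1 / p) * K powr \<tau>"
    have A: "0 < A" using 2 K_pos by (simp add: A_def)
    \<comment> \<open>One factor \<open>2 powr \<beta>\<close> comes from replacing \<open>x\<close>
      by \<open>x0\<close> in the kernel, the other from the dyadic shells.\<close>
    define C where "C = 2 powr \<beta> * (2 powr \<beta> * (A * (1 / (1 - \<zeta>))))"
    have C: "0 < C" using A \<zeta> by (simp add: C_def)
    show "\<exists>C>0. \<forall>f L x0 r x. f \<in> borel_measurable lebesgue \<longrightarrow> 0 \<le> L \<longrightarrow>
    (\<forall>x r. 0 < r \<longrightarrow> energy_on (ball x r) p f \<le> ennreal (L * ub x r powr k)) \<longrightarrow>
    0 < r \<longrightarrow> x \<in> ball x0 r \<longrightarrow>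
    (\<integral>\<^sup>+y\<in>- ball x0 (2 * r). riesz (real CARD('n) * (1 / q + 1 - 1 / p)) x y * (ennreal (exp (e * norm (b x - b y))) * f y) \<partial>lebesgue)
      \<le> ennreal (C * L powr (1 / p) * ub x0 r powr (k / p - 1 / q) * exp (e * norm (b x - c x0 r)))"
    unfolding \<tau>_def[symmetric] \<beta>_def[symmetric]
    proof (intro exI[of _ C] conjI C allI impI)
      fix f :: "real^'n \<Rightarrow> ennreal" and L r and x0 x :: "real^'n"
      assume [measurable]: "f \<in> borel_measurable lebesgue" and L: "0 \<le> L" and r: "0 < r" and x: "x \<in> ball x0 r"
        and mor: "\<forall>x r. 0 < r \<longrightarrow> energy_on (ball x r) p f \<le> ennreal (L * ub x r powr k)"
      define c0 where "c0 = c x0 r"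
      define U where "U t = ub x0 t" for t
      define S where "S t = sb x0 t" for t
      have US: "0 < U t" "0 < S t" if "0 < t" for t
        using wm_ball_pos[OF that, of x0] wm_s_pos[OF that, of x0] by (auto simp: U_def S_def)
      define g where "g y = ennreal (exp (e * norm (b y - c0))) * f y" for y
      have [measurable]: "g \<in> borel_measurable lebesgue" unfolding g_def by measurable
      have term_le: "ennreal (t powr - \<beta>) * (\<integral>\<^sup>+y\<in>ball x0 t. g y \<partial>lebesgue) \<le> ennreal (A * L powr (1 / p) * U r powr - \<kappa>) * ennreal (\<zeta> ^ i)"
        if t: "t = 2 ^ Suc i * (2 * r)" for t i
      proof -
        \<comment> \<open>The far shells of the ball of radius \<open>2 * r\<close> start at radius
          \<open>4 * r\<close>, hence the shift by two.\<close>
        define j where "j = Suc (Suc i)"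
        have tj: "t = 2 ^ j * r" "0 < t" using t r by (auto simp: j_def)
        define G where "G y = ennreal (exp (e * norm (b y - c x0 t)))" for y
        have [measurable]: "G \<in> borel_measurable lebesgue" unfolding G_def by measurable
        have [measurable]: "ball x0 t \<in> sets lebesgue" by simp
        have "(\<integral>\<^sup>+y\<in>ball x0 t. g y \<partial>lebesgue) \<le> (\<integral>\<^sup>+y. ennreal (exp (e * \<delta>) ^ j) * (G y * f y * indicator (ball x0 t) y) \<partial>lebesgue)"
        proof (rule nn_integral_mono)
          fix y
          have "norm (b y - c0) \<le> norm (b y - c x0 t) + norm (c x0 r - c x0 t)"
            using norm_triangle_ineq4[of "b y - c x0 t" "c x0 r - c x0 t"] by (simp add: c0_def)
          also have "norm (c x0 r - c x0 t) \<le> real j * \<delta>"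
            unfolding tj(1) \<delta>_def by (rule bounded_oscillation_centre_dyadic[OF bo r])
          finally have "e * norm (b y - c0) \<le> real j * (e * \<delta>) + e * norm (b y - c x0 t)"
            using mult_left_mono[of "norm (b y - c0)" "norm (b y - c x0 t) + real j * \<delta>" e] e by (simp add: algebra_simps)
          then have "exp (e * norm (b y - c0)) \<le> exp (e * \<delta>) ^ j * exp (e * norm (b y - c x0 t))"
            by (simp add: exp_add[symmetric] exp_of_nat_mult[symmetric])
          then have "ennreal (exp (e * norm (b y - c0))) \<le> ennreal (exp (e * \<delta>) ^ j) * G y"
            by (simp add: G_def ennreal_mult[symmetric] ennreal_leI)
          then show "g y * indicator (ball x0 t) y \<le> ennreal (exp (e * \<delta>) ^ j) * (G y * f y * indicator (ball x0 t) y)"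
            unfolding g_def mult.assoc[symmetric] by (intro mult_right_mono) auto
        qed
        also have "\<dots> = ennreal (exp (e * \<delta>) ^ j) * (\<integral>\<^sup>+y\<in>ball x0 t. G y * f y \<partial>lebesgue)"
          by (rule nn_integral_cmult) measurable
        also have "(\<integral>\<^sup>+y\<in>ball x0 t. G y * f y \<partial>lebesgue) 
          \<le> ennreal_powr (energy_on (ball x0 t) p f) (1 / p)
            * ennreal_powr (\<integral>\<^sup>+y\<in>ball x0 t. ennreal_powr (G y) p' \<partial>wm s) (1 - 1 / p)"
          unfolding p'_def using pq by (intro nn_integral_Holder_dual_weight) auto
        also have "\<dots> \<le> ennreal_powr (ennreal (L * U t powr k)) (1 / p) * ennreal_powr (ennreal (C2 * S t)) (1 - 1 / p)"
        proof (intro mult_mono ennreal_powr_mono)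
          show "energy_on (ball x0 t) p f \<le> ennreal (L * U t powr k)"
            using mor tj(2) by (simp add: U_def)
          have "ennreal_powr (G y) p' = ennreal (exp (e * p' * norm (b y - c x0 t)))" for y
            by (simp add: G_def powr_def mult_ac)
          then show "(\<integral>\<^sup>+y\<in>ball x0 t. ennreal_powr (G y) p' \<partial>wm s) \<le> ennreal (C2 * S t)"
            using 2(3)[OF tj(2) e2, of x0] 2(2) by (simp add: S_def emeasure_wm_ball ennreal_mult)
        qed (use pq in auto)
        also have "\<dots> = ennreal (L powr (1 / p) * U t powr (k / p) * (C2 powr (1 - 1 / p) * S t powr (1 - 1 / p)))"
          using L 2(2) US[OF tj(2)] by (simp add: powr_mult powr_powr ennreal_mult[symmetric])
        finally have I: "(\<integral>\<^sup>+y\<in>ball x0 t. g y \<partial>lebesgue) \<le> ennreal (exp (e * \<delta>) ^ j) * ennreal (L powr (1 / p) * U t powr (k / p) * (C2 powr (1 - 1 / p) * S t powr (1 - 1 / p)))"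
          by (simp add: mult_left_mono)
        have "ennreal (t powr - \<beta>) * (\<integral>\<^sup>+y\<in>ball x0 t. g y \<partial>lebesgue)
          \<le> ennreal (t powr - \<beta>) * (ennreal (exp (e * \<delta>) ^ j) * ennreal (L powr (1 / p) * U t powr (k / p) * (C2 powr (1 - 1 / p) * S t powr (1 - 1 / p))))"
          by (intro mult_left_mono I) simp
        also have "\<dots> = ennreal (exp (e * \<delta>) ^ j * (L powr (1 / p) * U t powr (k / p) * C2 powr (1 - 1 / p)) * (t powr - \<beta> * S t powr (1 - 1 / p)))"
          by (simp add: ennreal_mult[symmetric] mult_ac)
        also have "\<dots> \<le> ennreal ((1 / \<zeta>) ^ j * (L powr (1 / p) * U t powr (k / p) * C2 powr (1 - 1 / p)) * (K powr \<tau> * U t powr - (1 / q)))"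
        proof (intro ennreal_leI mult_mono[OF mult_right_mono])
          show "exp (e * \<delta>) ^ j \<le> (1 / \<zeta>) ^ j" using e4 by (intro power_mono) auto
          show "t powr - \<beta> * S t powr (1 - 1 / p) \<le> K powr \<tau> * U t powr - (1 / q)"
            using ball_cond_powr[OF _ _ pq(3) tj(2), of x0] pq by (simp add: \<beta>_def \<tau>_def U_def S_def)
        qed (use \<zeta> in auto)
        also have "(1 / \<zeta>) ^ j * (L powr (1 / p) * U t powr (k / p) * C2 powr (1 - 1 / p)) * (K powr \<tau> * U t powr - (1 / q))
          = A * L powr (1 / p) * ((1 / \<zeta>) ^ j * U t powr - \<kappa>)"
          using powr_add[of "U t" "k / p" "- (1 / q)"] by (simp add: A_def \<kappa>_def mult_ac)
        also have "(1 / \<zeta>) ^ j * U t powr - \<kappa> \<le> (1 / \<zeta>) ^ j * ((\<zeta> ^ j * \<zeta> ^ j) * U r powr - \<kappa>)"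
        proof (intro mult_left_mono)
          have "U r \<le> \<rho> ^ j * U t" using geo[OF r, of x0 j] by (simp add: U_def tj(1))
          then have "U r powr \<kappa> \<le> (\<rho> ^ j * U t) powr \<kappa>" using US[OF r] \<kappa> by (intro powr_mono2) auto
          also have "\<dots> = \<rho> powr (\<kappa> * real j) * U t powr \<kappa>"
            using \<rho>(1) US[OF tj(2)] by (simp add: powr_mult powr_powr mult.commute flip: powr_realpow)
          also have "\<rho> powr (\<kappa> * real j) = \<zeta> ^ j * \<zeta> ^ j"
            using \<rho>(1) by (simp add: \<zeta>_def powr_powr powr_add[symmetric] flip: powr_realpow)
          finally show "U t powr - \<kappa> \<le> \<zeta> ^ j * \<zeta> ^ j * U r powr - \<kappa>"
            using inverse_mult_le_flip[of "U r powr \<kappa>" 1 "\<zeta> ^ j * \<zeta> ^ j" "U t powr \<kappa>"] US[OF r] US[OF tj(2)] by (simp add: powr_minus)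
        qed (use \<zeta> in auto)
        also have "(1 / \<zeta>) ^ j * ((\<zeta> ^ j * \<zeta> ^ j) * U r powr - \<kappa>) = \<zeta> ^ j * U r powr - \<kappa>"
          using \<zeta> by (simp add: power_divide)
        also have "\<dots> \<le> \<zeta> ^ i * U r powr - \<kappa>"
          using \<zeta> by (intro mult_right_mono power_decreasing) (auto simp: j_def)
        finally have "ennreal (t powr - \<beta>) * (\<integral>\<^sup>+y\<in>ball x0 t. g y \<partial>lebesgue) \<le> ennreal (A * L powr (1 / p) * (\<zeta> ^ i * U r powr - \<kappa>))"
          using A by (simp add: mult_left_mono ennreal_leI)
        also have "\<dots> = ennreal (A * L powr (1 / p) * U r powr - \<kappa>) * ennreal (\<zeta> ^ i)"
          using A \<zeta> by (simp add: ennreal_mult[symmetric] mult_ac)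
        finally show ?thesis .
      qed
      have pt: "riesz \<beta> x y * (ennreal (exp (e * norm (b x - b y))) * f y) * indicator (- ball x0 (2 * r)) y
        \<le> ennreal (2 powr \<beta> * exp (e * norm (b x - c0))) * (ennreal (norm (x0 - y) powr - \<beta>) * g y * indicator (- ball x0 (2 * r)) y)" for y
      proof (cases "y \<in> ball x0 (2 * r)")
        case False
        \<comment> \<open>As |x0 - y| is at least 2 r, subtracting r removes at most half of it, so
          the kernel at \<open>x\<close> is comparable with the kernel at \<open>x0\<close>.\<close>
        have "norm (x0 - y) \<le> norm (x - y) + r" using x norm_triangle_ineq[of "x0 - x" "x - y"] by (simp add: dist_norm)
        then have "norm (x0 - y) / 2 \<le> norm (x - y)" using False by (simp add: dist_norm)
        moreover have "0 < norm (x0 - y) / 2" using False r by (auto simp: dist_norm not_less)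
        ultimately have "norm (x - y) powr - \<beta> \<le> (norm (x0 - y) / 2) powr - \<beta>" using \<beta> by (intro powr_mono2') auto
        also have "\<dots> = 2 powr \<beta> * norm (x0 - y) powr - \<beta>"
          by (subst powr_divide) (auto simp: powr_minus divide_inverse)
        finally have 1: "norm (x - y) powr - \<beta> \<le> 2 powr \<beta> * norm (x0 - y) powr - \<beta>" .
        have "norm (b x - b y) \<le> norm (b x - c0) + norm (b y - c0)"
          using norm_triangle_ineq4[of "b x - c0" "b y - c0"] by simp
        then have "exp (e * norm (b x - b y)) \<le> exp (e * norm (b x - c0)) * exp (e * norm (b y - c0))"
          using e by (simp add: exp_add[symmetric] distrib_left[symmetric])
        then have "norm (x - y) powr - \<beta> * exp (e * norm (b x - b y)) \<le> (2 powr \<beta> * norm (x0 - y) powr - \<beta>) * (exp (e * norm (b x - c0)) * exp (e * norm (b y - c0)))"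
          using 1 by (intro mult_mono) auto
        then have "ennreal (norm (x - y) powr - \<beta> * exp (e * norm (b x - b y))) * f y
          \<le> ennreal ((2 powr \<beta> * norm (x0 - y) powr - \<beta>) * (exp (e * norm (b x - c0)) * exp (e * norm (b y - c0)))) * f y"
          by (intro mult_right_mono ennreal_leI) auto
        then show ?thesis using False
          by (simp add: riesz_def g_def ennreal_mult mult_ac)
      qed simp
      have "(\<integral>\<^sup>+y\<in>- ball x0 (2 * r). riesz \<beta> x y * (ennreal (exp (e * norm (b x - b y))) * f y) \<partial>lebesgue)
        \<le> (\<integral>\<^sup>+y. ennreal (2 powr \<beta> * exp (e * norm (b x - c0))) * (ennreal (norm (x0 - y) powr - \<beta>) * g y * indicator (- ball x0 (2 * r)) y) \<partial>lebesgue)"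
        by (intro nn_integral_mono pt)
      also have "\<dots> = ennreal (2 powr \<beta> * exp (e * norm (b x - c0))) * (\<integral>\<^sup>+y\<in>- ball x0 (2 * r). ennreal (norm (x0 - y) powr - \<beta>) * g y \<partial>lebesgue)"
      proof (rule nn_integral_cmult)
        have [measurable]: "(\<lambda>y. ennreal (norm (x0 - y) powr - \<beta>)) \<in> borel_measurable lebesgue" by (rule measurable_riesz_kernel)
        have [measurable]: "ball x0 (2 * r) \<in> sets lebesgue" by simp
        show "(\<lambda>y. ennreal (norm (x0 - y) powr - \<beta>) * g y * indicator (- ball x0 (2 * r)) y) \<in> borel_measurable lebesgue" by measurable
      qed
      also have "(\<integral>\<^sup>+y\<in>- ball x0 (2 * r). ennreal (norm (x0 - y) powr - \<beta>) * g y \<partial>lebesgue)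
        \<le> ennreal (2 powr \<beta>) * (\<Sum>i. ennreal ((2 ^ Suc i * (2 * r)) powr - \<beta>) * (\<integral>\<^sup>+y\<in>ball x0 (2 ^ Suc i * (2 * r)). g y \<partial>lebesgue))"
        using r \<beta> by (intro riesz_far) auto
      also have "\<dots> \<le> ennreal (2 powr \<beta>) * (\<Sum>i. ennreal (A * L powr (1 / p) * U r powr - \<kappa>) * ennreal (\<zeta> ^ i))"
        by (intro mult_left_mono suminf_le summableI term_le refl) auto
      also have "\<dots> = ennreal (2 powr \<beta>) * (ennreal (A * L powr (1 / p) * U r powr - \<kappa>) * ennreal (1 / (1 - \<zeta>)))"
        using \<zeta> by (subst suminf_geometric_ennreal) auto
      also have "\<dots> = ennreal (2 powr \<beta> * (A * L powr (1 / p) * U r powr - \<kappa> * (1 / (1 - \<zeta>))))"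
        using A \<zeta> by (simp add: ennreal_mult[symmetric])
      also have "ennreal (2 powr \<beta> * exp (e * norm (b x - c0))) * \<dots> = ennreal (C * L powr (1 / p) * U r powr - \<kappa> * exp (e * norm (b x - c0)))"
        unfolding C_def using A \<zeta> by (simp add: ennreal_mult[symmetric] mult_ac)
      finally show "(\<integral>\<^sup>+y\<in>- ball x0 (2 * r). riesz \<beta> x y * (ennreal (exp (e * norm (b x - b y))) * f y) \<partial>lebesgue)
        \<le> ennreal (C * L powr (1 / p) * ub x0 r powr (k / p - 1 / q) * exp (e * norm (b x - c x0 r)))"
        by (simp add: mult_left_mono U_def c0_def \<kappa>_def)
    qed
  qed
qed

end

section \<open>The Morrey estimate for the exponential kernel\<close>

context muckenhoupt_pair
begin

text \<open>Here \<open>L\<close> stands for the p-th power of the Morrey norm. The function is cut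
  at the doubled ball: the global bound and doubling handle the inner part, the tail estimate the
  outer one, whose remaining exponential is integrated against \<open>u\<close> by
  John--Nirenberg.\<close>

proposition exponential_commutator_Morrey:
  assumes pq: "1 < p" "p < q" "\<theta> * (1 / q + 1 - 1 / p) = 1 / q" and k: "0 < k" "k < p / q" and bo: "bounded_oscillation b c M"
  obtains e C where "0 < e" "0 < C" "\<And>f L x0 r. f \<in> borel_measurable lebesgue \<Longrightarrow> 0 \<le> L \<Longrightarrow>
    (\<And>x r. 0 < r \<Longrightarrow> energy_on (ball x r) p f \<le> ennreal (L * ub x r powr k)) \<Longrightarrow>
    0 < r \<Longrightarrow>
    (\<integral>\<^sup>+x\<in>ball x0 r. ennreal (u x) * ennreal_powr (riesz_exp (real CARD('n) * (1 / q + 1 - 1 / p)) e b f x) q \<partial>lebesgue)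
      \<le> ennreal (C * L powr (q / p) * ub x0 r powr (q * k / p))"
proof -
  have b [measurable]: "b \<in> borel_measurable lebesgue" and M: "0 < M" using bo by (auto simp: bounded_oscillation_def)
  define \<beta> where "\<beta> = real CARD('n) * (1 / q + 1 - 1 / p)"
  have q: "0 < q" using pq by simp
  obtain \<epsilon>1 where \<epsilon>1: "0 < \<epsilon>1" "\<And>e. 0 < e \<Longrightarrow> e \<le> \<epsilon>1 \<Longrightarrow> \<exists>C>0. \<forall>f \<in> borel_measurable lebesgue.
    (\<integral>\<^sup>+x. ennreal (u x) * ennreal_powr (riesz_exp \<beta> e b f x) q \<partial>lebesgue)
      \<le> ennreal C * ennreal_powr (energy p f) (q / p)"
    using exponential_commutator_strong_type[OF pq bo] unfolding \<beta>_def by blast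
  obtain \<epsilon>2 where \<epsilon>2: "0 < \<epsilon>2" "\<And>e. 0 < e \<Longrightarrow> e \<le> \<epsilon>2 \<Longrightarrow> \<exists>C>0. \<forall>f L x0 r x. f \<in> borel_measurable lebesgue \<longrightarrow> 0 \<le> L \<longrightarrow>
    (\<forall>x r. 0 < r \<longrightarrow> energy_on (ball x r) p f \<le> ennreal (L * ub x r powr k)) \<longrightarrow>
    0 < r \<longrightarrow> x \<in> ball x0 r \<longrightarrow>
    (\<integral>\<^sup>+y\<in>- ball x0 (2 * r). riesz \<beta> x y * (ennreal (exp (e * norm (b x - b y))) * f y) \<partial>lebesgue)
      \<le> ennreal (C * L powr (1 / p) * ub x0 r powr (k / p - 1 / q) * exp (e * norm (b x - c x0 r)))"
    using commutator_tail[OF pq k bo] unfolding \<beta>_def by blast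
  obtain \<epsilon>3 C3 where 3: "0 < \<epsilon>3" "0 < C3"
    "\<And>x r e. 0 < r \<Longrightarrow> e \<le> \<epsilon>3 \<Longrightarrow> 
      (\<integral>\<^sup>+y\<in>ball x r. ennreal (exp (e * norm (b y - c x r))) \<partial>wm u) \<le> ennreal C3 * emeasure (wm u) (ball x r)"
    using John_Nirenberg[OF bo] by blast
  obtain D where D: "0 < D" "\<And>x z r. 0 < r \<Longrightarrow> ball x r \<subseteq> ball z (2 * r) \<Longrightarrow>
    ub z (2 * r) \<le> D * ub x r"
    using wm_doubling[of 2] by auto
  \<comment> \<open>A single exponent for both parts; the last bound is divided by \<open>q\<close>
    because the tail estimate is raised to the power \<open>q\<close> before integration.\<close>
  define e where "e = min (min \<epsilon>1 \<epsilon>2) (\<epsilon>3 / q)"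
  have "e \<le> \<epsilon>3 / q" by (simp add: e_def)
  then have "e * q \<le> \<epsilon>3" using q by (simp add: pos_le_divide_eq)
  then have e: "0 < e" "e \<le> \<epsilon>1" "e \<le> \<epsilon>2" "e * q \<le> \<epsilon>3"
    using \<epsilon>1(1) \<epsilon>2(1) 3(1) q by (simp_all add: e_def)
  obtain C1 where C1: "0 < C1" "\<And>f. f \<in> borel_measurable lebesgue \<Longrightarrow>
    (\<integral>\<^sup>+x. ennreal (u x) * ennreal_powr (riesz_exp \<beta> e b f x) q \<partial>lebesgue)
      \<le> ennreal C1 * ennreal_powr (energy p f) (q / p)"
    using \<epsilon>1(2)[OF e(1,2)] by blast
  obtain C2 where C2: "0 < C2" "\<And>f L x0 r x. f \<in> borel_measurable lebesgue \<Longrightarrow> 0 \<le> L \<Longrightarrow>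
    \<forall>x r. 0 < r \<longrightarrow> energy_on (ball x r) p f \<le> ennreal (L * ub x r powr k) \<Longrightarrow>
    0 < r \<Longrightarrow> x \<in> ball x0 r \<Longrightarrow>
    (\<integral>\<^sup>+y\<in>- ball x0 (2 * r). riesz \<beta> x y * (ennreal (exp (e * norm (b x - b y))) * f y) \<partial>lebesgue)
      \<le> ennreal (C2 * L powr (1 / p) * ub x0 r powr (k / p - 1 / q) * exp (e * norm (b x - c x0 r)))"
    using \<epsilon>2(2)[OF e(1,3)] by blast
  define C where "C = 2 powr q * (C1 * D powr (q * k / p) + C2 powr q * C3)"
  have C: "0 < C" unfolding C_def using C1(1) C2(1) 3(2) D(1) by (intro mult_pos_pos add_pos_pos) auto
  show ?thesis
  proof (rule that[OF e(1) C])
    fix f :: "real^'n \<Rightarrow> ennreal" and L r :: real and x0 :: "real^'n"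
    assume f [measurable]: "f \<in> borel_measurable lebesgue" and L: "0 \<le> L" and r: "0 < r"
      and mor: "\<And>x r. 0 < r \<Longrightarrow> energy_on (ball x r) p f \<le> ennreal (L * ub x r powr k)"
    define B2 where "B2 = ball x0 (2 * r)"
    have [measurable]: "B2 \<in> sets lebesgue" "ball x0 r \<in> sets lebesgue" by (simp_all add: B2_def)
    define U where "U = ub x0 r"
    have U: "0 < U" unfolding U_def by (rule wm_ball_pos[OF r])
    define h where "h x y = ennreal (exp (e * norm (b x - b y))) * f y" for x y
    define I1 where "I1 x = (\<integral>\<^sup>+y. riesz \<beta> x y * (h x y * indicator B2 y) \<partial>lebesgue)" for x
    define I2 where "I2 x = (\<integral>\<^sup>+y. riesz \<beta> x y * (h x y * indicator (- B2) y) \<partial>lebesgue)" for x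
    have [measurable]: "(\<lambda>(x, y). h x y) \<in> borel_measurable (lebesgue \<Otimes>\<^sub>M lebesgue)" unfolding h_def by measurable
    have [measurable]: "h x \<in> borel_measurable lebesgue" for x unfolding h_def[abs_def] by measurable
    have [measurable]: "I1 \<in> borel_measurable lebesgue" "I2 \<in> borel_measurable lebesgue"
      unfolding I1_def[abs_def] I2_def[abs_def] by (rule borel_measurable_riesz_kernel; measurable)+
    have split: "(\<integral>\<^sup>+y. riesz \<beta> x y * h x y \<partial>lebesgue) = I1 x + I2 x" for x
    proof -
      have "(\<integral>\<^sup>+y. riesz \<beta> x y * h x y \<partial>lebesgue) = (\<integral>\<^sup>+y. riesz \<beta> x y * (h x y * indicator B2 y) + riesz \<beta> x y * (h x y * indicator (- B2) y) \<partial>lebesgue)"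
        by (intro nn_integral_cong) (auto simp: indicator_def)
      then show ?thesis unfolding I1_def I2_def by (subst (asm) nn_integral_add) measurable
    qed
    have near: "(\<integral>\<^sup>+x. ennreal (u x) * ennreal_powr (I1 x) q \<partial>lebesgue) \<le> ennreal (C1 * (L powr (q / p) * (D powr (q * k / p) * U powr (q * k / p))))"
    proof -
      define f2 where "f2 y = f y * indicator B2 y" for y
      have [measurable]: "f2 \<in> borel_measurable lebesgue" unfolding f2_def by measurable
      have "(\<integral>\<^sup>+x. ennreal (u x) * ennreal_powr (I1 x) q \<partial>lebesgue) \<le> ennreal C1 * ennreal_powr (energy p f2) (q / p)"
        using C1(2)[of f2] by (simp add: I1_def h_def f2_def mult.assoc)
      also have "energy p f2 = energy_on B2 p f"
        by (intro nn_integral_cong) (auto simp: f2_def indicator_def)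
      also have "\<dots> \<le> ennreal (L * measure (wm u) B2 powr k)" unfolding B2_def using r by (intro mor) auto
      also have "\<dots> \<le> ennreal (L * (D * U) powr k)"
        using D(2)[OF r subset_ball[of r "2 * r" x0]] L k r unfolding B2_def U_def
        by (intro ennreal_leI mult_left_mono powr_mono2) auto
      also have "ennreal_powr (ennreal (L * (D * U) powr k)) (q / p) = ennreal (L powr (q / p) * (D powr (q * k / p) * U powr (q * k / p)))"
        using L D(1) U by (simp add: powr_mult powr_powr mult.commute)
      finally show ?thesis using C1(1) L pq by (simp add: ennreal_mult[symmetric] ennreal_powr_mono mult_left_mono)
    qed
    have far: "(\<integral>\<^sup>+x\<in>ball x0 r. ennreal (u x) * ennreal_powr (I2 x) q \<partial>lebesgue) \<le> ennreal (C2 powr q * C3 * (L powr (q / p) * U powr (q * k / p)))"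
    proof -
      define a where "a = C2 * L powr (1 / p) * U powr (k / p - 1 / q)"
      have a: "0 \<le> a" using C2(1) by (simp add: a_def)
      have "(\<integral>\<^sup>+x\<in>ball x0 r. ennreal (u x) * ennreal_powr (I2 x) q \<partial>lebesgue)
        \<le> (\<integral>\<^sup>+x. ennreal (a powr q) * (ennreal (u x) * (ennreal (exp (e * q * norm (b x - c x0 r))) * indicator (ball x0 r) x)) \<partial>lebesgue)"
      proof (rule nn_integral_mono)
        fix x
        show "ennreal (u x) * ennreal_powr (I2 x) q * indicator (ball x0 r) x
          \<le> ennreal (a powr q) * (ennreal (u x) * (ennreal (exp (e * q * norm (b x - c x0 r))) * indicator (ball x0 r) x))"
        proof (cases "x \<in> ball x0 r")
          case True
          have "I2 x \<le> ennreal (a * exp (e * norm (b x - c x0 r)))"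
            using C2(2)[OF f L _ r True] mor unfolding I2_def h_def B2_def a_def U_def by (simp add: mult.assoc)
          then have "ennreal_powr (I2 x) q \<le> ennreal_powr (ennreal (a * exp (e * norm (b x - c x0 r)))) q"
            using q by (intro ennreal_powr_mono) auto
          also have "\<dots> = ennreal (a powr q * exp (e * q * norm (b x - c x0 r)))"
            using a by (simp add: powr_mult) (simp add: powr_def mult_ac)
          finally have "ennreal (u x) * ennreal_powr (I2 x) q \<le> ennreal (u x) * ennreal (a powr q * exp (e * q * norm (b x - c x0 r)))"
            by (rule mult_left_mono) simp
          then show ?thesis using True by (simp add: ennreal_mult mult_ac)
        qed simp
      qed
      also have "\<dots> = ennreal (a powr q) * (\<integral>\<^sup>+x. ennreal (u x) * (ennreal (exp (e * q * norm (b x - c x0 r))) * indicator (ball x0 r) x) \<partial>lebesgue)"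
        by (rule nn_integral_cmult) measurable
      also have "(\<integral>\<^sup>+x. ennreal (u x) * (ennreal (exp (e * q * norm (b x - c x0 r))) * indicator (ball x0 r) x) \<partial>lebesgue)
        = (\<integral>\<^sup>+x\<in>ball x0 r. ennreal (exp (e * q * norm (b x - c x0 r))) \<partial>wm u)"
        by (intro nn_integral_wm[symmetric]) measurable
      also have "\<dots> \<le> ennreal (C3 * U)" using 3(3)[OF r e(4), of x0] 3(2) by (simp add: U_def emeasure_wm_ball ennreal_mult)
      also have "ennreal (a powr q) * ennreal (C3 * U) = ennreal (a powr q * (C3 * U))" using 3(2) U by (simp add: ennreal_mult)
      \<comment> \<open>The exponent of U is q k/p - 1; the missing power 1 is supplied by the
        measure of the ball, which restores the Morrey scaling.\<close>
      also have "a powr q = C2 powr q * L powr (q / p) * U powr (q * k / p - 1)"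
      proof -
        have "(k / p - 1 / q) * q = q * k / p - 1" using q pq(1) by (simp add: field_simps)
        then show ?thesis using C2(1) L U by (simp add: a_def powr_mult powr_powr)
      qed
      also have "C2 powr q * L powr (q / p) * U powr (q * k / p - 1) * (C3 * U) = C2 powr q * C3 * (L powr (q / p) * (U powr (q * k / p - 1) * U))"
        by (simp only: mult_ac)
      also have "U powr (q * k / p - 1) * U = U powr (q * k / p)" using U by (simp add: powr_diff)
      finally show ?thesis by (simp add: mult_left_mono)
    qed
    have "(\<integral>\<^sup>+x\<in>ball x0 r. ennreal (u x) * ennreal_powr (\<integral>\<^sup>+y. riesz \<beta> x y * h x y \<partial>lebesgue) q \<partial>lebesgue)
      \<le> (\<integral>\<^sup>+x. ennreal (2 powr q) * (ennreal (u x) * ennreal_powr (I1 x) q + ennreal (u x) * ennreal_powr (I2 x) q * indicator (ball x0 r) x) \<partial>lebesgue)"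
    proof (rule nn_integral_mono)
      fix x
      have "ennreal (u x) * ennreal_powr (I1 x + I2 x) q \<le> ennreal (u x) * (ennreal (2 powr q) * (ennreal_powr (I1 x) q + ennreal_powr (I2 x) q))"
        using q by (intro mult_left_mono ennreal_powr_add_le) auto
      also have "\<dots> = ennreal (2 powr q) * (ennreal (u x) * ennreal_powr (I1 x) q + ennreal (u x) * ennreal_powr (I2 x) q)"
        by (simp only: distrib_left mult_ac)
      finally show "ennreal (u x) * ennreal_powr (\<integral>\<^sup>+y. riesz \<beta> x y * h x y \<partial>lebesgue) q * indicator (ball x0 r) x
        \<le> ennreal (2 powr q) * (ennreal (u x) * ennreal_powr (I1 x) q + ennreal (u x) * ennreal_powr (I2 x) q * indicator (ball x0 r) x)"
        unfolding split by (cases "x \<in> ball x0 r") auto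
    qed
    also have "\<dots> = ennreal (2 powr q) * ((\<integral>\<^sup>+x. ennreal (u x) * ennreal_powr (I1 x) q \<partial>lebesgue) + (\<integral>\<^sup>+x\<in>ball x0 r. ennreal (u x) * ennreal_powr (I2 x) q \<partial>lebesgue))"
      by (subst nn_integral_cmult, measurable, subst nn_integral_add, measurable)
    also have "\<dots> \<le> ennreal (2 powr q) * (ennreal (C1 * (L powr (q / p) * (D powr (q * k / p) * U powr (q * k / p)))) + ennreal (C2 powr q * C3 * (L powr (q / p) * U powr (q * k / p))))"
      by (intro mult_left_mono add_mono near far) simp
    also have "\<dots> = ennreal (2 powr q * (C1 * (L powr (q / p) * (D powr (q * k / p) * U powr (q * k / p))) + C2 powr q * C3 * (L powr (q / p) * U powr (q * k / p))))"
      using C1(1) 3(2) by (simp add: ennreal_mult[symmetric] ennreal_plus[symmetric] del: ennreal_plus)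
    also have "2 powr q * (C1 * (L powr (q / p) * (D powr (q * k / p) * U powr (q * k / p))) + C2 powr q * C3 * (L powr (q / p) * U powr (q * k / p))) = C * L powr (q / p) * U powr (q * k / p)"
      unfolding C_def by (simp only: distrib_left distrib_right mult_ac)
    finally show "(\<integral>\<^sup>+x\<in>ball x0 r. ennreal (u x) * ennreal_powr (riesz_exp (real CARD('n) * (1 / q + 1 - 1 / p)) e b f x) q \<partial>lebesgue)
      \<le> ennreal (C * L powr (q / p) * ub x0 r powr (q * k / p))"
      unfolding h_def U_def \<beta>_def .
  qed
qed

end

section \<open>Measurability of oscillatory operators\<close>

lemma tendsto_dyadic_floor: "(\<lambda>j. of_int \<lfloor>2 ^ j * t\<rfloor> / 2 ^ j) \<longlonglongrightarrow> (t :: real)"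
proof -
  have "(\<lambda>j. of_int \<lfloor>2 ^ j * t\<rfloor> / 2 ^ j - t) \<longlonglongrightarrow> 0"
  proof (rule Lim_null_comparison)
    show "(\<lambda>j. (1 / 2 :: real) ^ j) \<longlonglongrightarrow> 0" by (rule LIMSEQ_power_zero) simp
    have "\<bar>of_int \<lfloor>2 ^ j * t\<rfloor> / 2 ^ j - t\<bar> \<le> (1 / 2) ^ j" for j :: nat
    proof -
      have "\<bar>of_int \<lfloor>2 ^ j * t\<rfloor> - 2 ^ j * t\<bar> \<le> 1" by linarith
      then have "\<bar>of_int \<lfloor>2 ^ j * t\<rfloor> - 2 ^ j * t\<bar> / 2 ^ j \<le> 1 / 2 ^ j" by (rule divide_right_mono) simp
      moreover have eq: "of_int \<lfloor>2 ^ j * t\<rfloor> / 2 ^ j - t = (of_int \<lfloor>2 ^ j * t\<rfloor> - 2 ^ j * t) / 2 ^ j"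
        by (simp add: diff_divide_distrib)
      moreover have "\<bar>of_int \<lfloor>2 ^ j * t\<rfloor> / 2 ^ j - t\<bar> = \<bar>of_int \<lfloor>2 ^ j * t\<rfloor> - 2 ^ j * t\<bar> / 2 ^ j"
        unfolding eq by simp
      ultimately show ?thesis by (simp add: power_one_over)
    qed
    then show "\<forall>\<^sub>F j in sequentially. norm (of_int \<lfloor>2 ^ j * t\<rfloor> / 2 ^ j - t) \<le> (1 / 2) ^ j" by simp
  qed
  then show ?thesis by (simp add: LIM_zero_iff)
qed

lemma borel_measurable_continuous_off_point:
  fixes g :: "'a::t2_space \<Rightarrow> 'b::topological_space"
  assumes "\<And>y. y \<noteq> a \<Longrightarrow> isCont g y"
  shows "(\<lambda>y. if y = a then z else g y) \<in> borel_measurable borel"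
proof -
  have "(\<lambda>y. if y \<in> {a} then z else g y) \<in> borel_measurable borel"
    using assms by (intro borel_measurable_continuous_on_if) (auto intro!: continuous_at_imp_continuous_on)
  then show ?thesis by simp
qed

text \<open>A separately continuous function is a pointwise limit of its discretizations in one variable.\<close>

lemma borel_measurable_separately_continuous:
  fixes K :: "real^'n \<Rightarrow> real^'n \<Rightarrow> complex"
  assumes "\<And>x y. x \<noteq> y \<Longrightarrow> isCont (\<lambda>u. K u y) x" and K2: "\<And>x y. x \<noteq> y \<Longrightarrow> isCont (K x) y"
  shows "(\<lambda>(x, y). if x = y then 0 else K x y) \<in> borel_measurable (borel \<Otimes>\<^sub>M borel)"
proof (rule borel_measurable_LIMSEQ_metric)
  define pt where "pt j z = (\<chi> i. real_of_int (z i) / 2 ^ j)" for j :: nat and z :: "'n \<Rightarrow> int"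
  define fl where "fl j x = (\<lambda>i. \<lfloor>2 ^ j * (x :: real^'n) $ i\<rfloor>)" for j :: nat and x
  define G where "G j = (\<lambda>(x, y). if x = y then 0 else (if y = pt j (fl j x) then 0 else K (pt j (fl j x)) y))" for j
  show "G j \<in> borel_measurable (borel \<Otimes>\<^sub>M borel)" for j
  proof -
    have fm: "(\<lambda>p. fl j (fst p)) \<in> measurable (borel \<Otimes>\<^sub>M (borel :: (real^'n) measure)) (count_space UNIV)"
    proof (subst measurable_count_space_eq2_countable, safe)
      fix z
      have [measurable]: "(\<lambda>p. fst p $ i) \<in> borel_measurable (borel \<Otimes>\<^sub>M (borel :: (real^'n) measure))" for i :: 'n
        by (rule measurable_compose[OF measurable_fst]) (intro borel_measurable_continuous_onI continuous_intros)
      have "(\<lambda>p. fl j (fst p)) -` {z} \<inter> space (borel \<Otimes>\<^sub>M borel) = {p \<in> space (borel \<Otimes>\<^sub>M (borel :: (real^'n) measure)). \<forall>i. \<lfloor>2 ^ j * fst p $ i\<rfloor> = z i}"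
        by (auto simp: fl_def fun_eq_iff)
      also have "\<dots> \<in> sets (borel \<Otimes>\<^sub>M borel)" by measurable
      finally show "(\<lambda>p. fl j (fst p)) -` {z} \<inter> space (borel \<Otimes>\<^sub>M borel) \<in> sets (borel \<Otimes>\<^sub>M (borel :: (real^'n) measure))" .
    qed auto
    have [measurable]: "(\<lambda>p. if snd p = pt j (fl j (fst p)) then 0 else K (pt j (fl j (fst p))) (snd p)) \<in> borel_measurable (borel \<Otimes>\<^sub>M (borel :: (real^'n) measure))"
    proof (rule measurable_compose_countable[where f = "\<lambda>z p. if snd p = pt j z then 0 else K (pt j z) (snd p)", OF _ fm])
      fix z
      have [measurable]: "(\<lambda>y. if y = pt j z then 0 else K (pt j z) y) \<in> borel_measurable borel"
        using K2 by (intro borel_measurable_continuous_off_point) auto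
      show "(\<lambda>p. if snd p = pt j z then 0 else K (pt j z) (snd p)) \<in> borel_measurable (borel \<Otimes>\<^sub>M borel)"
        by (rule measurable_compose[OF measurable_snd]) measurable
    qed
    have "G j = (\<lambda>p. if fst p = snd p then 0 else (if snd p = pt j (fl j (fst p)) then 0 else K (pt j (fl j (fst p))) (snd p)))"
      by (auto simp: G_def fun_eq_iff)
    also have "\<dots> \<in> borel_measurable (borel \<Otimes>\<^sub>M borel)" by measurable
    finally show ?thesis .
  qed
  fix p :: "(real^'n) \<times> (real^'n)"
  obtain x y where p: "p = (x, y)" by (cases p)
  show "(\<lambda>j. G j p) \<longlonglongrightarrow> (case p of (x, y) \<Rightarrow> if x = y then 0 else K x y)"
  proof (cases "x = y")
    case False
    have pt: "(\<lambda>j. pt j (fl j x)) \<longlonglongrightarrow> x"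
    proof (rule vec_tendstoI)
      fix i show "(\<lambda>j. pt j (fl j x) $ i) \<longlonglongrightarrow> x $ i"
        using tendsto_dyadic_floor[of "x $ i"] by (simp add: pt_def fl_def)
    qed
    then have ne: "\<forall>\<^sub>F j in sequentially. pt j (fl j x) \<noteq> y" using False by (rule tendsto_imp_eventually_ne)
    have lim: "(\<lambda>j. K (pt j (fl j x)) y) \<longlonglongrightarrow> K x y"
      using isCont_tendsto_compose[OF assms(1)[OF False] pt] .
    have "(\<lambda>j. if y = pt j (fl j x) then 0 else K (pt j (fl j x)) y) \<longlonglongrightarrow> K x y"
      by (rule Lim_transform_eventually[OF lim eventually_mono[OF ne]]) auto
    then show ?thesis using False by (simp add: p G_def)
  qed (simp add: p G_def)
qed

lemma lebesgue_measurable_borel_version: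
  fixes f :: "real^'n \<Rightarrow> complex"
  assumes [measurable]: "f \<in> borel_measurable lebesgue"
  obtains g where "g \<in> borel_measurable borel" "AE x in lebesgue. f x = g x"
proof -
  obtain g1 where g1: "g1 \<in> borel_measurable lborel" "AE x in lborel. Re (f x) = g1 x"
    using completion_ex_borel_measurable_real[of "\<lambda>x. Re (f x)" lborel] by auto
  obtain g2 where g2: "g2 \<in> borel_measurable lborel" "AE x in lborel. Im (f x) = g2 x"
    using completion_ex_borel_measurable_real[of "\<lambda>x. Im (f x)" lborel] by auto
  show ?thesis
  proof (rule that[of "\<lambda>x. complex_of_real (g1 x) + \<i> * complex_of_real (g2 x)"])
    show "(\<lambda>x. complex_of_real (g1 x) + \<i> * complex_of_real (g2 x)) \<in> borel_measurable borel"
      using g1(1) g2(1) by simp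
    have "AE x in lborel. f x = complex_of_real (g1 x) + \<i> * complex_of_real (g2 x)"
      using g1(2) g2(2) by eventually_elim (simp add: complex_eq_iff)
    then show "AE x in lebesgue. f x = complex_of_real (g1 x) + \<i> * complex_of_real (g2 x)"
      by (rule AE_completion)
  qed
qed

lemma AE_lebesgue_neq: "AE y in lebesgue. y \<noteq> (a :: real^'n)"
  by (intro AE_completion AE_lborel_singleton)

lemma borel_measurable_osc_integrand:
  fixes K :: "real^'n \<Rightarrow> real^'n \<Rightarrow> complex"
  assumes [measurable]: "f \<in> borel_measurable lebesgue" and K2: "\<And>x y. x \<noteq> y \<Longrightarrow> isCont (K x) y"
    and P: "continuous_on UNIV (\<lambda>(x, y). P x y)"
  shows "osc_integrand P K f x \<in> borel_measurable lebesgue"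
proof -
  have "(\<lambda>y. if y = x then K x x else K x y) \<in> borel_measurable borel"
    using K2 by (intro borel_measurable_continuous_off_point) auto
  moreover have "(\<lambda>y. if y = x then K x x else K x y) = K x" by auto
  ultimately have "K x \<in> borel_measurable borel" by simp
  moreover have "P x \<in> borel_measurable borel"
  proof (rule borel_measurable_continuous_onI)
    have "continuous_on UNIV (\<lambda>y. (x, y))" by (intro continuous_intros)
    from continuous_on_compose2[OF P this] show "continuous_on UNIV (P x)" by simp
  qed
  ultimately have [measurable]: "K x \<in> borel_measurable lebesgue" "P x \<in> borel_measurable lebesgue"
    by (auto intro!: measurable_completion)
  show ?thesis unfolding osc_integrand_def by measurable
qed

text \<open>The parameter integral calls for joint measurability on the Borel product. So
  \<open>f\<close> is replaced by a Borel version and the kernel by 0 on the diagonal; for each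
  fixed \<open>x\<close> both changes concern null sets of \<open>y\<close>.\<close>

lemma borel_measurable_osc_op:
  fixes K :: "real^'n \<Rightarrow> real^'n \<Rightarrow> complex"
  assumes f: "f \<in> borel_measurable lebesgue" 
    and K: "\<And>x y. x \<noteq> y \<Longrightarrow> isCont (\<lambda>u. K u y) x" "\<And>x y. x \<noteq> y \<Longrightarrow> isCont (K x) y"
    and P: "continuous_on UNIV (\<lambda>(x, y). P x y)"
  shows "osc_op P K f \<in> borel_measurable lebesgue"
proof -
  obtain g where g [measurable]: "g \<in> borel_measurable borel" "AE x in lebesgue. f x = g x"
    using lebesgue_measurable_borel_version[OF f] by blast
  define K0 where "K0 x y = (if x = y then 0 else K x y)" for x y
  have [measurable]: "(\<lambda>(x, y). K0 x y) \<in> borel_measurable (borel \<Otimes>\<^sub>M borel)"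
    using borel_measurable_separately_continuous[of K] K by (simp add: K0_def)
  have [measurable]: "(\<lambda>(x, y). P x y) \<in> borel_measurable (borel \<Otimes>\<^sub>M borel)"
    unfolding borel_prod using P by (rule borel_measurable_continuous_onI)
  define G where "G x y = exp (\<i> * of_real (P x y)) * K0 x y * g y" for x y
  have G [measurable]: "(\<lambda>(x, y). G x y) \<in> borel_measurable (borel \<Otimes>\<^sub>M borel)" unfolding G_def by measurable
  have "osc_op P K f x = (LINT y|lborel. G x y)" for x
  proof -
    have [measurable]: "G x \<in> borel_measurable borel" using measurable_compose[OF measurable_Pair1' G, of x] by simp
    have "osc_op P K f x = (LINT y|lebesgue. G x y)"
      unfolding osc_op_def
    proof (rule integral_cong_AE)
      show "osc_integrand P K f x \<in> borel_measurable lebesgue" by (rule borel_measurable_osc_integrand[OF f K(2) P])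
      show "G x \<in> borel_measurable lebesgue" by (rule measurable_completion) simp
      show "AE y in lebesgue. osc_integrand P K f x y = G x y"
        using g(2) AE_lebesgue_neq[of x] by eventually_elim (auto simp: osc_integrand_def G_def K0_def)
    qed
    then show ?thesis by (simp add: integral_completion)
  qed
  then have "osc_op P K f = (\<lambda>x. LINT y|lborel. G x y)" by (rule ext)
  moreover have "(\<lambda>x. LINT y|lborel. G x y) \<in> borel_measurable lborel"
    using G by (intro lborel.borel_measurable_lebesgue_integral) (simp cong: measurable_cong_sets)
  ultimately show ?thesis by (simp add: measurable_completion)
qed

lemma locally_integrable_borel_measurable:
  fixes f :: "real^'n \<Rightarrow> 'b::{banach, second_countable_topology}"
  assumes "locally_integrable f"
  shows "f \<in> borel_measurable lebesgue"
proof (rule borel_measurable_LIMSEQ_metric)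
  fix i :: nat
  show "(\<lambda>x. indicator (cball 0 (real i)) x *\<^sub>R f x) \<in> borel_measurable lebesgue"
  proof (rule borel_measurable_integrable)
    show "integrable lebesgue (\<lambda>x. indicator (cball 0 (real i)) x *\<^sub>R f x)"
      using assms compact_cball[of "0 :: real^'n" "real i"] unfolding locally_integrable_def set_integrable_def by blast
  qed
next
  fix x :: "real^'n"
  obtain m where m: "norm x \<le> real m" using real_arch_simple by blast
  have "\<forall>\<^sub>F i in sequentially. indicator (cball 0 (real i)) x *\<^sub>R f x = f x"
    using eventually_ge_at_top[of m] by (rule eventually_mono) (use m in auto)
  then show "(\<lambda>i. indicator (cball 0 (real i)) x *\<^sub>R f x) \<longlonglongrightarrow> f x" by (rule tendsto_eventually)
qed

section \<open>Reduction of the oscillatory commutator\<close>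

lemma conj_exp_eq: "1 < p \<Longrightarrow> conj_exp p = p / (p - 1)"
  unfolding conj_exp_def
proof (rule the_equality)
  assume p: "1 < p"
  then show "1 / p + 1 / (p / (p - 1)) = 1" by (simp add: field_simps)
  fix p' assume *: "1 / p + 1 / p' = 1"
  then have "p' \<noteq> 0" using p by auto
  then show "p' = p / (p - 1)" using * p by (simp add: field_simps)
qed

lemma set_nn_integral_pos:
  assumes "v \<in> borel_measurable lebesgue" "AE x in lebesgue. 0 < v x" "B \<in> sets lebesgue" "0 < emeasure lebesgue B"
  shows "0 < (\<integral>\<^sup>+x\<in>B. ennreal (v x) \<partial>lebesgue)"
proof (rule ccontr)
  have [measurable]: "v \<in> borel_measurable lebesgue" "B \<in> sets lebesgue" by fact+
  assume "\<not> 0 < (\<integral>\<^sup>+x\<in>B. ennreal (v x) \<partial>lebesgue)"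
  then have "(\<integral>\<^sup>+x\<in>B. ennreal (v x) \<partial>lebesgue) = 0" by (simp add: zero_less_iff_neq_zero)
  then have "AE x in lebesgue. ennreal (v x) * indicator B x = 0" by (subst (asm) nn_integral_0_iff_AE) auto
  then have "AE x in lebesgue. x \<notin> B" using assms(2) by eventually_elim (auto simp: indicator_def split: if_splits)
  then have "emeasure lebesgue B = 0" by (subst (asm) AE_iff_measurable[OF assms(3)]) auto
  then show False using assms(4) by simp
qed

text \<open>With \<tau> = 1/q + 1/p' one has \<theta> = 1/(q \<tau>) and 1 - \<theta> = 1/(p'
  \<tau>). The defining inequality raised to the power 1/\<tau> thus has exponents adding up to 1,
  and the two powers of the volume combine to the volume itself.\<close>

lemma A_pq_muckenhoupt_pair:
  fixes w :: "real^'n \<Rightarrow> real"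
  assumes "1 < p" "1 < q" "w \<in> A_pq p q"
  defines "p' \<equiv> p / (p - 1)"
  obtains K where "muckenhoupt_pair (\<lambda>x. w x powr q) (\<lambda>x. w x powr - p') (p' / (q + p')) K"
proof -
  have p': "0 < p'" using assms(1) by (simp add: p'_def)
  define \<theta> where "\<theta> = p' / (q + p')"
  define \<tau> where "\<tau> = 1 / q + 1 / p'"
  have th: "0 < \<theta>" "\<theta> < 1" "\<theta> = 1 / q * (1 / \<tau>)" "1 - \<theta> = 1 / p' * (1 / \<tau>)" "0 < \<tau>"
    using p' assms(2) by (auto simp: \<theta>_def \<tau>_def add_pos_pos divide_simps)
  define u where "u x = w x powr q" for x
  define s where "s x = w x powr - p'" for x
  define A where "A B = ennreal_powr ((\<integral>\<^sup>+x\<in>B. ennreal (u x) \<partial>lebesgue) / emeasure lebesgue B) (1 / q) *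
        ennreal_powr ((\<integral>\<^sup>+x\<in>B. ennreal (s x) \<partial>lebesgue) / emeasure lebesgue B) (1 / p')" for B
  have wt: "weight w" and sup: "(SUP B\<in>balls. A B) < \<infinity>"
    using assms(3) unfolding A_pq_def A_def u_def s_def conj_exp_eq[OF assms(1)] p'_def by auto
  have [measurable]: "w \<in> borel_measurable lebesgue" and pos: "AE x in lebesgue. 0 < w x"
    using wt by (auto simp: weight_def locally_integrable_borel_measurable)
  have [measurable]: "u \<in> borel_measurable lebesgue" "s \<in> borel_measurable lebesgue"
    unfolding u_def s_def by measurable
  have us: "AE x in lebesgue. 0 < u x" "AE x in lebesgue. 0 < s x"
    using pos by (auto simp: u_def s_def elim: eventually_mono)
  define \<kappa> where "\<kappa> = enn2real (SUP B\<in>balls. A B)"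
  have A_le: "A (ball x r) \<le> ennreal \<kappa>" if "0 < r" for x r
  proof -
    have "A (ball x r) \<le> (SUP B\<in>balls. A B)" using that by (intro SUP_upper) (auto simp: balls_def)
    then show ?thesis using sup by (simp add: \<kappa>_def)
  qed
  define \<omega> where "\<omega> = unit_ball_vol (real CARD('n))"
  have vol: "emeasure lebesgue (ball x r) = ennreal (\<omega> * r ^ CARD('n))" "0 < \<omega> * r ^ CARD('n)" if "0 < r" for x :: "real^'n" and r
    using that by (simp_all add: emeasure_completion_eq emeasure_ball \<omega>_def)
  have em: "emeasure (wm u) B = (\<integral>\<^sup>+x\<in>B. ennreal (u x) \<partial>lebesgue)" "emeasure (wm s) B = (\<integral>\<^sup>+x\<in>B. ennreal (s x) \<partial>lebesgue)"
    if "B \<in> sets lebesgue" for B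
    using that unfolding wm_def by (auto intro!: emeasure_density)
  have emp: "0 < emeasure (wm u) (ball x r)" "0 < emeasure (wm s) (ball x r)" if "0 < r" for x r
    using us vol(1)[OF that, of x] vol(2)[OF that] by (auto simp: em intro!: set_nn_integral_pos)
  have Aeq: "A (ball x r) = ennreal_powr (emeasure (wm u) (ball x r) / ennreal (\<omega> * r ^ CARD('n))) (1 / q) *
        ennreal_powr (emeasure (wm s) (ball x r) / ennreal (\<omega> * r ^ CARD('n))) (1 / p')" if "0 < r" for x r
    by (simp add: A_def em vol(1)[OF that])
  have fin: "emeasure (wm u) (ball x r) < \<infinity> \<and> emeasure (wm s) (ball x r) < \<infinity>" for x r
  proof (cases "0 < r")
    case True
    have "A (ball x r) < \<infinity>" using A_le[OF True, of x] by (auto intro: le_less_trans)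
    then have "ennreal_powr (emeasure (wm u) (ball x r) / ennreal (\<omega> * r ^ CARD('n))) (1 / q) *
        ennreal_powr (emeasure (wm s) (ball x r) / ennreal (\<omega> * r ^ CARD('n))) (1 / p') < \<infinity>"
      unfolding Aeq[OF True] .
    \<comment> \<open>Finiteness of the product passes to the factors only when neither vanishes,
      because 0 times infinity is 0.\<close>
    moreover have "0 < emeasure (wm u) (ball x r) / ennreal (\<omega> * r ^ CARD('n))" "0 < emeasure (wm s) (ball x r) / ennreal (\<omega> * r ^ CARD('n))"
      using emp[OF True, of x] by (auto simp: ennreal_zero_less_divide)
    ultimately have "emeasure (wm u) (ball x r) / ennreal (\<omega> * r ^ CARD('n)) < \<infinity>" "emeasure (wm s) (ball x r) / ennreal (\<omega> * r ^ CARD('n)) < \<infinity>"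
      by (auto simp: ennreal_mult_less_top)
    then show ?thesis
      by (cases "emeasure (wm u) (ball x r)"; cases "emeasure (wm s) (ball x r)") (auto simp: ennreal_top_divide)
  qed (simp add: ball_empty)
  have "muckenhoupt_pair u s \<theta> (\<omega> * \<kappa> powr (1 / \<tau>))"
  proof
    show "AE x in lebesgue. 0 < u x \<and> 0 < s x \<and> u x powr \<theta> * s x powr (1 - \<theta>) = 1"
      using pos
    proof eventually_elim
      case (elim x)
      have "u x powr \<theta> * s x powr (1 - \<theta>) = w x powr (q * \<theta> + - p' * (1 - \<theta>))"
        by (simp only: u_def s_def powr_powr powr_add)
      also have "q * \<theta> + - p' * (1 - \<theta>) = 0"
      proof -
        have "q * \<theta> = 1 / \<tau>" "p' * (1 - \<theta>) = 1 / \<tau>" using p' assms(2) by (subst th, simp)+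
        then show ?thesis by simp
      qed
      finally show ?case using elim by (simp add: u_def s_def)
    qed
    fix x :: "real^'n" and r :: real
    show "emeasure (wm u) (ball x r) < \<infinity>" "emeasure (wm s) (ball x r) < \<infinity>" using fin by auto
    assume r: "0 < r"
    define V where "V = \<omega> * r ^ CARD('n)"
    define U where "U = measure (wm u) (ball x r)"
    define S where "S = measure (wm s) (ball x r)"
    have V: "0 < V" using vol(2)[OF r] by (simp add: V_def)
    have US: "emeasure (wm u) (ball x r) = ennreal U" "emeasure (wm s) (ball x r) = ennreal S" "0 \<le> U" "0 \<le> S"
      using fin[of x r] by (auto simp: U_def S_def emeasure_eq_ennreal_measure less_top)
    have "A (ball x r) = ennreal ((U / V) powr (1 / q) * (S / V) powr (1 / p'))"
      unfolding Aeq[OF r] US V_def[symmetric] using V US(3,4) by (simp add: divide_ennreal ennreal_mult)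
    then have "(U / V) powr (1 / q) * (S / V) powr (1 / p') \<le> \<kappa>"
      using A_le[OF r, of x] by (simp add: \<kappa>_def)
    then have "((U / V) powr (1 / q) * (S / V) powr (1 / p')) powr (1 / \<tau>) \<le> \<kappa> powr (1 / \<tau>)"
      using th(5) by (intro powr_mono2) auto
    also have "((U / V) powr (1 / q) * (S / V) powr (1 / p')) powr (1 / \<tau>) = (U / V) powr \<theta> * (S / V) powr (1 - \<theta>)"
      by (simp only: powr_mult powr_powr th(3,4)[symmetric])
    also have "\<dots> = U powr \<theta> * S powr (1 - \<theta>) / (V powr \<theta> * V powr (1 - \<theta>))"
      using US(3,4) V by (simp add: powr_divide)
    also have "V powr \<theta> * V powr (1 - \<theta>) = V" using V by (simp add: powr_add[symmetric])
    finally show "measure (wm u) (ball x r) powr \<theta> * measure (wm s) (ball x r) powr (1 - \<theta>) \<le> \<omega> * \<kappa> powr (1 / \<tau>) * r ^ CARD('n)"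
      using V by (simp add: U_def S_def V_def divide_le_eq mult_ac)
  qed (use th in auto)
  then show ?thesis unfolding u_def s_def \<theta>_def by (rule that)
qed

lemma BMO_bounded_oscillation:
  fixes b :: "real^'n \<Rightarrow> complex"
  assumes "b \<in> BMO"
  obtains M where "bounded_oscillation b (\<lambda>x r. average (ball x r) b) M"
proof -
  define m where "m = enn2real (bmo_norm b)"
  have m: "bmo_norm b = ennreal m" "0 \<le> m" using assms by (auto simp: BMO_def m_def less_top)
  define \<omega> where "\<omega> = unit_ball_vol (real CARD('n))"
  \<comment> \<open>The added 1 keeps the constant positive when \<open>b\<close> has BMO norm
    0.\<close>
  have "bounded_oscillation b (\<lambda>x r. average (ball x r) b) ((m + 1) * \<omega>)"
    unfolding bounded_oscillation_def
  proof (intro conjI allI impI)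
    show "b \<in> borel_measurable lebesgue" using assms by (auto simp: BMO_def locally_integrable_borel_measurable)
    show "0 < (m + 1) * \<omega>" using m by (simp add: \<omega>_def add_nonneg_pos)
    fix x :: "real^'n" and r :: real assume r: "0 < r"
    let ?I = "\<integral>\<^sup>+y\<in>ball x r. ennreal (norm (b y - average (ball x r) b)) \<partial>lebesgue"
    have V: "emeasure lebesgue (ball x r) = ennreal (\<omega> * r ^ CARD('n))" "0 < \<omega> * r ^ CARD('n)"
      using r by (simp_all add: emeasure_completion_eq emeasure_ball \<omega>_def)
    have "?I / emeasure lebesgue (ball x r) \<le> bmo_norm b"
      unfolding bmo_norm_def using r by (intro SUP_upper) (auto simp: balls_def)
    then have "?I / ennreal (\<omega> * r ^ CARD('n)) \<le> ennreal m" using m V by simp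
    then have "ennreal (\<omega> * r ^ CARD('n)) * (?I / ennreal (\<omega> * r ^ CARD('n))) \<le> ennreal (\<omega> * r ^ CARD('n)) * ennreal m"
      by (rule mult_left_mono) simp
    then have "?I \<le> ennreal (\<omega> * r ^ CARD('n) * m)" 
      using V(2) m(2) unfolding ennreal_mult_divide_cancel[OF V(2)] by (simp add: ennreal_mult)
    also have "\<dots> \<le> ennreal ((m + 1) * \<omega> * r ^ CARD('n))" using V(2) by (intro ennreal_leI) (simp add: algebra_simps)
    finally show "?I \<le> ennreal ((m + 1) * \<omega> * r ^ CARD('n))" .
  qed
  then show ?thesis by (rule that)
qed

lemma SFCZK_bound:
  fixes K :: "real^'n \<Rightarrow> real^'n \<Rightarrow> complex"
  assumes "SFCZK \<alpha> K"
  obtains C where "0 < C" "\<And>x y. x \<noteq> y \<Longrightarrow> ennreal (norm (K x y)) \<le> ennreal C * riesz (real CARD('n) - \<alpha>) x y"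
    "\<And>x y. x \<noteq> y \<Longrightarrow> isCont (\<lambda>u. K u y) x" "\<And>x y. x \<noteq> y \<Longrightarrow> isCont (K x) y"
proof -
  obtain C where C: "\<And>x y. x \<noteq> y \<Longrightarrow> norm (K x y) \<le> C * norm (x - y) powr (- (real CARD('n) - \<alpha>))"
    "\<And>x y. x \<noteq> y \<Longrightarrow> (\<lambda>u. K u y) differentiable (at x)" "\<And>x y. x \<noteq> y \<Longrightarrow> (\<lambda>v. K x v) differentiable (at y)"
    using assms unfolding SFCZK_def by blast
  \<comment> \<open>The constant of the kernel condition carries no sign; a positive one is needed
    below.\<close>
  define D where "D = \<bar>C\<bar> + 1"
  have D: "0 < D" "C \<le> D" by (auto simp: D_def)
  show ?thesis
  proof (rule that[OF D(1)])
    fix x y :: "real^'n" assume xy: "x \<noteq> y"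
    have "norm (K x y) \<le> C * norm (x - y) powr (- (real CARD('n) - \<alpha>))" by (rule C(1)[OF xy])
    also have "\<dots> \<le> D * norm (x - y) powr (- (real CARD('n) - \<alpha>))" using D by (intro mult_right_mono) auto
    finally show "ennreal (norm (K x y)) \<le> ennreal D * riesz (real CARD('n) - \<alpha>) x y"
      using D by (simp add: riesz_def ennreal_mult[symmetric] ennreal_leI)
    show "isCont (\<lambda>u. K u y) x" "isCont (K x) y"
      using C(2,3)[OF xy] by (auto intro: differentiable_imp_continuous_within)
  qed
qed

text \<open>The oscillating factor has modulus 1, and exp(e t) dominates both 1 and e t. Finiteness
  of \<open>H\<close> therefore makes both integrals converge absolutely, and only then may the
  commutator be written as one integral with the factor \<open>b x - b y\<close>.\<close>

lemma commutator_pointwise: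
  fixes K :: "real^'n \<Rightarrow> real^'n \<Rightarrow> complex" and x :: "real^'n"
  assumes f: "f \<in> borel_measurable lebesgue" and b: "b \<in> borel_measurable lebesgue"
    and K: "0 < C" "\<And>x y. x \<noteq> y \<Longrightarrow> ennreal (norm (K x y)) \<le> ennreal C * riesz \<beta> x y"
      "\<And>x y. x \<noteq> y \<Longrightarrow> isCont (K x) y"
    and P: "continuous_on UNIV (\<lambda>(x, y). P x y)" and e: "0 < e"
  defines "H \<equiv> \<integral>\<^sup>+y. riesz \<beta> x y * (ennreal (exp (e * norm (b x - b y))) * ennreal (norm (f y))) \<partial>lebesgue"
  assumes H: "H < \<infinity>"
  shows "integrable lebesgue (osc_integrand P K f x)"
    "integrable lebesgue (osc_integrand P K (\<lambda>y. b y * f y) x)"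
    "ennreal (norm (commutator b (osc_op P K) f x)) \<le> ennreal (C / e) * H"
proof -
  note [measurable] = f b
  have m1 [measurable]: "osc_integrand P K f x \<in> borel_measurable lebesgue"
    by (rule borel_measurable_osc_integrand[OF f K(3) P])
  have m2 [measurable]: "osc_integrand P K (\<lambda>y. b y * f y) x \<in> borel_measurable lebesgue"
    by (rule borel_measurable_osc_integrand[OF _ K(3) P]) measurable
  have norm_osc: "norm (osc_integrand P K g x y) = norm (K x y) * norm (g y)" for g y
    by (simp add: osc_integrand_def norm_mult)
  have texp: "t \<le> exp (e * t) / e" for t :: real
  proof -
    have "e * t \<le> exp (e * t)" using exp_ge_add_one_self[of "e * t"] by linarith
    then show ?thesis using e by (simp add: field_simps)
  qed
  define h where "h y = riesz \<beta> x y * (ennreal (exp (e * norm (b x - b y))) * ennreal (norm (f y)))" for y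
  have [measurable]: "h \<in> borel_measurable lebesgue" unfolding h_def by measurable
  \<comment> \<open>Used with the multiplier \<open>c\<close> equal to 1, to
    \<open>norm (b y)\<close> and to \<open>norm (b x - b y)\<close>.\<close>
  have key: "ennreal (norm (K x y) * (c * norm (f y))) \<le> ennreal (C * m) * h y" 
    if "x \<noteq> y" "0 \<le> c" "0 \<le> m" "c \<le> m * exp (e * norm (b x - b y))" for y c m
  proof -
    have "ennreal (norm (K x y) * (c * norm (f y))) = ennreal (norm (K x y)) * (ennreal c * ennreal (norm (f y)))"
      using that by (simp add: ennreal_mult)
    also have "\<dots> \<le> (ennreal C * riesz \<beta> x y) * (ennreal (m * exp (e * norm (b x - b y))) * ennreal (norm (f y)))"
      using that by (intro mult_mono K(2) ennreal_leI) auto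
    also have "\<dots> = ennreal (C * m) * h y"
      unfolding h_def using that K(1) by (simp add: ennreal_mult mult_ac)
    finally show ?thesis .
  qed
  have fin: "(\<integral>\<^sup>+y. ennreal (C * m) * h y \<partial>lebesgue) = ennreal (C * m) * H" for m
    unfolding H_def h_def by (rule nn_integral_cmult) measurable
  have ne: "AE y in lebesgue. x \<noteq> y" using AE_lebesgue_neq[of x] by eventually_elim auto
  have "(\<integral>\<^sup>+y. ennreal (norm (osc_integrand P K f x y)) \<partial>lebesgue) \<le> (\<integral>\<^sup>+y. ennreal (C * 1) * h y \<partial>lebesgue)"
    using key[where c = 1 and m = 1] e by (intro nn_integral_mono_AE, use ne in eventually_elim) (auto simp: norm_osc)
  then show i1: "integrable lebesgue (osc_integrand P K f x)"
    using H unfolding fin by (intro integrableI_bounded m1) (auto intro: le_less_trans simp: ennreal_mult_less_top)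
  \<comment> \<open>Comes from |b y| \<le> |b x| + |b x - b y|: the first summand is multiplied by
    an exponential at least 1, the second is at most the exponential divided by
    \<open>e\<close>.\<close>
  define m where "m = norm (b x) + 1 / e"
  have m: "0 \<le> m" using e by (simp add: m_def)
  have "(\<integral>\<^sup>+y. ennreal (norm (osc_integrand P K (\<lambda>y. b y * f y) x y)) \<partial>lebesgue) \<le> (\<integral>\<^sup>+y. ennreal (C * m) * h y \<partial>lebesgue)"
  proof (intro nn_integral_mono_AE, use ne in eventually_elim)
    fix y assume y: "x \<noteq> y"
    have "norm (b y) \<le> norm (b x) + norm (b x - b y)" using norm_triangle_ineq4[of "b x" "b x - b y"] by simp
    also have "\<dots> \<le> norm (b x) * exp (e * norm (b x - b y)) + exp (e * norm (b x - b y)) / e"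
      using e texp[of "norm (b x - b y)"] by (intro add_mono) (auto intro!: mult_right_le_one_le simp: mult_le_cancel_left1)
    also have "\<dots> = m * exp (e * norm (b x - b y))" by (simp add: m_def distrib_right)
    finally show "ennreal (norm (osc_integrand P K (\<lambda>y. b y * f y) x y)) \<le> ennreal (C * m) * h y"
      using key[OF y _ m, of "norm (b y)"] by (simp add: norm_osc norm_mult)
  qed
  then show i2: "integrable lebesgue (osc_integrand P K (\<lambda>y. b y * f y) x)"
    using H unfolding fin by (intro integrableI_bounded m2) (auto intro: le_less_trans simp: ennreal_mult_less_top)
  have eq: "b x * osc_integrand P K f x y - osc_integrand P K (\<lambda>y. b y * f y) x y = (b x - b y) * osc_integrand P K f x y" for y
    by (simp add: osc_integrand_def algebra_simps)
  have i3: "integrable lebesgue (\<lambda>y. (b x - b y) * osc_integrand P K f x y)"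
    unfolding eq[symmetric] by (intro Bochner_Integration.integrable_diff integrable_mult_right i1 i2)
  have "commutator b (osc_op P K) f x = (LINT y|lebesgue. (b x - b y) * osc_integrand P K f x y)"
    unfolding commutator_def osc_op_def eq[symmetric] using i1 i2 by simp
  then have "ennreal (norm (commutator b (osc_op P K) f x)) \<le> (\<integral>\<^sup>+y. ennreal (norm ((b x - b y) * osc_integrand P K f x y)) \<partial>lebesgue)"
    using integral_norm_bound_ennreal[OF i3] by simp
  also have "\<dots> \<le> (\<integral>\<^sup>+y. ennreal (C * (1 / e)) * h y \<partial>lebesgue)"
  proof (intro nn_integral_mono_AE, use ne in eventually_elim)
    fix y assume y: "x \<noteq> y"
    show "ennreal (norm ((b x - b y) * osc_integrand P K f x y)) \<le> ennreal (C * (1 / e)) * h y"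
      using key[OF y, of "norm (b x - b y)" "1 / e"] texp[of "norm (b x - b y)"] e by (simp add: norm_mult norm_osc mult_ac)
  qed
  also have "\<dots> = ennreal (C / e) * H" using fin[of "1 / e"] by simp
  finally show "ennreal (norm (commutator b (osc_op P K) f x)) \<le> ennreal (C / e) * H" .
qed

lemma AE_lebesgue_ballI:
  assumes "\<And>r. 0 < r \<Longrightarrow> AE x in lebesgue. x \<in> ball (0 :: real^'n) r \<longrightarrow> Q x"
  shows "AE x in lebesgue. Q x"
proof -
  have "AE x in lebesgue. \<forall>n::nat. x \<in> ball (0 :: real^'n) (real (Suc n)) \<longrightarrow> Q x"
    using assms by (subst AE_all_countable) auto
  then show ?thesis
  proof eventually_elim
    case (elim x)
    obtain n where "norm x < real n" using reals_Archimedean2 by blast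
    then have "x \<in> ball 0 (real (Suc n))" by simp
    then show ?case using elim by blast
  qed
qed

theorem theorem3p4:
  fixes \<alpha> p q k :: real
    and w :: "real^'n \<Rightarrow> real"
    and K :: "real^'n \<Rightarrow> real^'n \<Rightarrow> complex"
    and P :: "real^'n \<Rightarrow> real^'n \<Rightarrow> real"
    and b :: "real^'n \<Rightarrow> complex"
  assumes "0 < \<alpha>" and "\<alpha> < real CARD('n)"
    and "1 < p" and "p < real CARD('n) / \<alpha>"
    and "1 / q = 1 / p - \<alpha> / real CARD('n)"
    and "0 < k" and "k < p / q"
    and "w \<in> A_pq p q"
    and "SFCZK \<alpha> K"
    and "real_polynomial_function (\<lambda>(x, y). P x y)"
    and "b \<in> BMO"
  shows "\<exists>C>0. \<forall>f \<in> morrey_space p k (\<lambda>x. w x powr p) (\<lambda>x. w x powr q).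
           osc_defined_ae P K f \<and>
           osc_defined_ae P K (\<lambda>y. b y * f y) \<and>
           commutator b (osc_op P K) f
             \<in> morrey_space q (q * k / p) (\<lambda>x. w x powr q) (\<lambda>x. w x powr q) \<and>
           morrey_norm q (q * k / p) (\<lambda>x. w x powr q) (\<lambda>x. w x powr q) (commutator b (osc_op P K) f)
             \<le> ennreal C * morrey_norm p k (\<lambda>x. w x powr p) (\<lambda>x. w x powr q) f"
proof -
  let ?norm = "morrey_norm p k (\<lambda>x. w x powr p) (\<lambda>x. w x powr q)"
  let ?norm' = "morrey_norm q (q * k / p) (\<lambda>x. w x powr q) (\<lambda>x. w x powr q)"
  have n: "0 < real CARD('n)" by simp
  have p: "0 < p" using assms(3) by simp
  have "\<alpha> / real CARD('n) < 1 / p" using assms(1,4) p n by (simp add: field_simps)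
  then have "0 < 1 / q" using assms(5) by simp
  then have q0: "0 < q" by simp
  have "0 < \<alpha> / real CARD('n)" using assms(1) n by simp
  then have "1 / q < 1 / p" using assms(5) by simp
  then have pq: "p < q" using q0 p by (simp add: field_simps)
  define p' where "p' = p / (p - 1)"
  have p': "0 < p'" "p' * (p - 1) = p" "1 / p' = 1 - 1 / p" using assms(3) by (auto simp: p'_def field_simps)
  define \<theta> where "\<theta> = p' / (q + p')"
  have th: "\<theta> * (1 / q + 1 - 1 / p) = 1 / q"
  proof -
    have "1 / q + 1 - 1 / p = 1 / q + 1 / p'" using p'(3) by simp
    also have "\<theta> * \<dots> = 1 / q" unfolding \<theta>_def using p'(1) q0 by (simp add: divide_simps)
    finally show ?thesis .
  qed
  define \<beta> where "\<beta> = real CARD('n) - \<alpha>"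
  have \<beta>: "real CARD('n) * (1 / q + 1 - 1 / p) = \<beta>" unfolding \<beta>_def assms(5) using n by (simp add: field_simps)
  define u where "u x = w x powr q" for x
  define s where "s x = w x powr - p'" for x
  obtain A where pair: "muckenhoupt_pair u s \<theta> A"
    using A_pq_muckenhoupt_pair[OF assms(3) _ assms(8)] pq assms(3) unfolding u_def s_def \<theta>_def p'_def by auto
  interpret muckenhoupt_pair u s \<theta> A by (rule pair)
  obtain M where bo: "bounded_oscillation b (\<lambda>x r. average (ball x r) b) M"
    using BMO_bounded_oscillation[OF assms(11)] by blast
  have b [measurable]: "b \<in> borel_measurable lebesgue" using bo by (auto simp: bounded_oscillation_def)
  have wt: "weight w" using assms(8) by (simp add: A_pq_def)
  have w [measurable]: "w \<in> borel_measurable lebesgue" and wpos: "AE x in lebesgue. 0 < w x"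
    using wt by (auto simp: weight_def locally_integrable_borel_measurable)
  obtain e C where e: "0 < e" "0 < C" and morrey: "\<And>f L x0 r. f \<in> borel_measurable lebesgue \<Longrightarrow> 0 \<le> L \<Longrightarrow>
    (\<And>x r. 0 < r \<Longrightarrow> (\<integral>\<^sup>+y\<in>ball x r. ennreal_powr (f y) p * ennreal (s y powr (1 - p)) \<partial>lebesgue) \<le> ennreal (L * measure (wm u) (ball x r) powr k)) \<Longrightarrow>
    0 < r \<Longrightarrow>
    (\<integral>\<^sup>+x\<in>ball x0 r. ennreal (u x) * ennreal_powr (\<integral>\<^sup>+y. riesz \<beta> x y * (ennreal (exp (e * norm (b x - b y))) * f y) \<partial>lebesgue) q \<partial>lebesgue)
      \<le> ennreal (C * L powr (q / p) * measure (wm u) (ball x0 r) powr (q * k / p))"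
    using exponential_commutator_Morrey[OF assms(3) pq th assms(6,7) bo] unfolding \<beta> by blast
  obtain C0 where C0: "0 < C0" "\<And>x y. x \<noteq> y \<Longrightarrow> ennreal (norm (K x y)) \<le> ennreal C0 * riesz \<beta> x y"
    "\<And>x y. x \<noteq> y \<Longrightarrow> isCont (\<lambda>u. K u y) x" "\<And>x y. x \<noteq> y \<Longrightarrow> isCont (K x) y"
    using SFCZK_bound[OF assms(9)] unfolding \<beta>_def by blast
  have P: "continuous_on UNIV (\<lambda>(x, y). P x y)"
    using assms(10) by (intro continuous_at_imp_continuous_on ballI continuous_real_polymonial_function)
  \<comment> \<open>\<open>C0\<close> comes from the size of the kernel, 1/e from the exponential
    domination, and the last factor from taking the q-th root of the Morrey estimate.\<close>
  define C' where "C' = C0 / e * C powr (1 / q)"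
  have C': "0 < C'" using C0(1) e by (simp add: C'_def)
  have wmeas: "wmeasure (\<lambda>x. w x powr q) (ball x r) = ennreal (measure (wm u) (ball x r))" for x r
    using emeasure_wm(1)[of "ball x r"] by (simp add: wmeasure_def u_def emeasure_wm_ball)
  show ?thesis
  proof (intro exI[of _ C'] conjI C' ballI)
    fix f assume "f \<in> morrey_space p k (\<lambda>x. w x powr p) (\<lambda>x. w x powr q)"
    then have f [measurable]: "f \<in> borel_measurable lebesgue" and fin: "?norm f < \<infinity>"
      by (auto simp: morrey_space_def)
    let ?cf = "commutator b (osc_op P K) f"
    define l where "l = enn2real (?norm f)"
    have l: "0 \<le> l" "?norm f = ennreal l"
      using fin by (auto simp: l_def)
    \<comment> \<open>The Morrey norm in the form expected by the estimate for the pair, with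
      \<open>L = l powr p\<close>.\<close>
    have mor: "(\<integral>\<^sup>+y\<in>ball x r. ennreal_powr (ennreal (norm (f y))) p * ennreal (s y powr (1 - p)) \<partial>lebesgue) \<le> ennreal (l powr p * measure (wm u) (ball x r) powr k)"
      if r: "0 < r" for x r
    proof -
      define U where "U = measure (wm u) (ball x r)"
      have U: "0 < U" unfolding U_def by (rule wm_ball_pos[OF r])
      define I where "I = (\<integral>\<^sup>+y\<in>ball x r. ennreal (norm (f y) powr p * w y powr p) \<partial>lebesgue)"
      have "(\<integral>\<^sup>+y\<in>ball x r. ennreal_powr (ennreal (norm (f y))) p * ennreal (s y powr (1 - p)) \<partial>lebesgue) = I"
        unfolding I_def
      proof (intro nn_integral_cong_AE, use wpos in eventually_elim)
        fix y assume "0 < w y"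
        have "s y powr (1 - p) = w y powr (p' * (p - 1))" unfolding s_def powr_powr by (simp add: algebra_simps)
        then have "s y powr (1 - p) = w y powr p" by (simp add: p'(2))
        then show "ennreal_powr (ennreal (norm (f y))) p * ennreal (s y powr (1 - p)) * indicator (ball x r) y
          = ennreal (norm (f y) powr p * w y powr p) * indicator (ball x r) y"
          by (simp add: ennreal_mult)
      qed
      moreover have "I \<le> ennreal (l powr p * U powr k)"
      proof -
        have "ennreal_powr (1 / ennreal_powr (wmeasure (\<lambda>x. w x powr q) (ball x r)) k * I) (1 / p) \<le> ennreal l"
          unfolding l(2)[symmetric] morrey_norm_def I_def using r by (intro SUP_upper) (auto simp: balls_def)
        then have "ennreal_powr (ennreal_powr (1 / ennreal (U powr k) * I) (1 / p)) p \<le> ennreal_powr (ennreal l) p"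
          using p U by (intro ennreal_powr_mono) (auto simp: wmeas U_def)
        then have "1 / ennreal (U powr k) * I \<le> ennreal (l powr p)"
          using p l(1) by (simp add: ennreal_powr_powr)
        then have "ennreal (U powr k) * (I / ennreal (U powr k)) \<le> ennreal (U powr k) * ennreal (l powr p)"
          by (intro mult_left_mono) (auto simp: ennreal_times_divide mult.commute)
        then show ?thesis using U by (simp add: ennreal_mult_divide_cancel ennreal_mult mult.commute)
      qed
      ultimately show ?thesis by (simp add: U_def)
    qed
    define H where "H x = (\<integral>\<^sup>+y. riesz \<beta> x y * (ennreal (exp (e * norm (b x - b y))) * ennreal (norm (f y))) \<partial>lebesgue)" for x
    have [measurable]: "H \<in> borel_measurable lebesgue"
      unfolding H_def[abs_def] by (rule borel_measurable_riesz_kernel) measurable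
    have Hb: "(\<integral>\<^sup>+x\<in>ball x0 r. ennreal (u x) * ennreal_powr (H x) q \<partial>lebesgue) \<le> ennreal (C * l powr q * measure (wm u) (ball x0 r) powr (q * k / p))"
      if r: "0 < r" for x0 r
    proof -
      have "(l powr p) powr (q / p) = l powr q" using p by (simp add: powr_powr)
      then show ?thesis
        using morrey[of "\<lambda>y. ennreal (norm (f y))" "l powr p" r x0] mor r unfolding H_def by simp
    qed
    \<comment> \<open>The local bound makes u H^q integrable on every ball, and u is positive almost
      everywhere, so \<open>H\<close> is finite almost everywhere. This yields the existence of both
      oscillatory integrals.\<close>
    have Hfin: "AE x in lebesgue. H x < \<infinity>"
    proof (rule AE_lebesgue_ballI)
      fix r :: real assume r: "0 < r"
      have "(\<integral>\<^sup>+x\<in>ball 0 r. ennreal (u x) * ennreal_powr (H x) q \<partial>lebesgue) \<noteq> \<infinity>"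
        using Hb[OF r, of 0] by (auto simp: top_unique)
      then have "AE x in lebesgue. ennreal (u x) * ennreal_powr (H x) q * indicator (ball 0 r) x \<noteq> \<infinity>"
        by (intro nn_integral_PInf_AE) (auto intro!: borel_measurable_times_ennreal borel_measurable_indicator)
      then show "AE x in lebesgue. x \<in> ball 0 r \<longrightarrow> H x < \<infinity>"
        using dual by eventually_elim (auto simp: ennreal_mult_eq_top_iff less_top)
    qed
    note pw = commutator_pointwise[OF f b C0(1,2,4) P e(1)]
    show "osc_defined_ae P K f" unfolding osc_defined_ae_def
      using Hfin by eventually_elim (rule pw(1), auto simp: H_def)
    show "osc_defined_ae P K (\<lambda>y. b y * f y)" unfolding osc_defined_ae_def
      using Hfin by eventually_elim (rule pw(2), auto simp: H_def)
    have comm: "AE x in lebesgue. ennreal (norm (?cf x)) \<le> ennreal (C0 / e) * H x"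
      using Hfin unfolding H_def by eventually_elim (rule pw(3), auto)
    have cm: "?cf \<in> borel_measurable lebesgue"
    proof -
      have [measurable]: "osc_op P K f \<in> borel_measurable lebesgue" "osc_op P K (\<lambda>y. b y * f y) \<in> borel_measurable lebesgue"
        using C0(3,4) P by (auto intro!: borel_measurable_osc_op)
      show ?thesis unfolding commutator_def[abs_def] by measurable
    qed
    have "?norm' ?cf \<le> ennreal (C' * l)"
      unfolding morrey_norm_def
    proof (rule SUP_least)
      fix B :: "(real^'n) set" assume "B \<in> balls"
      then obtain x0 r where B: "B = ball x0 r" "0 < r" by (auto simp: balls_def)
      define U where "U = measure (wm u) (ball x0 r)"
      have U: "0 < U" unfolding U_def by (rule wm_ball_pos[OF B(2)])
      define I where "I = (\<integral>\<^sup>+x\<in>B. ennreal (norm (?cf x) powr q * w x powr q) \<partial>lebesgue)"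
      have "I \<le> (\<integral>\<^sup>+x. ennreal ((C0 / e) powr q) * (ennreal (u x) * ennreal_powr (H x) q * indicator B x) \<partial>lebesgue)"
        unfolding I_def
      proof (intro nn_integral_mono_AE, use comm in eventually_elim)
        fix x assume "ennreal (norm (?cf x)) \<le> ennreal (C0 / e) * H x"
        then have "ennreal_powr (ennreal (norm (?cf x))) q \<le> ennreal_powr (ennreal (C0 / e) * H x) q"
          using q0 by (intro ennreal_powr_mono) auto
        then have "ennreal (norm (?cf x) powr q) \<le> ennreal ((C0 / e) powr q) * ennreal_powr (H x) q"
          using C0(1) e(1) by (simp add: ennreal_powr_mult)
        then have "ennreal (norm (?cf x) powr q) * (ennreal (u x) * indicator B x) \<le> ennreal ((C0 / e) powr q) * ennreal_powr (H x) q * (ennreal (u x) * indicator B x)"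
          by (rule mult_right_mono) simp
        then show "ennreal (norm (?cf x) powr q * w x powr q) * indicator B x
          \<le> ennreal ((C0 / e) powr q) * (ennreal (u x) * ennreal_powr (H x) q * indicator B x)"
          by (simp add: ennreal_mult u_def mult_ac)
      qed
      also have "\<dots> = ennreal ((C0 / e) powr q) * (\<integral>\<^sup>+x\<in>B. ennreal (u x) * ennreal_powr (H x) q \<partial>lebesgue)"
      proof (rule nn_integral_cmult)
        have [measurable]: "B \<in> sets lebesgue" by (simp add: B)
        show "(\<lambda>x. ennreal (u x) * ennreal_powr (H x) q * indicator B x) \<in> borel_measurable lebesgue" by measurable
      qed
      also have "\<dots> \<le> ennreal ((C0 / e) powr q) * ennreal (C * l powr q * U powr (q * k / p))"
        unfolding B U_def by (intro mult_left_mono Hb B(2)) simp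
      also have "\<dots> = ennreal (U powr (q * k / p)) * ennreal ((C0 / e) powr q * (C * l powr q))"
        using e by (simp add: ennreal_mult[symmetric] mult_ac)
      finally have "1 / ennreal (U powr (q * k / p)) * I \<le> 1 / ennreal (U powr (q * k / p)) * (ennreal (U powr (q * k / p)) * ennreal ((C0 / e) powr q * (C * l powr q)))"
        by (rule mult_left_mono) simp
      also have "\<dots> = (1 / ennreal (U powr (q * k / p)) * ennreal (U powr (q * k / p))) * ennreal ((C0 / e) powr q * (C * l powr q))"
        by (simp only: mult.assoc)
      also have "1 / ennreal (U powr (q * k / p)) * ennreal (U powr (q * k / p)) = 1"
        using U by (simp add: ennreal_divide_times ennreal_divide_self)
      finally have "ennreal_powr (1 / ennreal (U powr (q * k / p)) * I) (1 / q) \<le> ennreal_powr (ennreal ((C0 / e) powr q * (C * l powr q))) (1 / q)"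
        using q0 by (intro ennreal_powr_mono) auto
      also have "\<dots> = ennreal (C' * l)"
        using C0(1) e l(1) q0 by (simp add: powr_mult powr_powr C'_def mult_ac)
      finally show "ennreal_powr (1 / ennreal_powr (wmeasure (\<lambda>x. w x powr q) B) (q * k / p) *
           (\<integral>\<^sup>+x\<in>B. ennreal (norm (?cf x) powr q * w x powr q) \<partial>lebesgue)) (1 / q) \<le> ennreal (C' * l)"
        unfolding I_def[symmetric] by (simp add: B wmeas U_def)
    qed
    then show "?norm' ?cf
             \<le> ennreal C' * ?norm f"
      using C' l by (simp add: ennreal_mult)
    then show "?cf \<in> morrey_space q (q * k / p) (\<lambda>x. w x powr q) (\<lambda>x. w x powr q)"
      using cm l by (auto simp: morrey_space_def ennreal_mult_less_top intro: le_less_trans)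
  qed
qed

end
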